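(* Let $\Phi:\mathbb{M}_d\to\mathbb{M}_d$ be a $k$-entanglement breaking ($k$-EB) map, where $1\leq k\leq d$. Then $C_\Phi$ is weakly majorized by both $(d-k+1)\,\mathrm{tr}_1(C_\Phi)$ and $(d-k+1)\,\mathrm{tr}_2(C_\Phi)$.
   Context: Here $d,k$ are positive integers and $\mathbb{M}_d$ is the algebra of complex $d\times d$ matrices; a superscript $+$ denotes the cone of positive semidefinite matrices. A linear map $\Phi:\mathbb{M}_d\to\mathbb{M}_d$ is $k$-positive if $\mathrm{id}_k\otimes\Phi:\mathbb{M}_k\otimes\mathbb{M}_d\to\mathbb{M}_k\otimes\mathbb{M}_d$ maps positive semidefinite matrices to positive semidefinite matrices, where $\mathrm{id}_k$ is the identity map of $\mathbb{M}_k$. A matrix $X\in(\mathbb{M}_m\otimes\mathbb{M}_n)^+$ is separable if $X=\sum_i A_i\otimes B_i$ (finite sum) with $A_i\in\mathbb{M}_m^+$, $B_i\in\mathbb{M}_n^+$. A linear map $\Phi$ is $k$-entanglement breaking ($k$-EB) if it is $k$-positive and $(\mathrm{id}_k\otimes\Phi)(X)$ is separable for every $X\in(\mathbb{M}_k\otimes\mathbb{M}_d)^+$; such a map is not required to be completely positive. The Choi matrix of $\Phi$ is $C_\Phi=\sum_{i,j=1}^d E_{ij}\otimes\Phi(E_{ij})\in\mathbb{M}_d\otimes\mathbb{M}_d$, where $E_{ij}$ are the standard matrix units; it is Hermitian when $\Phi$ is $k$-EB. The partial traces on $\mathbb{M}_d\otimes\mathbb{M}_d$ are the linear maps with $\mathrm{tr}_1(A\otimes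 B)=\mathrm{tr}(A)B$ and $\mathrm{tr}_2(A\otimes B)=\mathrm{tr}(B)A$. For $x\in\mathbb{R}^n$ let $x^\downarrow$ be the vector with the same entries sorted in descending order. For $x,y\in\mathbb{R}^n$, $x$ is weakly majorized by $y$ if $\sum_{i=1}^{l}x_i^\downarrow\leq\sum_{i=1}^{l}y_i^\downarrow$ for all $1\leq l\leq n$; if $x,y$ have different lengths, extra zeros are appended to the shorter one. For positive semidefinite matrices $A,B$ (possibly of different sizes), $A$ is weakly majorized by $B$ if the vector of all eigenvalues of $A$ (with multiplicity, in decreasing order) is weakly majorized by that of $B$; the same condition on the (real) eigenvalues is used when $A$ is only Hermitian. *)

theory Defs
  imports "Jordan_Normal_Form.Char_Poly" "Jordan_Normal_Form.Schur_Decomposition"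
begin

text \<open>
  An element of the tensor product of the \<open>m \<times> m\<close> and the \<open>n \<times> n\<close> matrices is represented by a
  matrix of size \<open>m * n\<close>: the row (or column) index \<open>i * n + r\<close> with \<open>r < n\<close> stands for the
  pair \<open>(i, r)\<close>, so that matrices are made of \<open>m \<times> m\<close> blocks of size \<open>n \<times> n\<close>.
\<close>

definition kron :: "complex mat \<Rightarrow> complex mat \<Rightarrow> complex mat" where
  "kron A B = mat (dim_row A * dim_row B) (dim_col A * dim_col B)
     (\<lambda>(i, j). A $$ (i div dim_row B, j div dim_col B) * B $$ (i mod dim_row B, j mod dim_col B))"

definition mat_sum :: "nat \<Rightarrow> ('a \<Rightarrow> complex mat) \<Rightarrow> 'a set \<Rightarrow> complex mat" where
  "mat_sum n f S = mat n n (\<lambda>(i, j). \<Sum>t\<in>S. f t $$ (i, j))"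

definition mat_unit :: "nat \<Rightarrow> nat \<Rightarrow> nat \<Rightarrow> complex mat" where
  "mat_unit d i j = mat d d (\<lambda>(r, s). if r = i \<and> s = j then 1 else 0)"

text \<open>The order on \<^typ>\<open>complex\<close> is the one for which \<open>0 \<le> z\<close> means that \<open>z\<close> is real and nonnegative.\<close>

definition psd :: "nat \<Rightarrow> complex mat \<Rightarrow> bool" where
  "psd n A \<longleftrightarrow> A \<in> carrier_mat n n \<and> mat_adjoint A = A \<and>
     (\<forall>v \<in> carrier_vec n. 0 \<le> (A *\<^sub>v v) \<bullet>c v)"

definition separable :: "nat \<Rightarrow> nat \<Rightarrow> complex mat \<Rightarrow> bool" where
  "separable m n X \<longleftrightarrow> psd (m * n) X \<and>
     (\<exists>(N::nat) A B. (\<forall>t<N. psd m (A t) \<and> psd n (B t)) \<and>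
        X = mat_sum (m * n) (\<lambda>t. kron (A t) (B t)) {..<N})"

definition linear_mat_map :: "nat \<Rightarrow> (complex mat \<Rightarrow> complex mat) \<Rightarrow> bool" where
  "linear_mat_map d \<Phi> \<longleftrightarrow>
     (\<forall>A \<in> carrier_mat d d. \<Phi> A \<in> carrier_mat d d) \<and>
     (\<forall>A \<in> carrier_mat d d. \<forall>B \<in> carrier_mat d d. \<Phi> (A + B) = \<Phi> A + \<Phi> B) \<and>
     (\<forall>c. \<forall>A \<in> carrier_mat d d. \<Phi> (c \<cdot>\<^sub>m A) = c \<cdot>\<^sub>m \<Phi> A)"

definition block :: "nat \<Rightarrow> complex mat \<Rightarrow> nat \<Rightarrow> nat \<Rightarrow> complex mat" where
  "block d X a b = mat d d (\<lambda>(r, s). X $$ (a * d + r, b * d + s))"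

text \<open>
  The map \<open>id\<^sub>k \<otimes> \<Phi>\<close>: it applies \<open>\<Phi>\<close> to each of the \<open>k \<times> k\<close> blocks. For linear \<open>\<Phi>\<close> it is the
  linear map with \<open>A \<otimes> B \<mapsto> A \<otimes> \<Phi> B\<close>, see \<open>id_tensor_kron\<close>, \<open>id_tensor_add\<close> and
  \<open>id_tensor_smult\<close> below.
\<close>

definition id_tensor :: "nat \<Rightarrow> nat \<Rightarrow> (complex mat \<Rightarrow> complex mat) \<Rightarrow> complex mat \<Rightarrow> complex mat" where
  "id_tensor k d \<Phi> X = mat (k * d) (k * d)
     (\<lambda>(i, j). \<Phi> (block d X (i div d) (j div d)) $$ (i mod d, j mod d))"

definition k_positive :: "nat \<Rightarrow> nat \<Rightarrow> (complex mat \<Rightarrow> complex mat) \<Rightarrow> bool" where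
  "k_positive k d \<Phi> \<longleftrightarrow> (\<forall>X. psd (k * d) X \<longrightarrow> psd (k * d) (id_tensor k d \<Phi> X))"

definition k_entanglement_breaking :: "nat \<Rightarrow> nat \<Rightarrow> (complex mat \<Rightarrow> complex mat) \<Rightarrow> bool" where
  "k_entanglement_breaking k d \<Phi> \<longleftrightarrow> k_positive k d \<Phi> \<and>
     (\<forall>X. psd (k * d) X \<longrightarrow> separable k d (id_tensor k d \<Phi> X))"

definition choi :: "nat \<Rightarrow> (complex mat \<Rightarrow> complex mat) \<Rightarrow> complex mat" where
  "choi d \<Phi> = mat_sum (d * d) (\<lambda>(i, j). kron (mat_unit d i j) (\<Phi> (mat_unit d i j)))
     ({..<d} \<times> {..<d})"

text \<open>The trace over the first and over the second tensor factor, see \<open>ptrace1_kron\<close> and \<open>ptrace2_kron\<close>.\<close>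

definition ptrace1 :: "nat \<Rightarrow> complex mat \<Rightarrow> complex mat" where
  "ptrace1 d X = mat d d (\<lambda>(r, s). \<Sum>i<d. X $$ (i * d + r, i * d + s))"

definition ptrace2 :: "nat \<Rightarrow> complex mat \<Rightarrow> complex mat" where
  "ptrace2 d X = mat d d (\<lambda>(i, j). \<Sum>r<d. X $$ (i * d + r, j * d + r))"

definition decreasing :: "real list \<Rightarrow> real list" where
  "decreasing xs = rev (sort xs)"

definition pad_zeros :: "nat \<Rightarrow> real list \<Rightarrow> real list" where
  "pad_zeros n xs = xs @ replicate (n - length xs) 0"

definition weakly_majorized :: "real list \<Rightarrow> real list \<Rightarrow> bool" where
  "weakly_majorized xs ys \<longleftrightarrow> (let n = max (length xs) (length ys) in
     \<forall>l \<in> {1..n}. sum_list (take l (decreasing (pad_zeros n xs)))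
                \<le> sum_list (take l (decreasing (pad_zeros n ys))))"

text \<open>
  The eigenvalues counted with multiplicity, in decreasing order. This is meant for Hermitian
  matrices, where the real part does not change the eigenvalues.
\<close>

definition eigenvalue_list :: "complex mat \<Rightarrow> real list" where
  "eigenvalue_list A = rev (sorted_list_of_multiset (image_mset Re (proots (char_poly A))))"

definition weakly_majorized_mat :: "complex mat \<Rightarrow> complex mat \<Rightarrow> bool" where
  "weakly_majorized_mat A B \<longleftrightarrow> weakly_majorized (eigenvalue_list A) (eigenvalue_list B)"

lemma block_index_less:
  fixes a k r d :: nat
  assumes "a < k" "r < d"
  shows "a * d + r < k * d"
proof -
  have "a * d + r < Suc a * d" using assms by simp
  also have "\<dots> \<le> k * d" using assms by (intro mult_right_mono) auto
  finally show ?thesis .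
qed

lemma block_kron:
  assumes "A \<in> carrier_mat k k" "B \<in> carrier_mat d d" "a < k" "b < k"
  shows "block d (kron A B) a b = (A $$ (a, b)) \<cdot>\<^sub>m B"
  using assms by (intro eq_matI) (auto simp: block_def kron_def block_index_less)

lemma id_tensor_kron:
  assumes "linear_mat_map d \<Phi>" "A \<in> carrier_mat k k" "B \<in> carrier_mat d d"
  shows "id_tensor k d \<Phi> (kron A B) = kron A (\<Phi> B)"
proof -
  have c: "\<Phi> B \<in> carrier_mat d d" using assms by (auto simp: linear_mat_map_def)
  show ?thesis
  proof (rule eq_matI)
    fix i j assume "i < dim_row (kron A (\<Phi> B))" "j < dim_col (kron A (\<Phi> B))"
    then have ij: "i < k * d" "j < k * d" using assms c by (auto simp: kron_def)
    then have d: "0 < d" by (cases d) auto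
    have div: "i div d < k" "j div d < k" using ij by (auto simp: less_mult_imp_div_less)
    have "\<Phi> (block d (kron A B) (i div d) (j div d)) = A $$ (i div d, j div d) \<cdot>\<^sub>m \<Phi> B"
      using assms div by (simp add: block_kron linear_mat_map_def)
    then show "id_tensor k d \<Phi> (kron A B) $$ (i, j) = kron A (\<Phi> B) $$ (i, j)"
      using ij d c assms by (simp add: id_tensor_def kron_def)
  qed (use assms c in \<open>auto simp: kron_def id_tensor_def\<close>)
qed

lemma id_tensor_add:
  assumes "linear_mat_map d \<Phi>" "X \<in> carrier_mat (k * d) (k * d)" "Y \<in> carrier_mat (k * d) (k * d)"
  shows "id_tensor k d \<Phi> (X + Y) = id_tensor k d \<Phi> X + id_tensor k d \<Phi> Y"
proof (rule eq_matI)
  fix i j assume "i < dim_row (id_tensor k d \<Phi> X + id_tensor k d \<Phi> Y)"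
    "j < dim_col (id_tensor k d \<Phi> X + id_tensor k d \<Phi> Y)"
  then have ij: "i < k * d" "j < k * d" by (auto simp: id_tensor_def)
  then have d: "0 < d" by (cases d) auto
  have div: "i div d < k" "j div d < k" using ij by (auto simp: less_mult_imp_div_less)
  have b: "block d Z a b \<in> carrier_mat d d" for Z a b by (simp add: block_def)
  have "block d (X + Y) (i div d) (j div d)
      = block d X (i div d) (j div d) + block d Y (i div d) (j div d)"
    using assms div by (intro eq_matI) (auto simp: block_def block_index_less)
  then have eq: "\<Phi> (block d (X + Y) (i div d) (j div d))
      = \<Phi> (block d X (i div d) (j div d)) + \<Phi> (block d Y (i div d) (j div d))"
    using assms b by (simp add: linear_mat_map_def)
  have "\<Phi> (block d Y (i div d) (j div d)) \<in> carrier_mat d d"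
    using assms b by (simp add: linear_mat_map_def)
  then show "id_tensor k d \<Phi> (X + Y) $$ (i, j)
      = (id_tensor k d \<Phi> X + id_tensor k d \<Phi> Y) $$ (i, j)"
    using ij d eq by (simp add: id_tensor_def)
qed (auto simp: id_tensor_def)

lemma id_tensor_smult:
  assumes "linear_mat_map d \<Phi>" "X \<in> carrier_mat (k * d) (k * d)"
  shows "id_tensor k d \<Phi> (c \<cdot>\<^sub>m X) = c \<cdot>\<^sub>m id_tensor k d \<Phi> X"
proof (rule eq_matI)
  fix i j assume "i < dim_row (c \<cdot>\<^sub>m id_tensor k d \<Phi> X)" "j < dim_col (c \<cdot>\<^sub>m id_tensor k d \<Phi> X)"
  then have ij: "i < k * d" "j < k * d" by (auto simp: id_tensor_def)
  then have d: "0 < d" by (cases d) auto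
  have div: "i div d < k" "j div d < k" using ij by (auto simp: less_mult_imp_div_less)
  have b: "block d Z a b \<in> carrier_mat d d" for Z a b by (simp add: block_def)
  have "block d (c \<cdot>\<^sub>m X) (i div d) (j div d) = c \<cdot>\<^sub>m block d X (i div d) (j div d)"
    using assms div by (intro eq_matI) (auto simp: block_def block_index_less)
  then have eq: "\<Phi> (block d (c \<cdot>\<^sub>m X) (i div d) (j div d)) = c \<cdot>\<^sub>m \<Phi> (block d X (i div d) (j div d))"
    using assms b by (simp add: linear_mat_map_def)
  have "\<Phi> (block d X (i div d) (j div d)) \<in> carrier_mat d d"
    using assms b by (simp add: linear_mat_map_def)
  then show "id_tensor k d \<Phi> (c \<cdot>\<^sub>m X) $$ (i, j) = (c \<cdot>\<^sub>m id_tensor k d \<Phi> X) $$ (i, j)"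
    using ij d eq by (simp add: id_tensor_def)
qed (auto simp: id_tensor_def)

lemma ptrace1_kron:
  assumes "A \<in> carrier_mat d d" "B \<in> carrier_mat d d"
  shows "ptrace1 d (kron A B) = (\<Sum>i<d. A $$ (i, i)) \<cdot>\<^sub>m B"
  using assms
  by (intro eq_matI) (auto simp: ptrace1_def kron_def block_index_less sum_distrib_right)

lemma ptrace2_kron:
  assumes "A \<in> carrier_mat d d" "B \<in> carrier_mat d d"
  shows "ptrace2 d (kron A B) = (\<Sum>r<d. B $$ (r, r)) \<cdot>\<^sub>m A"
  using assms
  by (intro eq_matI)
    (auto simp: ptrace2_def kron_def block_index_less sum_distrib_left mult.commute)

end

theory Submission
  imports Defs
begin

text \<open>
  Write \<open>A = (d - k + 1) tr\<^sub>2 C\<close> for the Choi matrix \<open>C\<close>; the case of \<open>tr\<^sub>1\<close> is the same with the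
  two tensor factors exchanged. The engine of the proof is that the reduction criterion implies
  majorization: if \<open>0 \<le> X \<le> A \<otimes> 1\<close> and \<open>tr\<^sub>2 X \<le> A\<close>, then the eigenvalues \<open>\<mu>\<^sub>t\<close> of \<open>X\<close> are
  \<open>\<mu>\<^sub>t = \<Sum>\<^sub>i D\<^sub>t\<^sub>i \<alpha>\<^sub>i\<close>, where \<open>\<alpha>\<^sub>i\<close> are the eigenvalues of \<open>A\<close> and \<open>D\<close> is doubly substochastic, so
  that \<open>X\<close> is weakly majorized by \<open>A\<close> (\<open>top_sum_le_of_diagonal_domination\<close>). The Choi matrix itself
  may fail to be positive, but the partial sums of the eigenvalues of any \<open>X \<ge> C\<close> are at
  least those of \<open>C\<close>. Hence it is enough to find such an \<open>X\<close> above \<open>C\<close>.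

  For \<open>k \<ge> 2\<close>, compress \<open>C\<close> in the first factor to \<open>k\<close> of the \<open>d\<close> vectors of an orthonormal basis.
  The result is the image of a maximally entangled vector of \<open>k\<close> terms under \<open>id\<^sub>k \<otimes> \<Phi>\<close>, hence separable,
  and separable matrices satisfy the reduction criterion. In the sum over all \<open>k\<close>-element sets of basis
  vectors an off-diagonal block of \<open>C\<close> is counted \<open>binom (d - 2, k - 2)\<close> times and a diagonal block
  \<open>binom (d - 1, k - 1)\<close> times. After division by the first number this is \<open>C\<close> plus a nonnegative
  multiple of its block diagonal, and its marginals, when diagonal in the chosen basis, are those of \<open>C\<close>
  times \<open>(d - 1) / (k - 1) \<le> d - k + 1\<close> (\<open>subset_average\<close>, \<open>keb_factor\<close>).

  For \<open>k = 1\<close> only \<open>\<Phi> (x x\<^sup>*) \<ge> 0\<close> is known. Insert vectors \<open>x\<close> with entries \<open>\<theta>\<^sub>p / \<surd>h\<^sub>p\<close> into \<open>\<Phi>\<close>,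
  test against vectors with weights \<open>\<theta>\<^sub>p \<surd>h\<^sub>p\<close>, and average over the phases \<open>\<theta>\<close>: what remains is
  \<open>X = C + \<Sum>\<^sub>i \<Sum>\<^sub>j\<^sub>\<noteq>\<^sub>i (h\<^sub>i / h\<^sub>j) E\<^sub>i\<^sub>i \<otimes> \<Phi> (E\<^sub>j\<^sub>j)\<close> (\<open>phase_average\<close>). Constant weights give the factor \<open>d\<close> for \<open>tr\<^sub>1\<close>;
  for \<open>tr\<^sub>2\<close> the weights are the eigenvalues of \<open>tr\<^sub>2 C\<close>, made positive by a small \<open>\<epsilon>\<close>.

  Both constructions want diagonal marginals, so everything is expressed in the product of an
  eigenbasis of \<open>tr\<^sub>2 C\<close> and an eigenbasis of \<open>tr\<^sub>1 C\<close>. To change bases and to index by pairs without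
  arithmetic on indices, matrices are replaced by complex-valued kernels on finite index sets.
\<close>

section \<open>Unitary diagonalization of Hermitian matrices\<close>

lemma mat_adjoint_carrier [simp]: "A \<in> carrier_mat n m \<Longrightarrow> mat_adjoint A \<in> carrier_mat m n"
  for A :: "complex mat"
  unfolding mat_adjoint_def by (auto simp: mat_of_rows_def)

lemma dim_mat_adjoint [simp]:
  "dim_row (mat_adjoint A) = dim_col A" "dim_col (mat_adjoint A) = dim_row A"
  for A :: "complex mat"
  unfolding mat_adjoint_def by auto

lemma mat_adjoint_index:
  fixes A :: "complex mat"
  assumes "A \<in> carrier_mat n m" "i < m" "j < n"
  shows "mat_adjoint A $$ (i, j) = cnj (A $$ (j, i))"
  using assms unfolding mat_adjoint_def by (auto simp: mat_of_rows_def)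

lemma index_mult_mat_sum:
  fixes A B :: "complex mat"
  assumes "A \<in> carrier_mat n m" "B \<in> carrier_mat m l" "i < n" "j < l"
  shows "(A * B) $$ (i, j) = (\<Sum>k<m. A $$ (i, k) * B $$ (k, j))"
  using assms by (auto simp: scalar_prod_def lessThan_atLeast0 intro!: sum.cong)

lemma mat_adjoint_mult:
  fixes A B :: "complex mat"
  assumes A: "A \<in> carrier_mat n m" and B: "B \<in> carrier_mat m l"
  shows "mat_adjoint (A * B) = mat_adjoint B * mat_adjoint A"
proof (rule eq_matI)
  have AB: "A * B \<in> carrier_mat n l" using A B by simp
  have A': "mat_adjoint A \<in> carrier_mat m n" and B': "mat_adjoint B \<in> carrier_mat l m"
    using A B by auto
  then have BA: "mat_adjoint B * mat_adjoint A \<in> carrier_mat l n" by simp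
  show "dim_row (mat_adjoint (A * B)) = dim_row (mat_adjoint B * mat_adjoint A)"
    "dim_col (mat_adjoint (A * B)) = dim_col (mat_adjoint B * mat_adjoint A)"
    using mat_adjoint_carrier[OF AB] BA by auto
  fix i j assume "i < dim_row (mat_adjoint B * mat_adjoint A)"
    "j < dim_col (mat_adjoint B * mat_adjoint A)"
  then have ij: "i < l" "j < n" using BA by auto
  have "mat_adjoint (A * B) $$ (i, j) = (\<Sum>k<m. cnj (A $$ (j, k)) * cnj (B $$ (k, i)))"
    by (simp add: mat_adjoint_index[OF AB ij] index_mult_mat_sum[OF A B ij(2,1)])
  also have "\<dots> = (mat_adjoint B * mat_adjoint A) $$ (i, j)"
    unfolding index_mult_mat_sum[OF B' A' ij]
    using ij A B by (intro sum.cong) (auto simp: mat_adjoint_index mult.commute)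
  finally show "mat_adjoint (A * B) $$ (i, j) = (mat_adjoint B * mat_adjoint A) $$ (i, j)" .
qed

lemma mat_adjoint_adjoint [simp]:
  fixes A :: "complex mat"
  shows "mat_adjoint (mat_adjoint A) = A"
proof -
  define n m where "n = dim_row A" and "m = dim_col A"
  have A: "A \<in> carrier_mat n m" by (simp add: n_def m_def)
  have A': "mat_adjoint A \<in> carrier_mat m n" using A by simp
  show ?thesis
    using A carrier_matD[OF mat_adjoint_carrier[OF A']]
    by (intro eq_matI) (auto simp: mat_adjoint_index[OF A'] mat_adjoint_index[OF A])
qed

text \<open>
  The columns of \<open>W\<close> come from the Gram--Schmidt orthogonalization of a basis that starts with \<open>v\<close>;
  they only have to be divided by their norms.
\<close>

lemma unitary_with_first_column:
  fixes v :: "complex vec"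
  assumes v: "v \<in> carrier_vec n" "v \<noteq> 0\<^sub>v n"
  obtains W where "W \<in> carrier_mat n n" "mat_adjoint W * W = 1\<^sub>m n"
    "\<exists>c. c \<noteq> 0 \<and> col W 0 = c \<cdot>\<^sub>v v" "0 < n"
proof -
  interpret cof_vec_space n "TYPE(complex)" .
  define b where "b = basis_completion v"
  define ws where "ws = gram_schmidt n b"
  from basis_completion[OF v, folded b_def]
  have dist_b: "distinct b" and indep: "\<not> lin_dep (set b)" and b: "set b \<subseteq> carrier_vec n"
    and hdb: "hd b = v" and len_b: "length b = n" by auto
  have n: "0 < n" using v by (cases n) auto
  from hdb len_b n obtain vs where bv: "b = v # vs" by (cases b, auto)
  from gram_schmidt_result[OF b dist_b indep refl, folded ws_def]
  have ws: "set ws \<subseteq> carrier_vec n" "corthogonal ws" "length ws = n"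
    by (auto simp: len_b)
  from gram_schmidt_hd[OF v(1), of vs, folded bv] have hdws: "hd ws = v" unfolding ws_def .
  have w: "ws ! i \<in> carrier_vec n" if "i < n" for i using ws that by auto
  define c where "c i = complex_of_real (1 / sqrt (Re (ws ! i \<bullet>c ws ! i)))" for i
  define W where "W = mat n n (\<lambda>(r, i). c i * ws ! i $ r)"
  have W: "W \<in> carrier_mat n n" by (simp add: W_def)
  have pos: "ws ! i \<bullet>c ws ! i > 0" if "i < n" for i
  proof -
    have "ws ! i \<bullet>c ws ! i \<noteq> 0" using ws that by (auto simp: corthogonal_def)
    moreover have "ws ! i \<bullet>c ws ! i \<ge> 0" by (rule conjugate_square_ge_0_vec)
    ultimately show ?thesis by order
  qed
  have sq: "cnj (c i) * c i * (ws ! i \<bullet>c ws ! i) = 1" if "i < n" for i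
  proof -
    have "ws ! i \<bullet>c ws ! i = complex_of_real (Re (ws ! i \<bullet>c ws ! i))" "0 < Re (ws ! i \<bullet>c ws ! i)"
      using pos[OF that] by (auto simp: complex_eq_iff less_complex_def)
    then obtain x where x: "ws ! i \<bullet>c ws ! i = complex_of_real x" "0 < x" by blast
    then show ?thesis 
      by (simp add: c_def flip: of_real_mult)
  qed
  have "mat_adjoint W * W = 1\<^sub>m n"
  proof (rule eq_matI)
    fix i j assume "i < dim_row (1\<^sub>m n :: complex mat)" "j < dim_col (1\<^sub>m n :: complex mat)"
    then have ij: "i < n" "j < n" by auto
    have "(mat_adjoint W * W) $$ (i, j) = (\<Sum>r<n. cnj (W $$ (r, i)) * W $$ (r, j))"
      unfolding index_mult_mat_sum[OF mat_adjoint_carrier[OF W] W ij]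
      using ij by (intro sum.cong) (auto simp: mat_adjoint_index[OF W])
    also have "\<dots> = cnj (c i) * c j * (ws ! j \<bullet>c ws ! i)"
      using ij carrier_vecD[OF w[OF ij(1)]] by (auto simp: W_def scalar_prod_def sum_distrib_left lessThan_atLeast0 intro!: sum.cong)
    also have "\<dots> = 1\<^sub>m n $$ (i, j)"
      using ij sq ws by (cases "i = j") (auto simp: corthogonal_def)
    finally show "(mat_adjoint W * W) $$ (i, j) = 1\<^sub>m n $$ (i, j)" .
  next
    show "dim_row (mat_adjoint W * W) = dim_row (1\<^sub>m n :: complex mat)"
      using W by simp
    show "dim_col (mat_adjoint W * W) = dim_col (1\<^sub>m n :: complex mat)"
      using W by simp
  qed
  moreover have "col W 0 = c 0 \<cdot>\<^sub>v v"
    using hd_conv_nth[of ws] hdws ws(3) n v w[OF n] by (intro eq_vecI) (cases ws; auto simp: W_def)+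
  moreover have "c 0 \<noteq> 0" using sq[OF n] by auto
  ultimately show ?thesis using that W n by blast
qed

text \<open>
  This follows the induction of \<open>schur_decomposition\<close>, but with normalized columns at each step: the similarity
  produced there is a product of matrices with orthogonal columns of different lengths and need not be
  unitary. Since a unitary similarity preserves hermiticity, the row beside each split-off eigenvalue
  vanishes together with the column, and the triangular form is diagonal.
\<close>

theorem hermitian_unitary_diagonalization:
  fixes A :: "complex mat"
  assumes "A \<in> carrier_mat n n" "mat_adjoint A = A"
    and "char_poly A = (\<Prod>e\<leftarrow>es. [:- e, 1:])"
  shows "\<exists>P B. similar_mat_wit A B P (mat_adjoint P) \<and> diagonal_mat B \<and> diag_mat B = es"
  using assms
proof (induction es arbitrary: n A)
  case Nil
  with degree_monic_char_poly[of A n] have n: "n = 0" by auto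
  with Nil have "A \<in> carrier_mat 0 0" by auto
  then have "similar_mat_wit A A (1\<^sub>m 0) (mat_adjoint (1\<^sub>m 0))" 
    using carrier_matD[OF mat_adjoint_carrier[OF one_carrier_mat[of 0]]]
    by (intro similar_mat_witI[of _ _ 0]) (auto intro!: eq_matI)
  moreover have "diagonal_mat A" "diag_mat A = []" using \<open>A \<in> carrier_mat 0 0\<close> 
    by (auto simp: diagonal_mat_def diag_mat_def)
  ultimately show ?case by blast
next
  case (Cons e es)
  let ?n1 = "n - 1"
  note A = Cons.prems(1)
  have cp: "char_poly A = [:- e, 1:] * (\<Prod>e\<leftarrow>es. [:- e, 1:])" using Cons.prems(3) by simp
  have "eigenvalue A e" unfolding eigenvalue_root_char_poly[OF A] cp by simp
  then obtain v where "eigenvector A v e" unfolding eigenvalue_def by blast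
  then have v: "v \<in> carrier_vec n" "v \<noteq> 0\<^sub>v n" "A *\<^sub>v v = e \<cdot>\<^sub>v v"
    using A unfolding eigenvector_def by auto
  obtain W c where W: "W \<in> carrier_mat n n" and WW: "mat_adjoint W * W = 1\<^sub>m n"
    and c: "c \<noteq> 0" "col W 0 = c \<cdot>\<^sub>v v" and n: "0 < n"
    using unitary_with_first_column[OF v(1,2)] by metis
  have W': "mat_adjoint W \<in> carrier_mat n n" using W by simp
  have WW': "W * mat_adjoint W = 1\<^sub>m n" by (rule mat_mult_left_right_inverse[OF W' W WW])
  define A' where "A' = mat_adjoint W * A * W"
  have A': "A' \<in> carrier_mat n n" unfolding A'_def by (rule mult_carrier_mat[OF mult_carrier_mat[OF W' A] W])
  have herm: "mat_adjoint A' = A'"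
    unfolding A'_def using W W' A Cons.prems(2)
    by (simp add: mat_adjoint_mult[of _ n n _ n] assoc_mult_mat[of _ n n _ n _ n])
  have "W * (mat_adjoint W * (A * W)) = A * W"
    using assoc_mult_mat[OF W W' mult_carrier_mat[OF A W]] WW' A W by simp
  moreover have "A * W * mat_adjoint W = A"
    using assoc_mult_mat[OF A W W'] WW' A by simp
  ultimately have "W * A' * mat_adjoint W = A"
    unfolding A'_def assoc_mult_mat[OF W' A W] by simp
  then have simW: "similar_mat_wit A A' W (mat_adjoint W)"
    by (intro similar_mat_witI[OF WW' WW _ A A' W W']) simp
  have col0: "col A' 0 = vec n (\<lambda>i. if i = 0 then e else 0)"
  proof -
    have "col A' 0 = (mat_adjoint W * A) *\<^sub>v col W 0"
      unfolding A'_def by (rule col_mult2[OF mult_carrier_mat[OF W' A] W n])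
    also have "\<dots> = mat_adjoint W *\<^sub>v (A *\<^sub>v col W 0)"
      using W by (intro assoc_mult_mat_vec[OF W' A]) (auto simp: carrier_vecI)
    also have "A *\<^sub>v col W 0 = e \<cdot>\<^sub>v col W 0"
      unfolding c(2) using v A by (simp add: mult_mat_vec smult_smult_assoc mult.commute)
    also have "mat_adjoint W *\<^sub>v (e \<cdot>\<^sub>v col W 0) = e \<cdot>\<^sub>v (mat_adjoint W *\<^sub>v col W 0)"
      using W W' by (intro mult_mat_vec[of _ n n]) auto
    also have "mat_adjoint W *\<^sub>v col W 0 = col (mat_adjoint W * W) 0"
      by (rule col_mult2[OF W' W n, symmetric])
    also have "e \<cdot>\<^sub>v \<dots> = vec n (\<lambda>i. if i = 0 then e else 0)"
      unfolding WW using n by (intro eq_vecI) auto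
    finally show ?thesis .
  qed
  have A'0: "A' $$ (i, 0) = (if i = 0 then e else 0)" if "i < n" for i
    using arg_cong[OF col0, of "\<lambda>u. u $ i"] that A' by auto
  have A'0': "A' $$ (0, i) = 0" if "i < n" "i \<noteq> 0" for i
    using mat_adjoint_index[OF A', of 0 i] that n A'0[of i] unfolding herm by auto
  define A3 where "A3 = mat ?n1 ?n1 (\<lambda>(i, j). A' $$ (Suc i, Suc j))"
  have A3: "A3 \<in> carrier_mat ?n1 ?n1" by (simp add: A3_def)
  define A1 where "A1 = mat 1 1 (\<lambda>_. e)"
  have A1: "A1 \<in> carrier_mat 1 1" by (simp add: A1_def)
  have block: "A' = four_block_mat A1 (0\<^sub>m 1 ?n1) (0\<^sub>m ?n1 1) A3"
    using A' n A'0 A'0'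
    by (intro eq_matI) (auto simp: A1_def A3_def four_block_mat_def Let_def)
  have "char_poly A = char_poly A'"
    using simW by (intro char_poly_similar) (auto simp: similar_mat_def)
  also have "\<dots> = char_poly A1 * char_poly A3"
    unfolding block by (rule char_poly_four_block_zeros_col[OF A1 _ A3]) simp
  also have "char_poly A1 = [:- e, 1:]"
    by (simp add: A1_def char_poly_defs det_def sign_def)
  finally have cp3: "char_poly A3 = (\<Prod>e\<leftarrow>es. [:- e, 1:])"
    unfolding cp by (metis mult_cancel_left pCons_eq_0_iff zero_neq_one)
  have herm3: "mat_adjoint A3 = A3"
  proof (rule eq_matI)
    fix i j assume "i < dim_row A3" "j < dim_col A3"
    then have "i < ?n1" "j < ?n1" using A3 by auto
    then show "mat_adjoint A3 $$ (i, j) = A3 $$ (i, j)"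
      using mat_adjoint_index[OF A', of "Suc i" "Suc j"] 
      unfolding mat_adjoint_index[OF A3 \<open>i < ?n1\<close> \<open>j < ?n1\<close>] herm
      by (auto simp: A3_def)
  qed (use A3 in auto)
  from Cons.IH[OF A3 herm3 cp3] obtain P B where PB: "similar_mat_wit A3 B P (mat_adjoint P)"
    "diagonal_mat B" "diag_mat B = es" by blast
  from similar_mat_witD2[OF A3 PB(1)] have B: "B \<in> carrier_mat ?n1 ?n1"
    and P: "P \<in> carrier_mat ?n1 ?n1" and P': "mat_adjoint P \<in> carrier_mat ?n1 ?n1" by auto
  let ?P = "four_block_mat (1\<^sub>m 1) (0\<^sub>m 1 ?n1) (0\<^sub>m ?n1 1) P"
  let ?Q = "four_block_mat (1\<^sub>m 1) (0\<^sub>m 1 ?n1) (0\<^sub>m ?n1 1) (mat_adjoint P)"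
  let ?B = "four_block_mat A1 (0\<^sub>m 1 ?n1) (0\<^sub>m ?n1 1) B"
  have P4: "?P \<in> carrier_mat n n" and Q4: "?Q \<in> carrier_mat n n"
    using P P' n four_block_carrier_mat[of "1\<^sub>m 1" 1 1 P ?n1 ?n1]
      four_block_carrier_mat[of "1\<^sub>m 1" 1 1 "mat_adjoint P" ?n1 ?n1] by auto
  have "similar_mat_wit A' ?B ?P ?Q"
    unfolding block
    by (rule similar_mat_wit_four_block[OF similar_mat_wit_refl[OF A1] PB(1) _ _ A1 A3])
      (use P P' in auto)
  from similar_mat_wit_trans[OF simW this]
  have "similar_mat_wit A ?B (W * ?P) (?Q * mat_adjoint W)" .
  moreover have "?Q = mat_adjoint ?P"
  proof (rule eq_matI)
    fix i j assume "i < dim_row (mat_adjoint ?P)" "j < dim_col (mat_adjoint ?P)"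
    then have ij: "i < n" "j < n" using mat_adjoint_carrier[OF P4] by auto
    show "?Q $$ (i, j) = mat_adjoint ?P $$ (i, j)"
      unfolding mat_adjoint_index[OF P4 ij]
      using ij P P' by (auto simp: mat_adjoint_index[OF P])
  qed (use Q4 mat_adjoint_carrier[OF P4] in auto)
  ultimately have "similar_mat_wit A ?B (W * ?P) (mat_adjoint (W * ?P))"
    using mat_adjoint_mult[OF W P4] by simp
  moreover have "diagonal_mat ?B"
    using PB(2) A1 B by (auto simp: diagonal_mat_def)
  moreover have "diag_mat ?B = e # es"
    using diag_four_block_mat[OF A1 B] PB(3) by (simp add: A1_def diag_mat_def)
  ultimately show ?case by blast
qed

section \<open>Positive semidefinite kernels on finite index sets\<close>

definition qform :: "'i set \<Rightarrow> ('i \<Rightarrow> 'i \<Rightarrow> complex) \<Rightarrow> ('i \<Rightarrow> complex) \<Rightarrow> complex" where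
  "qform I K v = (\<Sum>a\<in>I. \<Sum>b\<in>I. cnj (v a) * K a b * v b)"

definition pos_kernel :: "'i set \<Rightarrow> ('i \<Rightarrow> 'i \<Rightarrow> complex) \<Rightarrow> bool" where
  "pos_kernel I K \<longleftrightarrow> (\<forall>v. 0 \<le> qform I K v)"

definition cip :: "'i set \<Rightarrow> ('i \<Rightarrow> complex) \<Rightarrow> ('i \<Rightarrow> complex) \<Rightarrow> complex" where
  "cip I u v = (\<Sum>a\<in>I. cnj (u a) * v a)"

text \<open>
  The index sets of the vectors and of their entries are unrelated, so completeness is demanded along
  with orthonormality instead of being derived from a dimension count.
\<close>

definition orthonormal_basis :: "'j set \<Rightarrow> 'i set \<Rightarrow> ('j \<Rightarrow> 'i \<Rightarrow> complex) \<Rightarrow> bool" where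
  "orthonormal_basis J I e \<longleftrightarrow>
     (\<forall>s\<in>J. \<forall>t\<in>J. cip I (e s) (e t) = (if s = t then 1 else 0)) \<and>
     (\<forall>a\<in>I. \<forall>b\<in>I. (\<Sum>t\<in>J. e t a * cnj (e t b)) = (if a = b then 1 else 0))"

lemma mult_cnj_self: "z * cnj z = (of_real (cmod z))\<^sup>2" "cnj z * z = (of_real (cmod z))\<^sup>2"
  using complex_norm_square[of z] by (simp_all add: mult.commute)

lemma zero_le_complex_of_real_iff: "0 \<le> complex_of_real x \<longleftrightarrow> 0 \<le> x"
  by (simp add: less_eq_complex_def)

lemma qform_cong:
  assumes "\<And>a b. a \<in> I \<Longrightarrow> b \<in> I \<Longrightarrow> K a b = L a b"
  shows "qform I K v = qform I L v"
  using assms unfolding qform_def by (intro sum.cong refl) auto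

lemma pos_kernel_cong:
  assumes "\<And>a b. a \<in> I \<Longrightarrow> b \<in> I \<Longrightarrow> K a b = L a b"
  shows "pos_kernel I K = pos_kernel I L"
  using qform_cong[of I K L, OF assms] unfolding pos_kernel_def by simp

lemma qform_add: "qform I (\<lambda>a b. K a b + L a b) v = qform I K v + qform I L v"
  by (simp add: qform_def algebra_simps sum.distrib)

lemma qform_diff: "qform I (\<lambda>a b. K a b - L a b) v = qform I K v - qform I L v"
  by (simp add: qform_def algebra_simps sum_subtractf)

lemma qform_scale: "qform I (\<lambda>a b. c * K a b) v = c * qform I K v"
  by (simp add: qform_def sum_distrib_left algebra_simps)

lemma qform_sum:
  "qform I (\<lambda>a b. \<Sum>t\<in>S. K t a b) v = (\<Sum>t\<in>S. qform I (K t) v)"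
proof -
  have "qform I (\<lambda>a b. \<Sum>t\<in>S. K t a b) v = (\<Sum>a\<in>I. \<Sum>b\<in>I. \<Sum>t\<in>S. cnj (v a) * K t a b * v b)"
    by (simp add: qform_def sum_distrib_left sum_distrib_right)
  also have "\<dots> = (\<Sum>a\<in>I. \<Sum>t\<in>S. \<Sum>b\<in>I. cnj (v a) * K t a b * v b)"
    by (intro sum.cong refl sum.swap)
  also have "\<dots> = (\<Sum>t\<in>S. qform I (K t) v)"
    unfolding qform_def by (rule sum.swap)
  finally show ?thesis .
qed

lemma qform_rank_one:
  "qform I (\<lambda>a b. u a * cnj (u b)) v = of_real ((cmod (cip I u v))\<^sup>2)"
proof -
  have "qform I (\<lambda>a b. u a * cnj (u b)) v = cnj (cip I u v) * cip I u v"
    by (simp add: qform_def cip_def sum_product algebra_simps)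
  also have "\<dots> = of_real ((cmod (cip I u v))\<^sup>2)"
    by (simp only: complex_norm_square mult.commute)
  finally show ?thesis .
qed

lemma qform_diagonal:
  assumes "finite I"
  shows "qform I (\<lambda>a b. if a = b then of_real (r a) else 0) v
    = of_real (\<Sum>a\<in>I. r a * (cmod (v a))\<^sup>2)"
proof -
  have "qform I (\<lambda>a b. if a = b then of_real (r a) else 0) v
    = (\<Sum>a\<in>I. \<Sum>b\<in>I. if a = b then of_real (r a) * (v a * cnj (v a)) else 0)"
    unfolding qform_def by (intro sum.cong refl) auto
  also have "\<dots> = (\<Sum>a\<in>I. of_real (r a) * (v a * cnj (v a)))"
    using assms by (simp add: sum.delta)
  finally show ?thesis by (simp add: mult_cnj_self)
qed

lemma qform_spectral:
  assumes "\<And>a b. a \<in> I \<Longrightarrow> b \<in> I \<Longrightarrow> K a b = (\<Sum>t\<in>J. of_real (\<mu> t) * (e t a * cnj (e t b)))"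
  shows "qform I K v = of_real (\<Sum>t\<in>J. \<mu> t * (cmod (cip I (e t) v))\<^sup>2)"
  by (subst qform_cong[OF assms]) (simp_all add: qform_sum qform_scale qform_rank_one)

lemma parseval:
  assumes "finite I" "orthonormal_basis J I e"
  shows "(\<Sum>t\<in>J. (cmod (cip I (e t) v))\<^sup>2) = (\<Sum>a\<in>I. (cmod (v a))\<^sup>2)"
proof -
  have "qform I (\<lambda>a b. if a = b then of_real 1 else 0) v = of_real (\<Sum>t\<in>J. 1 * (cmod (cip I (e t) v))\<^sup>2)"
    using assms(2) by (intro qform_spectral) (auto simp: orthonormal_basis_def)
  moreover have "qform I (\<lambda>a b. if a = b then of_real 1 else 0) v = of_real (\<Sum>a\<in>I. 1 * (cmod (v a))\<^sup>2)"
    by (rule qform_diagonal[OF assms(1)])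
  ultimately show ?thesis by (simp only: of_real_eq_iff mult_1)
qed

lemma sum_of_norm_squares_eq_1:
  assumes "orthonormal_basis J I e" "t \<in> J"
  shows "(\<Sum>a\<in>I. (cmod (e t a))\<^sup>2) = 1"
proof -
  have "complex_of_real (\<Sum>a\<in>I. (cmod (e t a))\<^sup>2) = cip I (e t) (e t)"
    by (simp add: cip_def mult_cnj_self)
  also have "\<dots> = complex_of_real 1" using assms by (simp add: orthonormal_basis_def)
  finally show ?thesis by (simp only: of_real_eq_iff)
qed

lemma qform_restrict:
  assumes "finite I" "S \<subseteq> I" "\<And>a. a \<in> I - S \<Longrightarrow> v a = 0"
  shows "qform I K v = qform S K v"
proof -
  have "qform I K v = (\<Sum>a\<in>S. \<Sum>b\<in>I. cnj (v a) * K a b * v b)"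
    unfolding qform_def using assms by (intro sum.mono_neutral_right) auto
  also have "\<dots> = qform S K v"
    unfolding qform_def using assms by (intro sum.cong sum.mono_neutral_right) auto
  finally show ?thesis .
qed

text \<open>
  Polarization, by vectors with at most two nonzero entries. It yields that a kernel with real
  quadratic form is Hermitian.
\<close>

lemma qform_eq_0_imp:
  assumes I: "finite I" and 0: "\<And>v. qform I K v = 0" and ab: "a \<in> I" "b \<in> I"
  shows "K a b = 0"
proof -
  have diag: "K c c = 0" if "c \<in> I" for c
  proof -
    have "qform {c} K (\<lambda>x. if x = c then 1 else 0) = 0"
      using qform_restrict[OF I, of "{c}" "\<lambda>x. if x = c then 1 else 0" K] that 0 by auto
    then show ?thesis by (simp add: qform_def)
  qed
  show ?thesis
  proof (cases "a = b")
    case False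
    have *: "c * K a b + cnj c * K b a = 0" for c
    proof -
      let ?v = "\<lambda>x. if x = a then 1 else if x = b then c else 0"
      have "qform {a, b} K ?v = 0"
        using qform_restrict[OF I, of "{a, b}" ?v K] ab 0 by auto
      then show ?thesis using False diag ab by (simp add: qform_def algebra_simps)
    qed
    from *[of 1] have "K b a = - K a b" by (simp add: add_eq_0_iff)
    with *[of \<i>] show ?thesis by simp
  qed (use diag ab in auto)
qed

lemma cnj_qform: "cnj (qform I K v) = qform I (\<lambda>a b. cnj (K b a)) v"
  unfolding qform_def by (simp add: algebra_simps) (rule sum.swap)

lemma pos_kernel_hermitian:
  assumes "finite I" "pos_kernel I K" "a \<in> I" "b \<in> I"
  shows "K b a = cnj (K a b)"
proof -
  have "qform I (\<lambda>a b. K a b - cnj (K b a)) v = 0" for v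
  proof -
    have "cnj (qform I K v) = qform I K v"
      using assms(2) by (auto simp: pos_kernel_def less_eq_complex_def complex_eq_iff)
    then show ?thesis by (simp add: qform_diff cnj_qform[symmetric])
  qed
  from qform_eq_0_imp[OF assms(1) this assms(4,3)] show ?thesis by simp
qed

lemma cip_reindex:
  assumes "bij_betw h I' I"
  shows "cip I u v = cip I' (u \<circ> h) (v \<circ> h)"
  unfolding cip_def using sum.reindex_bij_betw[OF assms, symmetric] by simp

lemma qform_reindex:
  assumes "bij_betw h I' I"
  shows "qform I K v = qform I' (\<lambda>a b. K (h a) (h b)) (v \<circ> h)"
  unfolding qform_def
  by (subst sum.reindex_bij_betw[OF assms, symmetric], intro sum.cong refl)
    (subst sum.reindex_bij_betw[OF assms, symmetric], simp)

lemma orthonormal_basis_reindex: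
  assumes "bij_betw h I' I" "orthonormal_basis J I' e"
  shows "orthonormal_basis J I (\<lambda>t a. e t (inv_into I' h a))"
proof -
  have "bij_betw (inv_into I' h) I I'" using assms(1) by (rule bij_betw_inv_into)
  then have "cip I' (e s) (e t) = cip I (\<lambda>a. e s (inv_into I' h a)) (\<lambda>a. e t (inv_into I' h a))" for s t
    using cip_reindex[of "inv_into I' h" I I' "e s" "e t"] by (simp add: o_def)
  moreover have "inv_into I' h a \<in> I'" if "a \<in> I" for a
    using that assms(1) by (metis bij_betw_imp_surj_on inv_into_into)
  moreover have "(inv_into I' h a = inv_into I' h b) = (a = b)" if "a \<in> I" "b \<in> I" for a b
    using that assms(1) by (metis bij_betw_imp_surj_on inv_into_injective)
  ultimately show ?thesis using assms(2) unfolding orthonormal_basis_def by auto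
qed

lemma pos_kernel_add:
  assumes "pos_kernel I K" "pos_kernel I L"
  shows "pos_kernel I (\<lambda>a b. K a b + L a b)"
  using assms by (simp add: pos_kernel_def qform_add)

lemma pos_kernel_sum:
  assumes "\<And>t. t \<in> S \<Longrightarrow> pos_kernel I (K t)"
  shows "pos_kernel I (\<lambda>a b. \<Sum>t\<in>S. K t a b)"
  using assms by (simp add: pos_kernel_def qform_sum sum_nonneg)

lemma pos_kernel_scale:
  assumes "pos_kernel I K" "0 \<le> c"
  shows "pos_kernel I (\<lambda>a b. of_real c * K a b)"
  using assms by (auto simp: pos_kernel_def qform_scale less_eq_complex_def)

lemma pos_kernel_diagonal:
  assumes "finite I" "\<And>a. a \<in> I \<Longrightarrow> 0 \<le> r a"
  shows "pos_kernel I (\<lambda>a b. if a = b then of_real (r a) else 0)"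
  unfolding pos_kernel_def qform_diagonal[OF assms(1)]
  using assms(2) by (auto simp: less_eq_complex_def intro!: sum_nonneg)

lemma pos_kernel_diag_nonneg:
  assumes "finite I" "pos_kernel I K" "a \<in> I"
  shows "0 \<le> K a a"
proof -
  have "0 \<le> qform {a} K (\<lambda>x. if x = a then 1 else 0)"
    using qform_restrict[OF assms(1), of "{a}" "\<lambda>x. if x = a then 1 else 0" K] assms(3)
      assms(2)[unfolded pos_kernel_def, rule_format, of "\<lambda>x. if x = a then 1 else 0"] by simp
  then show ?thesis by (simp add: qform_def)
qed

lemma pos_kernel_extend:
  assumes "finite I" "T \<subseteq> I" "pos_kernel T K"
  shows "pos_kernel I (\<lambda>a b. if a \<in> T \<and> b \<in> T then K a b else 0)"
proof -
  have "qform I (\<lambda>a b. if a \<in> T \<and> b \<in> T then K a b else 0) v = qform T K v" for v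
  proof -
    have "qform I (\<lambda>a b. if a \<in> T \<and> b \<in> T then K a b else 0) v
      = (\<Sum>a\<in>T. \<Sum>b\<in>I. cnj (v a) * (if a \<in> T \<and> b \<in> T then K a b else 0) * v b)"
      unfolding qform_def using assms by (intro sum.mono_neutral_right) auto
    also have "\<dots> = qform T K v"
      unfolding qform_def using assms by (intro sum.cong refl sum.mono_neutral_cong_right) auto
    finally show ?thesis .
  qed
  then show ?thesis using assms(3) by (simp add: pos_kernel_def)
qed

lemma pos_kernel_eqI:
  assumes "pos_kernel I K" "\<And>a b. a \<in> I \<Longrightarrow> b \<in> I \<Longrightarrow> K a b = L a b"
  shows "pos_kernel I L"
  using assms pos_kernel_cong by metis

lemma pos_kernel_scaleD:
  assumes "pos_kernel I (\<lambda>a b. of_real c * K a b)" "0 < c"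
  shows "pos_kernel I K"
  using pos_kernel_scale[OF assms(1), of "1 / c"] assms(2)
  by (simp flip: of_real_mult mult.assoc)

lemma pos_kernel_reindex:
  assumes "bij_betw h I' I" "pos_kernel I' (\<lambda>a b. K (h a) (h b))"
  shows "pos_kernel I K"
  using assms(2) by (simp add: pos_kernel_def qform_reindex[OF assms(1)])

section \<open>Spectral decompositions\<close>

lemma sorted_rev_eigenvalue_list: "sorted (rev (eigenvalue_list A))"
  by (simp add: eigenvalue_list_def)

text \<open>
  The order of the eigenvalues in a unitary diagonalization can be prescribed. The diagonal entries are real because
  the diagonal form of a Hermitian matrix is Hermitian; therefore taking real parts in \<open>eigenvalue_list\<close>
  loses nothing, and its decreasing order can be used for the eigenvectors.
\<close>

theorem hermitian_spectral_decomposition: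
  fixes A :: "complex mat"
  assumes A: "A \<in> carrier_mat n n" and herm: "mat_adjoint A = A"
  defines "es \<equiv> eigenvalue_list A"
  shows "length es = n"
    and "\<exists>u. orthonormal_basis {..<n} {..<n} u \<and> (\<forall>i<n. \<forall>j<n.
      A $$ (i, j) = (\<Sum>t<n. of_real (es ! t) * (u t i * cnj (u t j))))"
proof -
  have char_poly: "char_poly A = (\<Prod>c\<leftarrow>cs. [:- c, 1:])" if "mset cs = proots (char_poly A)" for cs
  proof -
    have "smult (lead_coeff (char_poly A)) (\<Prod>x\<in>#proots (char_poly A). [:-x, 1:]) = char_poly A"
      by (rule complex_poly_decompose_multiset)
    then have "char_poly A = (\<Prod>x\<in>#mset cs. [:-x, 1:])"
      using degree_monic_char_poly[OF A] that by simp
    then show ?thesis by (metis mset_map prod_mset_prod_list)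
  qed
  have len: "length cs = n" if "mset cs = proots (char_poly A)" for cs
  proof -
    have "length cs = size (proots (char_poly A))" by (metis size_mset that)
    then show ?thesis using degree_monic_char_poly[OF A] by (simp add: size_proots_complex)
  qed
  have diag: "\<exists>u. orthonormal_basis {..<n} {..<n} u \<and> (\<forall>i<n. \<forall>j<n.
      A $$ (i, j) = (\<Sum>t<n. cs ! t * (u t i * cnj (u t j)))) \<and> (\<forall>t<n. cs ! t \<in> \<real>)"
    if cs: "mset cs = proots (char_poly A)" for cs
  proof -
    obtain P B where PB: "similar_mat_wit A B P (mat_adjoint P)" "diagonal_mat B" "diag_mat B = cs"
      using hermitian_unitary_diagonalization[OF A herm char_poly[OF cs]] by blast
    from similar_mat_witD2[OF A PB(1)] have B: "B \<in> carrier_mat n n" and P: "P \<in> carrier_mat n n"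
      and P': "mat_adjoint P \<in> carrier_mat n n" and PP': "P * mat_adjoint P = 1\<^sub>m n"
      and P'P: "mat_adjoint P * P = 1\<^sub>m n" and AB: "A = P * B * mat_adjoint P" by blast+
    have Bij: "B $$ (i, j) = (if i = j then cs ! i else 0)" if "i < n" "j < n" for i j
      using that PB(2,3) B by (auto simp: diagonal_mat_def diag_mat_def)
    define u where "u t i = P $$ (i, t)" for t i
    have PB: "(P * B) $$ (i, t) = u t i * cs ! t" if "i < n" "t < n" for i t
      unfolding index_mult_mat_sum[OF P B that] using that
      by (subst sum.mono_neutral_right[of _ "{t}"]) (auto simp: Bij u_def)
    have A_eq: "A $$ (i, j) = (\<Sum>t<n. cs ! t * (u t i * cnj (u t j)))" if "i < n" "j < n" for i j
    proof -
      have "A $$ (i, j) = (P * B * mat_adjoint P) $$ (i, j)" using AB by simp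
      also have "\<dots> = (\<Sum>t<n. (P * B) $$ (i, t) * mat_adjoint P $$ (t, j))"
        by (rule index_mult_mat_sum[OF mult_carrier_mat[OF P B] P' that])
      also have "\<dots> = (\<Sum>t<n. cs ! t * (u t i * cnj (u t j)))"
        using that by (intro sum.cong refl) (simp add: PB mat_adjoint_index[OF P] u_def)
      finally show ?thesis .
    qed
    have "cip {..<n} (u s) (u t) = (if s = t then 1 else 0)" if "s < n" "t < n" for s t
    proof -
      have "cip {..<n} (u s) (u t) = (mat_adjoint P * P) $$ (s, t)"
        unfolding index_mult_mat_sum[OF P' P that] cip_def
        using that by (intro sum.cong refl) (simp add: mat_adjoint_index[OF P] u_def)
      then show ?thesis using that by (simp add: P'P)
    qed
    moreover have "(\<Sum>t<n. u t i * cnj (u t j)) = (if i = j then 1 else 0)" if "i < n" "j < n" for i j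
    proof -
      have "(\<Sum>t<n. u t i * cnj (u t j)) = (P * mat_adjoint P) $$ (i, j)"
        unfolding index_mult_mat_sum[OF P P' that]
        using that by (intro sum.cong refl) (simp add: mat_adjoint_index[OF P] u_def)
      then show ?thesis using that by (simp add: PP')
    qed
    moreover have "cs ! t \<in> \<real>" if "t < n" for t
    proof -
      have "mat_adjoint P * (P * B * mat_adjoint P) * P = B"
        using P P' B P'P PP'
        by (smt (verit) assoc_mult_mat left_mult_one_mat mult_carrier_mat right_mult_one_mat)
      then have "mat_adjoint B = mat_adjoint (mat_adjoint P * (A * P))"
        using AB A P P' by (metis assoc_mult_mat)
      also have "\<dots> = mat_adjoint P * A * P"
        by (subst mat_adjoint_mult[OF P' mult_carrier_mat[OF A P]],
            subst mat_adjoint_mult[OF A P]) (simp add: herm)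
      also have "\<dots> = B"
        using \<open>mat_adjoint P * (P * B * mat_adjoint P) * P = B\<close> AB by simp
      finally have "cnj (cs ! t) = cs ! t"
        using mat_adjoint_index[OF B that that] Bij[OF that that] by simp
      then show ?thesis by (simp add: Reals_cnj_iff)
    qed
    ultimately show ?thesis using A_eq unfolding orthonormal_basis_def by (intro exI[of _ u]) auto
  qed
  have mset_es: "mset es = image_mset Re (proots (char_poly A))"
    unfolding es_def eigenvalue_list_def by simp
  obtain cs where cs: "mset cs = proots (char_poly A)" using ex_mset by blast
  have "set cs \<subseteq> \<real>" using diag[OF cs] len[OF cs] by (auto simp: in_set_conv_nth)
  then have "c \<in> \<real>" if "c \<in># proots (char_poly A)" for c
    using that cs by (metis set_mset_mset subsetD)
  then have "image_mset (complex_of_real \<circ> Re) (proots (char_poly A)) = image_mset id (proots (char_poly A))"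
    by (intro image_mset_cong) (auto elim: Reals_cases)
  then have mset: "mset (map complex_of_real es) = proots (char_poly A)"
    by (simp add: mset_es image_mset.compositionality)
  from len[OF this] show n: "length es = n" by simp
  from diag[OF mset] obtain u where u: "orthonormal_basis {..<n} {..<n} u"
    "\<forall>i<n. \<forall>j<n. A $$ (i, j) = (\<Sum>t<n. map complex_of_real es ! t * (u t i * cnj (u t j)))" by blast
  from u n show "\<exists>u. orthonormal_basis {..<n} {..<n} u \<and> (\<forall>i<n. \<forall>j<n.
      A $$ (i, j) = (\<Sum>t<n. of_real (es ! t) * (u t i * cnj (u t j))))"
    by (intro exI[of _ u]) simp
qed

theorem pos_kernel_spectral:
  assumes I: "finite I" and K: "pos_kernel I K"
  obtains J :: "nat set" and \<mu> e where "finite J" "orthonormal_basis J I e" "\<And>t. t \<in> J \<Longrightarrow> 0 \<le> \<mu> t"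
    "\<And>a b. a \<in> I \<Longrightarrow> b \<in> I \<Longrightarrow> K a b = (\<Sum>t\<in>J. of_real (\<mu> t) * (e t a * cnj (e t b)))"
proof -
  define n where "n = card I"
  obtain h where h: "bij_betw h {..<n} I"
    using ex_bij_betw_nat_finite[OF I] by (auto simp: n_def atLeast0LessThan)
  define A where "A = mat n n (\<lambda>(i, j). K (h i) (h j))"
  have A: "A \<in> carrier_mat n n" by (simp add: A_def)
  have hI: "h i \<in> I" if "i < n" for i using h that by (auto simp: bij_betw_def)
  have "mat_adjoint A = A"
  proof (rule eq_matI)
    fix i j assume "i < dim_row A" "j < dim_col A"
    then have ij: "i < n" "j < n" using A by auto
    then show "mat_adjoint A $$ (i, j) = A $$ (i, j)"
      using pos_kernel_hermitian[OF I K hI[OF ij(2)] hI[OF ij(1)]]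
      unfolding mat_adjoint_index[OF A ij] by (simp add: A_def)
  qed (use A in auto)
  from hermitian_spectral_decomposition(2)[OF A this] obtain u where
    u: "orthonormal_basis {..<n} {..<n} u" and
    A_eq: "\<And>i j. i < n \<Longrightarrow> j < n \<Longrightarrow>
      A $$ (i, j) = (\<Sum>t<n. of_real (eigenvalue_list A ! t) * (u t i * cnj (u t j)))" by blast
  define e where "e t a = u t (inv_into {..<n} h a)" for t a
  have e: "orthonormal_basis {..<n} I e"
    unfolding e_def by (rule orthonormal_basis_reindex[OF h u])
  have inv: "inv_into {..<n} h a < n" "h (inv_into {..<n} h a) = a" if "a \<in> I" for a
    using h that by (auto simp: bij_betw_def f_inv_into_f dest: inv_into_into[of a h "{..<n}"])
  have K_eq: "K a b = (\<Sum>t<n. of_real (eigenvalue_list A ! t) * (e t a * cnj (e t b)))"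
    if "a \<in> I" "b \<in> I" for a b
    using A_eq[of "inv_into {..<n} h a" "inv_into {..<n} h b"] inv that by (simp add: A_def e_def)
  have "0 \<le> eigenvalue_list A ! t" if "t < n" for t
  proof -
    have "qform I K (e t) = of_real (\<Sum>s<n. eigenvalue_list A ! s * (cmod (cip I (e s) (e t)))\<^sup>2)"
      by (rule qform_spectral[OF K_eq])
    also have "(\<Sum>s<n. eigenvalue_list A ! s * (cmod (cip I (e s) (e t)))\<^sup>2)
      = (\<Sum>s<n. if s = t then eigenvalue_list A ! s else 0)"
      using e that by (intro sum.cong) (auto simp: orthonormal_basis_def)
    also have "\<dots> = eigenvalue_list A ! t" using that by (simp add: sum.delta)
    finally show ?thesis
      using K unfolding pos_kernel_def by (metis Re_complex_of_real less_eq_complex_def zero_complex.sel(1))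
  qed
  then show ?thesis using that[of "{..<n}" e] e K_eq by blast
qed

text \<open>
  Each eigenvalue of a positive kernel is at most the sum of all of them. This is the source of the
  reduction criterion for separable kernels.
\<close>

lemma trace_minus_pos_kernel:
  assumes I: "finite I" and K: "pos_kernel I K"
  shows "pos_kernel I (\<lambda>a b. (if a = b then (\<Sum>c\<in>I. K c c) else 0) - K a b)"
proof -
  obtain J :: "nat set" and \<mu> e where J: "finite J" "orthonormal_basis J I e" "\<And>t. t \<in> J \<Longrightarrow> 0 \<le> \<mu> t"
    and K_eq: "\<And>a b. a \<in> I \<Longrightarrow> b \<in> I \<Longrightarrow> K a b = (\<Sum>t\<in>J. of_real (\<mu> t) * (e t a * cnj (e t b)))"
    using pos_kernel_spectral[OF I K] by metis
  define \<tau> where "\<tau> = (\<Sum>t\<in>J. \<mu> t)"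
  have "(\<Sum>c\<in>I. K c c) = (\<Sum>c\<in>I. \<Sum>t\<in>J. of_real (\<mu> t) * (e t c * cnj (e t c)))"
    by (intro sum.cong refl K_eq)
  also have "\<dots> = (\<Sum>t\<in>J. of_real (\<mu> t) * cip I (e t) (e t))"
    unfolding cip_def sum_distrib_left by (subst sum.swap) (simp add: mult.commute)
  also have "\<dots> = of_real \<tau>"
    using J(2) by (simp add: orthonormal_basis_def \<tau>_def)
  finally have tr: "(\<Sum>c\<in>I. K c c) = of_real \<tau>" .
  have "qform I (\<lambda>a b. (if a = b then (\<Sum>c\<in>I. K c c) else 0) - K a b) v
    = of_real (\<Sum>t\<in>J. (\<tau> - \<mu> t) * (cmod (cip I (e t) v))\<^sup>2)" for v
  proof -
    have "qform I (\<lambda>a b. if a = b then of_real \<tau> else 0) v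
      = of_real (\<Sum>t\<in>J. \<tau> * (cmod (cip I (e t) v))\<^sup>2)"
      unfolding qform_diagonal[OF I, of "\<lambda>_. \<tau>"] by (simp only: parseval[OF I J(2)] flip: sum_distrib_left)
    moreover have "qform I K v = of_real (\<Sum>t\<in>J. \<mu> t * (cmod (cip I (e t) v))\<^sup>2)"
      by (rule qform_spectral[OF K_eq])
    ultimately show ?thesis
      unfolding tr qform_diff by (simp only: left_diff_distrib sum_subtractf of_real_diff)
  qed
  moreover have "\<mu> t \<le> \<tau>" if "t \<in> J" for t
    unfolding \<tau>_def using J that by (intro member_le_sum) auto
  ultimately show ?thesis
    unfolding pos_kernel_def by (auto simp: less_eq_complex_def intro!: sum_nonneg)
qed

section \<open>Weak majorization from domination by a diagonal\<close>

lemma cmod_cip_commute: "cmod (cip I u v) = cmod (cip I v u)"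
proof -
  have "cip I u v = cnj (cip I v u)" by (simp add: cip_def mult.commute)
  then show ?thesis by simp
qed

text \<open>
  Shifting \<open>\<alpha>\<close> by its entry of index \<open>l\<close> makes the entries before \<open>l\<close> nonnegative and the later ones nonpositive,
  so the weights \<open>1\<close> before \<open>l\<close> and \<open>0\<close> afterwards are optimal.
\<close>

lemma sum_le_sum_largest:
  fixes \<alpha> s :: "nat \<Rightarrow> real"
  assumes nonneg: "\<And>i. i < d \<Longrightarrow> 0 \<le> \<alpha> i"
    and mono: "\<And>i j. i \<le> j \<Longrightarrow> j < d \<Longrightarrow> \<alpha> j \<le> \<alpha> i"
    and s: "\<And>i. i < d \<Longrightarrow> 0 \<le> s i" "\<And>i. i < d \<Longrightarrow> s i \<le> 1" "(\<Sum>i<d. s i) \<le> real l"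
  shows "(\<Sum>i<d. \<alpha> i * s i) \<le> (\<Sum>i<min l d. \<alpha> i)"
proof (cases "d \<le> l")
  case True
  have "(\<Sum>i<d. \<alpha> i * s i) \<le> (\<Sum>i<d. \<alpha> i)"
    using nonneg s by (intro sum_mono) (simp add: mult_left_le)
  then show ?thesis using True by (simp add: min_def)
next
  case False
  have "(\<Sum>i<d. \<alpha> i * s i) = (\<Sum>i<d. (\<alpha> i - \<alpha> l) * s i) + \<alpha> l * (\<Sum>i<d. s i)"
    by (simp add: sum_distrib_left algebra_simps flip: sum.distrib)
  also have "\<dots> \<le> (\<Sum>i<d. if i < l then \<alpha> i - \<alpha> l else 0) + \<alpha> l * real l"
  proof (intro add_mono sum_mono mult_left_mono)
    fix i assume "i \<in> {..<d}"
    then show "(\<alpha> i - \<alpha> l) * s i \<le> (if i < l then \<alpha> i - \<alpha> l else 0)"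
      using s(1,2)[of i] mono[of i l] mono[of l i] False
      by (auto intro: mult_left_le mult_nonpos_nonneg)
  qed (use nonneg[of l] s(3) False in auto)
  also have "(\<Sum>i<d. if i < l then \<alpha> i - \<alpha> l else 0) = (\<Sum>i<l. \<alpha> i - \<alpha> l)"
    using False by (intro sum.mono_neutral_cong_right) auto
  finally show ?thesis using False by (simp add: sum_subtractf mult.commute)
qed

text \<open>
  The map \<open>\<kappa>\<close> groups the basis vectors into the eigenspaces of a matrix \<open>A\<close> on one tensor factor, so that
  \<open>A \<otimes> 1\<close> is the diagonal kernel with entries \<open>\<alpha> (\<kappa> a)\<close>, and the sum over a fibre of \<open>\<kappa>\<close> is a diagonal entry of a
  partial trace. With \<open>w\<^sub>t\<^sub>i\<close> the squared length of the part of the eigenvector \<open>e\<^sub>t\<close> in the \<open>i\<close>-th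
  group, \<open>D\<^sub>t\<^sub>i = \<mu>\<^sub>t w\<^sub>t\<^sub>i / \<alpha>\<^sub>i\<close> satisfies \<open>\<mu>\<^sub>t = \<Sum>\<^sub>i D\<^sub>t\<^sub>i \<alpha>\<^sub>i\<close>. Its column sums are at most \<open>1\<close> by the bound on the
  fibre sums. For its row sums, test \<open>X \<le> A \<otimes> 1\<close> on \<open>f = (A\<^sup>-\<^sup>1 \<otimes> 1) e\<^sub>t\<close>: with \<open>q = \<langle>e\<^sub>t, f\<rangle>\<close> this gives
  \<open>\<mu>\<^sub>t q\<^sup>2 \<le> \<langle>f, X f\<rangle> \<le> q\<close>, and \<open>\<mu>\<^sub>t q\<close> is the row sum. Passing from the \<open>e\<^sub>t\<close> to other orthonormal vectors
  \<open>u\<^sub>j\<close> costs another substochastic average, with weights \<open>p\<^sub>t\<close>.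
\<close>

theorem top_sum_le_of_diagonal_domination:
  fixes X :: "'i \<Rightarrow> 'i \<Rightarrow> complex" and \<alpha> :: "nat \<Rightarrow> real"
  assumes I: "finite I" and \<kappa>: "\<And>a. a \<in> I \<Longrightarrow> \<kappa> a < d"
    and \<alpha>: "\<And>i. i < d \<Longrightarrow> 0 \<le> \<alpha> i" "\<And>i j. i \<le> j \<Longrightarrow> j < d \<Longrightarrow> \<alpha> j \<le> \<alpha> i"
    and e: "orthonormal_basis J I e" "finite J" "\<And>t. t \<in> J \<Longrightarrow> 0 \<le> \<mu> t"
      "\<And>a b. a \<in> I \<Longrightarrow> b \<in> I \<Longrightarrow> X a b = (\<Sum>t\<in>J. of_real (\<mu> t) * (e t a * cnj (e t b)))"
    and dom: "pos_kernel I (\<lambda>a b. (if a = b then of_real (\<alpha> (\<kappa> a)) else 0) - X a b)"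
    and diag: "\<And>i. i < d \<Longrightarrow> (\<Sum>a\<in>{a \<in> I. \<kappa> a = i}. Re (X a a)) \<le> \<alpha> i"
    and u: "orthonormal_basis {..<n} I u" "l \<le> n"
  shows "(\<Sum>j<l. Re (qform I X (u j))) \<le> (\<Sum>i<min l d. \<alpha> i)"
proof -
  define w where "w t i = (\<Sum>a\<in>{a \<in> I. \<kappa> a = i}. (cmod (e t a))\<^sup>2)" for t i
  define D where "D t i = \<mu> t * w t i / \<alpha> i" for t i
  define p where "p t = (\<Sum>j<l. (cmod (cip I (e t) (u j)))\<^sup>2)" for t
  have group: "(\<Sum>a\<in>I. g (\<kappa> a) * f a) = (\<Sum>i<d. g i * (\<Sum>a\<in>{a \<in> I. \<kappa> a = i}. f a))"
    for g f :: "_ \<Rightarrow> real"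
  proof -
    have "(\<Sum>i<d. g i * (\<Sum>a\<in>{a \<in> I. \<kappa> a = i}. f a)) = (\<Sum>i<d. \<Sum>a\<in>{a \<in> I. \<kappa> a = i}. g (\<kappa> a) * f a)"
      by (auto simp: sum_distrib_left intro!: sum.cong)
    also have "\<dots> = (\<Sum>a\<in>I. g (\<kappa> a) * f a)"
      using I \<kappa> by (intro sum.group) auto
    finally show ?thesis by simp
  qed
  have w0: "0 \<le> w t i" for t i unfolding w_def by (intro sum_nonneg) auto
  have D0: "0 \<le> D t i" if "t \<in> J" "i < d" for t i
    unfolding D_def using w0 \<alpha>(1) e(3) that by auto
  have Xdiag: "Re (X a a) = (\<Sum>t\<in>J. \<mu> t * (cmod (e t a))\<^sup>2)" if "a \<in> I" for a
    using e(4)[OF that that] by (simp add: complex_norm_square[symmetric])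
  have col: "(\<Sum>t\<in>J. \<mu> t * w t i) \<le> \<alpha> i" if "i < d" for i
  proof -
    have "(\<Sum>t\<in>J. \<mu> t * w t i) = (\<Sum>a\<in>{a \<in> I. \<kappa> a = i}. \<Sum>t\<in>J. \<mu> t * (cmod (e t a))\<^sup>2)"
      unfolding w_def sum_distrib_left by (rule sum.swap)
    also have "\<dots> = (\<Sum>a\<in>{a \<in> I. \<kappa> a = i}. Re (X a a))"
      by (intro sum.cong) (auto simp: Xdiag)
    finally show ?thesis using diag[OF that] by simp
  qed
  have D\<alpha>: "\<alpha> i * D t i = \<mu> t * w t i" if "t \<in> J" "i < d" for t i
  proof (cases "\<alpha> i = 0")
    case True
    have "\<mu> t * w t i \<le> (\<Sum>t\<in>J. \<mu> t * w t i)"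
      using that e w0 by (intro member_le_sum) auto
    then have "\<mu> t * w t i = 0"
      using col[OF that(2)] True e(3)[OF that(1)] w0[of t i] by (smt (verit) mult_nonneg_nonneg)
    then show ?thesis using True by simp
  qed (simp add: D_def)
  have Dcol: "(\<Sum>t\<in>J. D t i) \<le> 1" if "i < d" for i
    using col[OF that] \<alpha>(1)[OF that]
    by (cases "\<alpha> i = 0") (auto simp: D_def divide_le_eq simp flip: sum_divide_distrib)
  have Drow: "(\<Sum>i<d. D t i) \<le> 1" if t: "t \<in> J" for t
  proof -
    define q where "q = (\<Sum>i<d. w t i / \<alpha> i)"
    define f where "f a = e t a / of_real (\<alpha> (\<kappa> a))" for a
    have q0: "0 \<le> q" unfolding q_def using w0 \<alpha>(1) by (intro sum_nonneg) auto
    have q: "q = (\<Sum>a\<in>I. (cmod (e t a))\<^sup>2 / \<alpha> (\<kappa> a))"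
      using group[of "\<lambda>i. 1 / \<alpha> i" "\<lambda>a. (cmod (e t a))\<^sup>2"] by (simp add: q_def w_def)
    \<comment> \<open>Where \<open>\<alpha>\<close> vanishes, \<open>f\<close> is zero because division by zero gives zero, so \<open>f\<close> is the pseudo-inverse applied to \<open>e t\<close>.\<close>
    have "cip I (e t) f = of_real q"
      unfolding q cip_def f_def
      by (auto simp: mult_cnj_self intro!: sum.cong)
    then have "(cmod (cip I (e t) f))\<^sup>2 = q\<^sup>2" by simp
    then have "\<mu> t * q\<^sup>2 \<le> (\<Sum>s\<in>J. \<mu> s * (cmod (cip I (e s) f))\<^sup>2)"
      using member_le_sum[of t J "\<lambda>s. \<mu> s * (cmod (cip I (e s) f))\<^sup>2"] t e by auto
    also have "\<dots> \<le> (\<Sum>a\<in>I. \<alpha> (\<kappa> a) * (cmod (f a))\<^sup>2)"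
    proof -
      have "qform I X f = of_real (\<Sum>s\<in>J. \<mu> s * (cmod (cip I (e s) f))\<^sup>2)"
        by (rule qform_spectral[OF e(4)])
      with dom[unfolded pos_kernel_def, rule_format, of f]
      show ?thesis
        unfolding qform_diff qform_diagonal[OF I]
        by (simp only: zero_le_complex_of_real_iff diff_ge_0_iff_ge flip: of_real_diff)
    qed
    also have "\<dots> = q"
      unfolding q f_def using \<alpha>(1) \<kappa>
      by (auto simp: norm_divide power_divide power2_eq_square intro!: sum.cong)
    finally have "\<mu> t * q * q \<le> 1 * q" by (simp add: power2_eq_square mult.assoc)
    then have "\<mu> t * q \<le> 1" using q0 by (cases "q = 0") auto
    then show ?thesis unfolding q_def D_def by (simp add: sum_distrib_left)
  qed
  have p0: "0 \<le> p t" for t unfolding p_def by (intro sum_nonneg) auto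
  have p1: "p t \<le> 1" if "t \<in> J" for t
  proof -
    have "p t \<le> (\<Sum>j<n. (cmod (cip I (e t) (u j)))\<^sup>2)"
      unfolding p_def using u(2) by (intro sum_mono2) auto
    also have "\<dots> = (\<Sum>j<n. (cmod (cip I (u j) (e t)))\<^sup>2)" by (simp add: cmod_cip_commute[of I "e t"])
    also have "\<dots> = 1" using parseval[OF I u(1)] sum_of_norm_squares_eq_1[OF e(1) that] by simp
    finally show ?thesis .
  qed
  have psum: "(\<Sum>t\<in>J. p t) = real l"
  proof -
    have "(\<Sum>t\<in>J. p t) = (\<Sum>j<l. \<Sum>t\<in>J. (cmod (cip I (e t) (u j)))\<^sup>2)"
      unfolding p_def by (rule sum.swap)
    also have "\<dots> = (\<Sum>j<l. 1)"
      using parseval[OF I e(1)] sum_of_norm_squares_eq_1[OF u(1)] u(2) by (intro sum.cong) auto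
    finally show ?thesis by simp
  qed
  have "(\<Sum>j<l. Re (qform I X (u j))) = (\<Sum>j<l. \<Sum>t\<in>J. \<mu> t * (cmod (cip I (e t) (u j)))\<^sup>2)"
    by (simp add: qform_spectral[OF e(4)])
  also have "\<dots> = (\<Sum>t\<in>J. \<mu> t * p t)"
    unfolding p_def sum_distrib_left by (rule sum.swap)
  also have "\<dots> = (\<Sum>t\<in>J. (\<Sum>i<d. \<alpha> i * D t i) * p t)"
  proof (intro sum.cong refl)
    fix t assume t: "t \<in> J"
    have "(\<Sum>i<d. w t i) = (\<Sum>a\<in>I. (cmod (e t a))\<^sup>2)"
      using group[of "\<lambda>i. 1" "\<lambda>a. (cmod (e t a))\<^sup>2"] by (simp add: w_def)
    then have "(\<Sum>i<d. w t i) = 1" using sum_of_norm_squares_eq_1[OF e(1) t] by simp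
    then have "(\<Sum>i<d. \<mu> t * w t i) = \<mu> t" by (simp flip: sum_distrib_left)
    then show "\<mu> t * p t = (\<Sum>i<d. \<alpha> i * D t i) * p t" using D\<alpha>[OF t] by simp
  qed
  also have "\<dots> = (\<Sum>t\<in>J. \<Sum>i<d. \<alpha> i * (D t i * p t))"
    by (simp add: sum_distrib_right mult.assoc)
  also have "\<dots> = (\<Sum>i<d. \<alpha> i * (\<Sum>t\<in>J. D t i * p t))"
    unfolding sum_distrib_left by (rule sum.swap)
  also have "\<dots> \<le> (\<Sum>i<min l d. \<alpha> i)"
  proof (rule sum_le_sum_largest[OF \<alpha>])
    fix i assume i: "i < d"
    show "0 \<le> (\<Sum>t\<in>J. D t i * p t)" using D0 p0 i by (intro sum_nonneg) auto
    have "(\<Sum>t\<in>J. D t i * p t) \<le> (\<Sum>t\<in>J. D t i)"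
      using D0 p1 i by (intro sum_mono mult_left_le) auto
    then show "(\<Sum>t\<in>J. D t i * p t) \<le> 1" using Dcol[OF i] by simp
  next
    have "(\<Sum>i<d. \<Sum>t\<in>J. D t i * p t) = (\<Sum>t\<in>J. (\<Sum>i<d. D t i) * p t)"
      unfolding sum_distrib_right by (rule sum.swap)
    also have "\<dots> \<le> (\<Sum>t\<in>J. 1 * p t)"
      using Drow p0 by (intro sum_mono mult_right_mono) auto
    finally show "(\<Sum>i<d. \<Sum>t\<in>J. D t i * p t) \<le> real l" using psum by simp
  qed auto
  finally show ?thesis .
qed

text \<open>
  The eigenvalues \<open>lam\<close> belong to \<open>C\<close>, and they are only compared with \<open>X\<close> through its quadratic form on
  the eigenvectors of \<open>C\<close>.
\<close>

lemma eigenvalue_sum_le: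
  fixes \<alpha> lam :: "nat \<Rightarrow> real" and C X :: "'i \<Rightarrow> 'i \<Rightarrow> complex"
  assumes I: "finite I" and \<kappa>: "\<And>a. a \<in> I \<Longrightarrow> \<kappa> a < d"
    and \<alpha>: "\<And>i. i < d \<Longrightarrow> 0 \<le> \<alpha> i" "\<And>i j. i \<le> j \<Longrightarrow> j < d \<Longrightarrow> \<alpha> j \<le> \<alpha> i"
    and X: "pos_kernel I X" and CX: "pos_kernel I (\<lambda>a b. X a b - C a b)"
    and dom: "pos_kernel I (\<lambda>a b. (if a = b then of_real (\<alpha> (\<kappa> a)) else 0) - X a b)"
    and diag: "\<And>i. i < d \<Longrightarrow> (\<Sum>a\<in>{a \<in> I. \<kappa> a = i}. Re (X a a)) \<le> \<alpha> i"
    and u: "orthonormal_basis {..<n} I u" "l \<le> n"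
      "\<And>a b. a \<in> I \<Longrightarrow> b \<in> I \<Longrightarrow> C a b = (\<Sum>t<n. of_real (lam t) * (u t a * cnj (u t b)))"
  shows "(\<Sum>j<l. lam j) \<le> (\<Sum>i<min l d. \<alpha> i)"
proof -
  have "lam j \<le> Re (qform I X (u j))" if "j < l" for j
  proof -
    have "qform I C (u j) = of_real (\<Sum>t<n. lam t * (cmod (cip I (u t) (u j)))\<^sup>2)"
      by (rule qform_spectral[OF u(3)])
    also have "(\<Sum>t<n. lam t * (cmod (cip I (u t) (u j)))\<^sup>2) = (\<Sum>t<n. if t = j then lam t else 0)"
      using u(1,2) that by (intro sum.cong) (auto simp: orthonormal_basis_def)
    also have "\<dots> = lam j" using that u(2) by simp
    finally have "qform I C (u j) = of_real (lam j)" .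
    moreover have "0 \<le> qform I X (u j) - qform I C (u j)"
      using CX unfolding pos_kernel_def qform_diff by blast
    ultimately show ?thesis by (simp add: less_eq_complex_def)
  qed
  then have "(\<Sum>j<l. lam j) \<le> (\<Sum>j<l. Re (qform I X (u j)))" by (intro sum_mono) auto
  also obtain J :: "nat set" and \<mu> e where e: "finite J" "orthonormal_basis J I e" "\<And>t. t \<in> J \<Longrightarrow> 0 \<le> \<mu> t"
    "\<And>a b. a \<in> I \<Longrightarrow> b \<in> I \<Longrightarrow> X a b = (\<Sum>t\<in>J. of_real (\<mu> t) * (e t a * cnj (e t b)))"
    by (rule pos_kernel_spectral[OF I X]) blast
  have "(\<Sum>j<l. Re (qform I X (u j))) \<le> (\<Sum>i<min l d. \<alpha> i)"
    by (rule top_sum_le_of_diagonal_domination[OF I \<kappa> \<alpha> e(2,1,3,4) dom diag u(1,2)])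
  finally show ?thesis .
qed

section \<open>Tensor products and separable kernels\<close>

lemma qform_Times:
  "qform (S \<times> R) K v = (\<Sum>p\<in>S. \<Sum>q\<in>S. \<Sum>r\<in>R. \<Sum>s\<in>R. cnj (v (p, r)) * K (p, r) (q, s) * v (q, s))"
proof -
  have "qform (S \<times> R) K v = (\<Sum>p\<in>S. \<Sum>r\<in>R. \<Sum>q\<in>S. \<Sum>s\<in>R. cnj (v (p, r)) * K (p, r) (q, s) * v (q, s))"
    unfolding qform_def by (simp only: sum.cartesian_product')
  also have "\<dots> = (\<Sum>p\<in>S. \<Sum>q\<in>S. \<Sum>r\<in>R. \<Sum>s\<in>R. cnj (v (p, r)) * K (p, r) (q, s) * v (q, s))"
    by (intro sum.cong refl sum.swap)
  finally show ?thesis .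
qed

lemma pos_kernel_block_diagonal:
  assumes S: "finite S" and G: "\<And>p. p \<in> S \<Longrightarrow> pos_kernel R (G p)"
  shows "pos_kernel (S \<times> R) (\<lambda>x y. if fst x = fst y then G (fst x) (snd x) (snd y) else 0)"
proof -
  have "qform (S \<times> R) (\<lambda>x y. if fst x = fst y then G (fst x) (snd x) (snd y) else 0) v
    = (\<Sum>p\<in>S. qform R (G p) (\<lambda>r. v (p, r)))" for v
  proof -
    have "(\<Sum>q\<in>S. \<Sum>r\<in>R. \<Sum>s\<in>R. cnj (v (p, r)) * (if p = q then G p r s else 0) * v (q, s))
      = qform R (G p) (\<lambda>r. v (p, r))" if "p \<in> S" for p
    proof -
      have "(\<Sum>q\<in>S. \<Sum>r\<in>R. \<Sum>s\<in>R. cnj (v (p, r)) * (if p = q then G p r s else 0) * v (q, s))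
        = (\<Sum>q\<in>S. if p = q then qform R (G p) (\<lambda>r. v (p, r)) else 0)"
        unfolding qform_def by (intro sum.cong refl) auto
      then show ?thesis using S that by simp
    qed
    then show ?thesis unfolding qform_Times fst_conv snd_conv by (intro sum.cong) auto
  qed
  then show ?thesis using G unfolding pos_kernel_def by (auto intro!: sum_nonneg)
qed

text \<open>
  Contracting the first factor with \<open>e\<close> turns the tensor product of a rank-one kernel with \<open>B\<close> into \<open>B\<close>.
\<close>

lemma qform_rank_one_tensor:
  "qform (S \<times> R) (\<lambda>x y. (e (fst x) * cnj (e (fst y))) * B (snd x) (snd y)) v
    = qform R B (\<lambda>r. \<Sum>p\<in>S. cnj (e p) * v (p, r))"
proof -
  have "qform R B (\<lambda>r. \<Sum>p\<in>S. cnj (e p) * v (p, r))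
    = (\<Sum>r\<in>R. \<Sum>s\<in>R. \<Sum>p\<in>S. \<Sum>q\<in>S. cnj (v (p, r)) * (e p * cnj (e q) * B r s) * v (q, s))"
  proof -
    have "cnj (\<Sum>p\<in>S. cnj (e p) * v (p, r)) * B r s * (\<Sum>q\<in>S. cnj (e q) * v (q, s))
      = (\<Sum>p\<in>S. \<Sum>q\<in>S. cnj (v (p, r)) * (e p * cnj (e q) * B r s) * v (q, s))" for r s
    proof -
      have "cnj (\<Sum>p\<in>S. cnj (e p) * v (p, r)) * B r s * (\<Sum>q\<in>S. cnj (e q) * v (q, s))
        = B r s * ((\<Sum>p\<in>S. e p * cnj (v (p, r))) * (\<Sum>q\<in>S. cnj (e q) * v (q, s)))"
        by (simp only: cnj_sum complex_cnj_mult complex_cnj_cnj mult_ac)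
      also have "\<dots> = (\<Sum>p\<in>S. \<Sum>q\<in>S. cnj (v (p, r)) * (e p * cnj (e q) * B r s) * v (q, s))"
        unfolding sum_product by (simp only: sum_distrib_left mult_ac)
      finally show ?thesis .
    qed
    then show ?thesis unfolding qform_def by simp
  qed
  also have "\<dots> = (\<Sum>r\<in>R. \<Sum>p\<in>S. \<Sum>s\<in>R. \<Sum>q\<in>S. cnj (v (p, r)) * (e p * cnj (e q) * B r s) * v (q, s))"
    by (intro sum.cong refl sum.swap)
  also have "\<dots> = (\<Sum>p\<in>S. \<Sum>r\<in>R. \<Sum>s\<in>R. \<Sum>q\<in>S. cnj (v (p, r)) * (e p * cnj (e q) * B r s) * v (q, s))"
    by (rule sum.swap)
  also have "\<dots> = (\<Sum>p\<in>S. \<Sum>r\<in>R. \<Sum>q\<in>S. \<Sum>s\<in>R. cnj (v (p, r)) * (e p * cnj (e q) * B r s) * v (q, s))"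
    by (intro sum.cong refl sum.swap)
  also have "\<dots> = (\<Sum>p\<in>S. \<Sum>q\<in>S. \<Sum>r\<in>R. \<Sum>s\<in>R. cnj (v (p, r)) * (e p * cnj (e q) * B r s) * v (q, s))"
    by (intro sum.cong refl sum.swap)
  finally show ?thesis unfolding qform_Times by simp
qed

lemma pos_kernel_tensor:
  assumes S: "finite S" and A: "pos_kernel S A" and B: "pos_kernel R B"
  shows "pos_kernel (S \<times> R) (\<lambda>x y. A (fst x) (fst y) * B (snd x) (snd y))"
proof -
  obtain J :: "nat set" and \<mu> e where J: "\<And>t. t \<in> J \<Longrightarrow> 0 \<le> \<mu> t"
    and A_eq: "\<And>a b. a \<in> S \<Longrightarrow> b \<in> S \<Longrightarrow> A a b = (\<Sum>t\<in>J. of_real (\<mu> t) * (e t a * cnj (e t b)))"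
    using pos_kernel_spectral[OF S A] by metis
  have "pos_kernel (S \<times> R) (\<lambda>x y. \<Sum>t\<in>J. of_real (\<mu> t) * (e t (fst x) * cnj (e t (fst y)) * B (snd x) (snd y)))"
    using B J by (intro pos_kernel_sum pos_kernel_scale) (simp_all add: pos_kernel_def qform_rank_one_tensor)
  then show ?thesis
    by (subst pos_kernel_cong[where L = "\<lambda>x y. \<Sum>t\<in>J. of_real (\<mu> t) * (e t (fst x) * cnj (e t (fst y)) * B (snd x) (snd y))"])
      (auto simp: A_eq sum_distrib_right mult.assoc)
qed

definition sep_kernel :: "'a set \<Rightarrow> 'b set \<Rightarrow> ('a \<Rightarrow> 'a \<Rightarrow> 'b \<Rightarrow> 'b \<Rightarrow> complex) \<Rightarrow> bool" where
  "sep_kernel S R F \<longleftrightarrow> (\<exists>(N::nat) A B. (\<forall>n<N. pos_kernel S (A n) \<and> pos_kernel R (B n)) \<and>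
     (\<forall>p\<in>S. \<forall>q\<in>S. \<forall>r\<in>R. \<forall>s\<in>R. F p q r s = (\<Sum>n<N. A n p q * B n r s)))"

lemma sep_kernel_pos:
  assumes "finite S" "sep_kernel S R F"
  shows "pos_kernel (S \<times> R) (\<lambda>x y. F (fst x) (fst y) (snd x) (snd y))"
proof -
  obtain N :: nat and A B where AB: "\<forall>n<N. pos_kernel S (A n) \<and> pos_kernel R (B n)"
    and F: "\<forall>p\<in>S. \<forall>q\<in>S. \<forall>r\<in>R. \<forall>s\<in>R. F p q r s = (\<Sum>n<N. A n p q * B n r s)"
    using assms(2) unfolding sep_kernel_def by blast
  have "pos_kernel (S \<times> R) (\<lambda>x y. \<Sum>n<N. A n (fst x) (fst y) * B n (snd x) (snd y))"
    using AB assms(1) by (intro pos_kernel_sum pos_kernel_tensor) auto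
  then show ?thesis
    by (subst pos_kernel_cong[where L = "\<lambda>x y. \<Sum>n<N. A n (fst x) (fst y) * B n (snd x) (snd y)"])
      (auto simp: F)
qed

text \<open>
  The first factor \<open>K\<close> of each term is replaced by \<open>tr K - K\<close>, which is still positive; for the second
  inequality the same is done to the second factor.
\<close>

lemma sep_kernel_reduction1:
  assumes "finite S" "sep_kernel S R F"
  shows "pos_kernel (S \<times> R) (\<lambda>x y. (if fst x = fst y then (\<Sum>p\<in>S. F p p (snd x) (snd y)) else 0)
    - F (fst x) (fst y) (snd x) (snd y))"
proof -
  obtain N :: nat and A B where AB: "\<forall>n<N. pos_kernel S (A n) \<and> pos_kernel R (B n)"
    and F: "\<forall>p\<in>S. \<forall>q\<in>S. \<forall>r\<in>R. \<forall>s\<in>R. F p q r s = (\<Sum>n<N. A n p q * B n r s)"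
    using assms(2) unfolding sep_kernel_def by blast
  let ?L = "\<lambda>x y. \<Sum>n<N. ((if fst x = fst y then (\<Sum>p\<in>S. A n p p) else 0) - A n (fst x) (fst y)) * B n (snd x) (snd y)"
  have "pos_kernel (S \<times> R) ?L"
    using AB assms(1)
    by (intro pos_kernel_sum pos_kernel_tensor[where A = "\<lambda>a b. (if a = b then (\<Sum>p\<in>S. A _ p p) else 0) - A _ a b"]
        trace_minus_pos_kernel) auto
  moreover have "(\<Sum>p\<in>S. F p p r s) = (\<Sum>n<N. (\<Sum>p\<in>S. A n p p) * B n r s)" if "r \<in> R" "s \<in> R" for r s
    unfolding sum_distrib_right using F that by (subst sum.swap) (auto intro!: sum.cong)
  ultimately show ?thesis
    by (subst pos_kernel_cong[where L = ?L]) (auto simp: F left_diff_distrib sum_subtractf sum_negf)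
qed

lemma sep_kernel_reduction2:
  assumes "finite S" "finite R" "sep_kernel S R F"
  shows "pos_kernel (S \<times> R) (\<lambda>x y. (if snd x = snd y then (\<Sum>r\<in>R. F (fst x) (fst y) r r) else 0)
    - F (fst x) (fst y) (snd x) (snd y))"
proof -
  obtain N :: nat and A B where AB: "\<forall>n<N. pos_kernel S (A n) \<and> pos_kernel R (B n)"
    and F: "\<forall>p\<in>S. \<forall>q\<in>S. \<forall>r\<in>R. \<forall>s\<in>R. F p q r s = (\<Sum>n<N. A n p q * B n r s)"
    using assms(3) unfolding sep_kernel_def by blast
  let ?L = "\<lambda>x y. \<Sum>n<N. A n (fst x) (fst y) * ((if snd x = snd y then (\<Sum>p\<in>R. B n p p) else 0) - B n (snd x) (snd y))"
  have "pos_kernel (S \<times> R) ?L"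
    using AB assms(1,2)
    by (intro pos_kernel_sum pos_kernel_tensor[where B = "\<lambda>a b. (if a = b then (\<Sum>p\<in>R. B _ p p) else 0) - B _ a b"]
        trace_minus_pos_kernel) auto
  moreover have "(\<Sum>r\<in>R. F p q r r) = (\<Sum>n<N. A n p q * (\<Sum>r\<in>R. B n r r))" if "p \<in> S" "q \<in> S" for p q
    unfolding sum_distrib_left using F that by (subst sum.swap) (auto intro!: sum.cong)
  ultimately show ?thesis
    by (subst pos_kernel_cong[where L = ?L]) (auto simp: F right_diff_distrib sum_subtractf sum_negf)
qed

section \<open>Kernels of entanglement breaking maps\<close>

text \<open>
  Here \<open>F p q r s\<close> stands for the entry \<open>(r, s)\<close> of \<open>\<Phi> (E\<^sub>p\<^sub>q)\<close>. The vectors \<open>x s\<close> are the \<open>k\<close> components of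
  a vector of the \<open>k * d\<close>-dimensional product space, so \<open>id\<^sub>k \<otimes> \<Phi>\<close> is only applied to positive matrices of rank one. In
  this form the property is visibly stable under a change of basis on either side of \<open>\<Phi>\<close>.
\<close>

definition keb_kernel :: "nat \<Rightarrow> nat \<Rightarrow> (nat \<Rightarrow> nat \<Rightarrow> nat \<Rightarrow> nat \<Rightarrow> complex) \<Rightarrow> bool" where
  "keb_kernel k d F \<longleftrightarrow> (\<forall>x. sep_kernel {..<k} {..<d}
     (\<lambda>s t r r'. \<Sum>p<d. \<Sum>q<d. x s p * cnj (x t q) * F p q r r'))"

text \<open>
  Take for \<open>x\<close> an enumeration of the basis vectors with index in \<open>T\<close>: the restriction of the Choi kernel
  to \<open>T\<close> is the image of a maximally entangled vector.
\<close>

lemma keb_kernel_sep_on_subset: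
  assumes keb: "keb_kernel k d F" and T: "T \<subseteq> {..<d}" "card T = k"
  shows "sep_kernel T {..<d} F"
proof -
  have "finite T" using T finite_subset by blast
  then obtain h where h: "bij_betw h {..<k} T"
    using ex_bij_betw_nat_finite[of T] T(2) by (auto simp: atLeast0LessThan)
  define g where "g = inv_into {..<k} h"
  have g: "bij_betw g T {..<k}" unfolding g_def by (rule bij_betw_inv_into[OF h])
  have gT: "g p < k" "h (g p) = p" if "p \<in> T" for p
    using h g that by (auto simp: g_def bij_betw_def f_inv_into_f)
  have gh: "g (h s) = s" if "s < k" for s
    using h that by (auto simp: g_def bij_betw_def)
  define x :: "nat \<Rightarrow> nat \<Rightarrow> complex" where "x s p = (if p = h s then 1 else 0)" for s p
  obtain N :: nat and A B where AB: "\<forall>n<N. pos_kernel {..<k} (A n) \<and> pos_kernel {..<d} (B n)"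
    and F: "\<forall>s\<in>{..<k}. \<forall>t\<in>{..<k}. \<forall>r\<in>{..<d}. \<forall>r'\<in>{..<d}.
      (\<Sum>p<d. \<Sum>q<d. x s p * cnj (x t q) * F p q r r') = (\<Sum>n<N. A n s t * B n r r')"
    using spec[OF keb[unfolded keb_kernel_def], of x] unfolding sep_kernel_def by blast
  have x_sum: "(\<Sum>p<d. \<Sum>q<d. x s p * cnj (x t q) * F p q r r') = F (h s) (h t) r r'"
    if "h s < d" "h t < d" for s t r r'
  proof -
    have "(\<Sum>p<d. \<Sum>q<d. x s p * cnj (x t q) * F p q r r')
      = (\<Sum>p<d. \<Sum>q<d. if q = h t then x s p * F p (h t) r r' else 0)"
      by (intro sum.cong refl) (auto simp: x_def)
    also have "\<dots> = (\<Sum>p<d. if p = h s then F (h s) (h t) r r' else 0)"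
      using that by (intro sum.cong refl) (auto simp: x_def)
    finally show ?thesis using that by simp
  qed
  have F': "F p q r r' = (\<Sum>n<N. A n (g p) (g q) * B n r r')"
    if "p \<in> T" "q \<in> T" "r < d" "r' < d" for p q r r'
  proof -
    have "p < d" "q < d" using that T by auto
    then show ?thesis
      using F[rule_format, of "g p" "g q" r r'] x_sum[of "g p" "g q" r r'] gT that by simp
  qed
  have "pos_kernel T (\<lambda>p q. A n (g p) (g q))" if "n < N" for n
  proof (rule pos_kernel_reindex[OF h])
    show "pos_kernel {..<k} (\<lambda>a b. A n (g (h a)) (g (h b)))"
      using AB that by (subst pos_kernel_cong[where L = "A n"]) (auto simp: gh)
  qed
  then show ?thesis unfolding sep_kernel_def using AB F'
    by (intro exI[of _ N] exI[of _ "\<lambda>n p q. A n (g p) (g q)"] exI[of _ B]) auto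
qed

text \<open>
  All \<open>k\<close> components are set equal to \<open>x\<close>; then each block of the image is \<open>\<Phi> (x x\<^sup>*)\<close>, and
  a diagonal block of a separable kernel is positive.
\<close>

lemma keb_kernel_positive:
  assumes keb: "keb_kernel k d F" and k: "0 < k"
  shows "pos_kernel {..<d} (\<lambda>r s. \<Sum>p<d. \<Sum>q<d. x p * cnj (x q) * F p q r s)"
proof -
  obtain N :: nat and A B where AB: "\<forall>n<N. pos_kernel {..<k} (A n) \<and> pos_kernel {..<d} (B n)"
    and F: "\<forall>s\<in>{..<k}. \<forall>t\<in>{..<k}. \<forall>r\<in>{..<d}. \<forall>r'\<in>{..<d}.
      (\<Sum>p<d. \<Sum>q<d. x p * cnj (x q) * F p q r r') = (\<Sum>n<N. A n s t * B n r r')"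
    using spec[OF keb[unfolded keb_kernel_def], of "\<lambda>s. x"] unfolding sep_kernel_def by blast
  have "pos_kernel {..<d} (\<lambda>r s. \<Sum>n<N. of_real (Re (A n 0 0)) * B n r s)"
    using AB k pos_kernel_diag_nonneg[of "{..<k}" _ 0]
    by (intro pos_kernel_sum pos_kernel_scale) (auto simp: less_eq_complex_def)
  moreover have "of_real (Re (A n 0 0)) = A n 0 0" if "n < N" for n
    using AB k pos_kernel_diag_nonneg[of "{..<k}" "A n" 0] that
    by (auto simp: less_eq_complex_def complex_eq_iff)
  ultimately show ?thesis
    using F k by (subst pos_kernel_cong[where L = "\<lambda>r s. \<Sum>n<N. of_real (Re (A n 0 0)) * B n r s"]) auto
qed

lemma keb_kernel_diagonal_block:
  assumes "keb_kernel k d F" "0 < k" "j < d"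
  shows "pos_kernel {..<d} (F j j)"
proof -
  define x :: "nat \<Rightarrow> complex" where "x p = (if p = j then 1 else 0)" for p
  have "(\<Sum>p<d. \<Sum>q<d. x p * cnj (x q) * F p q r s) = F j j r s" for r s
  proof -
    have "(\<Sum>p<d. \<Sum>q<d. x p * cnj (x q) * F p q r s)
      = (\<Sum>p<d. \<Sum>q<d. if q = j then x p * F p j r s else 0)"
      by (intro sum.cong refl) (auto simp: x_def)
    also have "\<dots> = (\<Sum>p<d. if p = j then F j j r s else 0)"
      using assms by (intro sum.cong refl) (auto simp: x_def)
    finally show ?thesis using assms by simp
  qed
  then show ?thesis using keb_kernel_positive[OF assms(1,2), of x] by simp
qed

text \<open>
  Positivity of \<open>\<Phi> (x x\<^sup>*)\<close> makes it Hermitian for all \<open>x\<close>, and polarization in \<open>x\<close> separates the entries.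
\<close>

lemma keb_kernel_hermitian:
  assumes keb: "keb_kernel k d F" and k: "0 < k" and lt: "p < d" "q < d" "r < d" "s < d"
  shows "F q p s r = cnj (F p q r s)"
proof -
  have "qform {..<d} (\<lambda>q p. F p q r s - cnj (F q p s r)) x = 0" for x
  proof -
    have "(\<Sum>p<d. \<Sum>q<d. x p * cnj (x q) * F p q s r) = cnj (\<Sum>p<d. \<Sum>q<d. x p * cnj (x q) * F p q r s)"
      using pos_kernel_hermitian[OF _ keb_kernel_positive[OF keb k, of x], of r s] lt by simp
    then have "cnj (\<Sum>p<d. \<Sum>q<d. x p * cnj (x q) * F p q s r) = (\<Sum>p<d. \<Sum>q<d. x p * cnj (x q) * F p q r s)"
      by simp
    moreover have "qform {..<d} (\<lambda>q p. cnj (F q p s r)) x = cnj (\<Sum>p<d. \<Sum>q<d. x p * cnj (x q) * F p q s r)"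
      unfolding qform_def by (simp add: mult_ac)
    moreover have "qform {..<d} (\<lambda>q p. F p q r s) x = (\<Sum>p<d. \<Sum>q<d. x p * cnj (x q) * F p q r s)"
      unfolding qform_def by (subst sum.swap) (simp add: mult_ac)
    ultimately show ?thesis unfolding qform_diff by simp
  qed
  from qform_eq_0_imp[OF finite_lessThan this, of q p] lt have "F p q r s = cnj (F q p s r)" by simp
  then show ?thesis by simp
qed

section \<open>Averaging over coordinate subsets\<close>

lemma card_subsets_containing:
  assumes A: "finite A" "U \<subseteq> A" and k: "card U \<le> k"
  shows "card {T. T \<subseteq> A \<and> card T = k \<and> U \<subseteq> T} = (card A - card U) choose (k - card U)"
proof -
  have fU: "finite U" using A by (metis finite_subset)
  have "bij_betw (\<lambda>T. T \<union> U) {S. S \<subseteq> A - U \<and> card S = k - card U}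
    {T. T \<subseteq> A \<and> card T = k \<and> U \<subseteq> T}"
  proof (rule bij_betw_byWitness[where f' = "\<lambda>T. T - U"])
    have "card (S \<union> U) = k" if "S \<subseteq> A - U" "card S = k - card U" for S
    proof -
      have "finite S" using A that by (meson finite_Diff finite_subset)
      then have "card (S \<union> U) = card S + card U"
        using fU that by (intro card_Un_disjoint) auto
      then show ?thesis using that k by simp
    qed
    then show "(\<lambda>T. T \<union> U) ` {S. S \<subseteq> A - U \<and> card S = k - card U} \<subseteq> {T. T \<subseteq> A \<and> card T = k \<and> U \<subseteq> T}"
      using A by auto
    show "(\<lambda>T. T - U) ` {T. T \<subseteq> A \<and> card T = k \<and> U \<subseteq> T} \<subseteq> {S. S \<subseteq> A - U \<and> card S = k - card U}"
      using fU by (auto simp: card_Diff_subset)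
  qed auto
  then have "card {T. T \<subseteq> A \<and> card T = k \<and> U \<subseteq> T} = card {S. S \<subseteq> A - U \<and> card S = k - card U}"
    by (rule bij_betw_same_card[symmetric])
  also have "\<dots> = card (A - U) choose (k - card U)" using A by (intro n_subsets) auto
  finally show ?thesis using A fU by (simp add: card_Diff_subset)
qed

text \<open>
  The kernel \<open>X\<close> is the sum of the restrictions of \<open>F\<close> to all \<open>k\<close>-element subsets \<open>T\<close> of indices in the first factor, divided by
  the number \<open>N2\<close> of such subsets through two given points; \<open>c = N1 / N2\<close> for the number \<open>N1\<close> of those through one
  point. Each restriction is separable, and the bounds on \<open>X\<close> are averages of its reduction inequalities.
  In the bound by \<open>n\<close>, the sum of \<open>\<Sum>t\<in>T. \<Phi> (E\<^sub>t\<^sub>t)\<close> over the subsets \<open>T\<close> containing \<open>p\<close>, divided by \<open>N2\<close>,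
  falls short of \<open>c (\<Sum>t. \<Phi> (E\<^sub>t\<^sub>t))\<close> by \<open>c - 1\<close> times the sum of the blocks with \<open>t \<noteq> p\<close>.
\<close>

lemma subset_average:
  fixes m n :: "nat \<Rightarrow> real"
  assumes keb: "keb_kernel k d F" and k: "2 \<le> k" "k \<le> d"
    and tr2: "\<And>p q. p < d \<Longrightarrow> q < d \<Longrightarrow> (\<Sum>r<d. F p q r r) = (if p = q then of_real (m p) else 0)"
    and tr1: "\<And>r s. r < d \<Longrightarrow> s < d \<Longrightarrow> (\<Sum>p<d. F p p r s) = (if r = s then of_real (n r) else 0)"
  defines "c \<equiv> (real d - 1) / (real k - 1)"
  defines "X \<equiv> \<lambda>x y. (if fst x = fst y then of_real c else 1) * F (fst x) (fst y) (snd x) (snd y)"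
  shows "pos_kernel ({..<d} \<times> {..<d}) X"
    and "pos_kernel ({..<d} \<times> {..<d}) (\<lambda>x y. X x y - F (fst x) (fst y) (snd x) (snd y))"
    and "pos_kernel ({..<d} \<times> {..<d}) (\<lambda>x y. (if x = y then of_real (c * m (fst x)) else 0) - X x y)"
    and "pos_kernel ({..<d} \<times> {..<d}) (\<lambda>x y. (if x = y then of_real (c * n (snd x)) else 0) - X x y)"
proof -
  let ?I = "{..<d} \<times> {..<d}"
  define \<T> where "\<T> = {T. T \<subseteq> {..<d} \<and> card T = k}"
  have fin: "finite \<T>" unfolding \<T>_def by (rule finite_subset[of _ "Pow {..<d}"]) auto
  define N1 N2 where "N1 = real ((d - 1) choose (k - 1))" and "N2 = real ((d - 2) choose (k - 2))"
  have N2: "0 < N2" using k by (simp add: N2_def zero_less_binomial)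
  have N1: "N1 = c * N2"
  proof -
    have "(k - 1) * ((d - 1) choose (k - 1)) = (d - 1) * ((d - 1 - 1) choose (k - 1 - 1))"
      using k by (intro times_binomial_minus1_eq) auto
    then have "real (k - 1) * N1 = real (d - 1) * N2"
      unfolding N1_def N2_def by (simp add: numeral_2_eq_2 flip: of_nat_mult)
    then show ?thesis using k by (simp add: c_def of_nat_diff field_simps)
  qed
  have c1: "1 \<le> c" using k by (simp add: c_def)
  have count: "(\<Sum>T\<in>\<T>. if p \<in> T \<and> q \<in> T then z else 0) = of_real (if p = q then N1 else N2) * z"
    if "p < d" "q < d" for p q and z :: complex
  proof -
    have "(\<Sum>T\<in>\<T>. if p \<in> T \<and> q \<in> T then z else 0) = (\<Sum>T\<in>{T \<in> \<T>. p \<in> T \<and> q \<in> T}. z)"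
      using fin by (intro sum.mono_neutral_cong_right) auto
    also have "{T \<in> \<T>. p \<in> T \<and> q \<in> T} = {T. T \<subseteq> {..<d} \<and> card T = k \<and> {p, q} \<subseteq> T}"
      by (auto simp: \<T>_def)
    also have "(\<Sum>T\<in>\<dots>. z) = of_nat ((d - card {p, q}) choose (k - card {p, q})) * z"
      using card_subsets_containing[of "{..<d}" "{p, q}" k] that k
      by (simp add: card_insert_if)
    also have "\<dots> = of_real (if p = q then N1 else N2) * z"
      by (auto simp: N1_def N2_def numeral_2_eq_2)
    finally show ?thesis .
  qed
  have sep: "sep_kernel T {..<d} F" if "T \<in> \<T>" for T
    using keb_kernel_sep_on_subset[OF keb] that by (auto simp: \<T>_def)
  have finT: "finite T" "T \<times> {..<d} \<subseteq> ?I" if "T \<in> \<T>" for T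
    using that finite_subset by (auto simp: \<T>_def)
  have lift: "pos_kernel ?I (\<lambda>x y. \<Sum>T\<in>\<T>. if fst x \<in> T \<and> fst y \<in> T then K T x y else 0)"
    if K: "\<And>T. T \<in> \<T> \<Longrightarrow> pos_kernel (T \<times> {..<d}) (K T)" for K
  proof (rule pos_kernel_sum)
    fix T assume T: "T \<in> \<T>"
    show "pos_kernel ?I (\<lambda>x y. if fst x \<in> T \<and> fst y \<in> T then K T x y else 0)"
      using pos_kernel_extend[OF _ finT(2)[OF T] K[OF T]]
      by (subst pos_kernel_cong[where L = "\<lambda>x y. if x \<in> T \<times> {..<d} \<and> y \<in> T \<times> {..<d} then K T x y else 0"]) auto
  qed
  have X_sum: "(\<Sum>T\<in>\<T>. if fst x \<in> T \<and> fst y \<in> T then F (fst x) (fst y) (snd x) (snd y) else 0)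
    = of_real N2 * X x y" if "x \<in> ?I" "y \<in> ?I" for x y
    using that by (subst count) (auto simp: X_def N1)
  show "pos_kernel ?I X"
  proof (rule pos_kernel_scaleD[OF _ N2])
    show "pos_kernel ?I (\<lambda>x y. of_real N2 * X x y)"
      by (rule pos_kernel_eqI[OF lift[OF sep_kernel_pos[OF finT(1) sep]] X_sum])
  qed
  have blocks: "pos_kernel {..<d} (F j j)" if "j < d" for j
    using keb_kernel_diagonal_block[OF keb _ that] k by simp
  show "pos_kernel ?I (\<lambda>x y. X x y - F (fst x) (fst y) (snd x) (snd y))"
  proof -
    have "pos_kernel ?I (\<lambda>x y. if fst x = fst y then of_real (c - 1) * F (fst x) (fst x) (snd x) (snd y) else 0)"
      using blocks c1 by (intro pos_kernel_block_diagonal pos_kernel_scale) auto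
    then show ?thesis
      by (subst pos_kernel_cong[where L = "\<lambda>x y. if fst x = fst y then of_real (c - 1) * F (fst x) (fst x) (snd x) (snd y) else 0"])
        (auto simp: X_def algebra_simps)
  qed
  show "pos_kernel ?I (\<lambda>x y. (if x = y then of_real (c * m (fst x)) else 0) - X x y)"
  proof (rule pos_kernel_scaleD[OF _ N2])
    let ?K = "\<lambda>x y. (if snd x = snd y then (\<Sum>r<d. F (fst x) (fst y) r r) else 0)
      - F (fst x) (fst y) (snd x) (snd y)"
    have eq: "(\<Sum>T\<in>\<T>. if fst x \<in> T \<and> fst y \<in> T then ?K x y else 0)
      = of_real N2 * ((if x = y then of_real (c * m (fst x)) else 0) - X x y)"
      if "x \<in> ?I" "y \<in> ?I" for x y
      using that by (subst count) (auto simp: X_def N1 tr2 algebra_simps prod_eq_iff)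
    show "pos_kernel ?I (\<lambda>x y. of_real N2 * ((if x = y then of_real (c * m (fst x)) else 0) - X x y))"
      by (rule pos_kernel_eqI[OF lift[OF sep_kernel_reduction2[OF finT(1) finite_lessThan sep]] eq])
  qed
  show "pos_kernel ?I (\<lambda>x y. (if x = y then of_real (c * n (snd x)) else 0) - X x y)"
  proof (rule pos_kernel_scaleD[OF _ N2])
    let ?K = "\<lambda>T x y. (if fst x = fst y then (\<Sum>p\<in>T. F p p (snd x) (snd y)) else 0)
      - F (fst x) (fst y) (snd x) (snd y)"
    let ?L = "\<lambda>x y. if fst x = fst y then of_real (N2 * (c - 1)) * (\<Sum>t\<in>{..<d} - {fst x}. F t t (snd x) (snd y)) else 0"
    have L: "pos_kernel ?I ?L"
      using blocks c1 N2 by (intro pos_kernel_block_diagonal pos_kernel_scale pos_kernel_sum) auto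
    have eq: "(\<Sum>T\<in>\<T>. if fst x \<in> T \<and> fst y \<in> T then ?K T x y else 0) + ?L x y
      = of_real N2 * ((if x = y then of_real (c * n (snd x)) else 0) - X x y)"
      if "x \<in> ?I" "y \<in> ?I" for x y
    proof -
      obtain p r where x: "x = (p, r)" by (cases x)
      obtain q s where y: "y = (q, s)" by (cases y)
      have xy: "x = (p, r)" "y = (q, s)" "p < d" "r < d" "q < d" "s < d"
        using that x y by auto
      have "(\<Sum>T\<in>\<T>. if p \<in> T then (\<Sum>t\<in>T. F t t r s) else 0)
        = (\<Sum>T\<in>\<T>. \<Sum>t<d. if p \<in> T \<and> t \<in> T then F t t r s else 0)"
      proof (intro sum.cong refl)
        fix T assume "T \<in> \<T>"
        then have "T \<subseteq> {..<d}" by (simp add: \<T>_def)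
        then show "(if p \<in> T then (\<Sum>t\<in>T. F t t r s) else 0)
          = (\<Sum>t<d. if p \<in> T \<and> t \<in> T then F t t r s else 0)"
          by (auto intro!: sum.mono_neutral_cong_left)
      qed
      also have "\<dots> = (\<Sum>t<d. of_real (if p = t then N1 else N2) * F t t r s)"
        using xy by (subst sum.swap) (auto simp: count)
      also have "\<dots> = of_real N1 * F p p r s + of_real N2 * (\<Sum>t\<in>{..<d} - {p}. F t t r s)"
        using xy by (subst sum.remove[of _ p]) (auto simp: sum_distrib_left intro!: sum.cong)
      finally have 1: "(\<Sum>T\<in>\<T>. if p \<in> T then (\<Sum>t\<in>T. F t t r s) else 0)
        = of_real N1 * F p p r s + of_real N2 * (\<Sum>t\<in>{..<d} - {p}. F t t r s)" .
      have 2: "F p p r s + (\<Sum>t\<in>{..<d} - {p}. F t t r s) = (if r = s then of_real (n r) else 0)"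
        using tr1[of r s] xy by (subst (asm) sum.remove[of _ p]) auto
      have 3: "(\<Sum>T\<in>\<T>. if p \<in> T \<and> q \<in> T then F p q r s else 0) = of_real N2 * X x y"
        using X_sum[OF that] unfolding xy fst_conv snd_conv .
      have "(\<Sum>T\<in>\<T>. if p \<in> T \<and> q \<in> T then (if p = q then (\<Sum>t\<in>T. F t t r s) else 0) - F p q r s else 0)
        = (\<Sum>T\<in>\<T>. if p \<in> T \<and> q \<in> T then (if p = q then (\<Sum>t\<in>T. F t t r s) else 0) else 0)
          - (\<Sum>T\<in>\<T>. if p \<in> T \<and> q \<in> T then F p q r s else 0)"
        unfolding sum_subtractf[symmetric] by (intro sum.cong) auto
      also have "(\<Sum>T\<in>\<T>. if p \<in> T \<and> q \<in> T then (if p = q then (\<Sum>t\<in>T. F t t r s) else 0) else 0)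
        = (if p = q then of_real N1 * F p p r s + of_real N2 * (\<Sum>t\<in>{..<d} - {p}. F t t r s) else 0)"
        using 1 by (cases "p = q") (simp_all cong: if_cong)
      finally have 4: "(\<Sum>T\<in>\<T>. if p \<in> T \<and> q \<in> T then (if p = q then (\<Sum>t\<in>T. F t t r s) else 0) - F p q r s else 0)
        = (if p = q then of_real N1 * F p p r s + of_real N2 * (\<Sum>t\<in>{..<d} - {p}. F t t r s) else 0)
          - of_real N2 * X (p, r) (q, s)" unfolding 3 xy .
      have 5: "of_real N1 * F p p r s + of_real N2 * S + of_real (N2 * (c - 1)) * S
        = of_real N2 * of_real c * (F p p r s + S)" for S
        by (simp add: N1 algebra_simps)
      show ?thesis
        unfolding xy fst_conv snd_conv 4
        using 5[of "\<Sum>t\<in>{..<d} - {p}. F t t r s", unfolded 2]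
        by (cases "p = q"; cases "r = s") (simp_all add: algebra_simps)
    qed
    show "pos_kernel ?I (\<lambda>x y. of_real N2 * ((if x = y then of_real (c * n (snd x)) else 0) - X x y))"
      by (rule pos_kernel_eqI[OF pos_kernel_add[OF lift[OF sep_kernel_reduction1[OF finT(1) sep]] L] eq])
  qed
qed

section \<open>Averaging over phases\<close>

lemma sum_character:
  fixes m :: int
  assumes N: "\<bar>m\<bar> < int N"
  shows "(\<Sum>\<tau><N. cis (2 * pi * real \<tau> * of_int m / real N)) = (if m = 0 then of_nat N else 0)"
proof (cases "m = 0")
  case False
  define z where "z = cis (2 * pi * of_int m / real N)"
  have N0: "0 < N" using N by auto
  have pow: "cis (2 * pi * real \<tau> * of_int m / real N) = z ^ \<tau>" for \<tau>
    unfolding z_def DeMoivre by (simp add: field_simps)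
  have "z ^ N = cis (2 * pi * real N * of_int m / real N)" by (rule pow[symmetric])
  also have "2 * pi * real N * of_int m / real N = 2 * pi * of_int m" using N0 by simp
  also have "cis (2 * pi * of_int m) = 1" by (rule cis_multiple_2pi) simp
  finally have zN: "z ^ N = 1" .
  have "z \<noteq> 1"
  proof
    assume "z = 1"
    then have "cos (2 * pi * of_int m / real N) = 1"
      by (simp add: z_def complex_eq_iff)
    then obtain j :: int where "2 * pi * of_int m / real N = of_int j * 2 * pi"
      using cos_one_2pi_int by blast
    then have "real_of_int m = real_of_int (j * int N)" using N0 by (simp add: field_simps)
    then have m: "m = j * int N" by linarith
    then have "j \<noteq> 0" using False by auto
    then have "int N \<le> \<bar>j\<bar> * int N" using N0 by simp
    then show False using N m by (simp add: abs_mult)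
  qed
  then show ?thesis using False zN by (simp add: pow geometric_sum)
qed simp

text \<open>
  The powers of two form a Sidon set: dividing by the smallest power leaves a parity argument.
\<close>

lemma power2_sum_eq_iff:
  fixes a b c e :: nat
  shows "(2::nat) ^ a + 2 ^ b = 2 ^ c + 2 ^ e \<longleftrightarrow> (a = c \<and> b = e) \<or> (a = e \<and> b = c)"
proof -
  \<comment> \<open>If \<open>a < c\<close>, division by \<open>2 ^ a\<close> leaves an even number of size at least \<open>4\<close> on one side, and \<open>2\<close> or an odd number on the other.\<close>
  have le: "a = c" if eq: "(2::nat) ^ a + 2 ^ b = 2 ^ c + 2 ^ e" and ord: "a \<le> b" "c \<le> e" "a \<le> c" for a b c e :: nat
  proof (rule ccontr)
    assume "a \<noteq> c"
    then have ac: "a < c" using ord by simp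
    define x y z where "x = b - a" and "y = c - Suc a" and "z = e - Suc a"
    have b: "b = a + x" and c: "c = Suc (a + y)" and e: "e = Suc (a + z)"
      using ord ac by (auto simp: x_def y_def z_def)
    have "(2::nat) ^ a * (1 + 2 ^ x) = 2 ^ a * (2 * (2 ^ y + 2 ^ z))"
      using eq by (simp add: b c e power_add algebra_simps)
    then have *: "1 + (2::nat) ^ x = 2 * (2 ^ y + 2 ^ z)"
      by (metis mult_left_cancel power_not_zero zero_neq_numeral)
    show False
    proof (cases x)
      case 0
      obtain u v where "(2::nat) ^ y = Suc u" "(2::nat) ^ z = Suc v"
        by (metis not0_implies_Suc power_not_zero zero_neq_numeral)
      then show False using * 0 by simp
    next
      case (Suc x')
      then have "odd (1 + (2::nat) ^ x)" by simp
      then show False unfolding * by simp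
    qed
  qed
  have ord: "a = c \<and> b = e" if "(2::nat) ^ a + 2 ^ b = 2 ^ c + 2 ^ e" "a \<le> b" "c \<le> e" for a b c e :: nat
  proof -
    have "a = c" using le[of a b c e] le[of c e a b] that by (cases "a \<le> c") auto
    then show ?thesis using that by simp
  qed
  show ?thesis
  proof
    assume eq: "(2::nat) ^ a + 2 ^ b = 2 ^ c + 2 ^ e"
    then have "(2::nat) ^ a + 2 ^ b = 2 ^ e + 2 ^ c" "(2::nat) ^ b + 2 ^ a = 2 ^ c + 2 ^ e"
      "(2::nat) ^ b + 2 ^ a = 2 ^ e + 2 ^ c" by simp_all
    with eq show "(a = c \<and> b = e) \<or> (a = e \<and> b = c)"
      using ord[of a b c e] ord[of a b e c] ord[of b a c e] ord[of b a e c]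
      by (metis nat_le_linear)
  qed (auto simp: add.commute)
qed

text \<open>
  Averages over independent phases, realized by the \<open>N\<close> powers of a single root of unity: coordinate \<open>i\<close>
  has the frequency \<open>2 ^ i\<close>. As these frequencies form a Sidon set, a product of four phases averages to
  zero unless the conjugated pair matches the other pair. All frequency differences are below \<open>N = 2 ^ (d + 1)\<close>
  in absolute value, so that none of them wraps around.
\<close>

lemma phases:
  obtains N :: nat and \<theta> :: "nat \<Rightarrow> nat \<Rightarrow> complex" where "0 < N"
    "\<And>\<tau> i. cmod (\<theta> \<tau> i) = 1"
    "\<And>p q i j. p < d \<Longrightarrow> q < d \<Longrightarrow> i < d \<Longrightarrow> j < d \<Longrightarrow>
      (\<Sum>\<tau><N. \<theta> \<tau> p * cnj (\<theta> \<tau> q) * cnj (\<theta> \<tau> i) * \<theta> \<tau> j)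
        = (if p = q \<and> i = j \<or> p = i \<and> q = j then of_nat N else 0)"
proof -
  define N where "N = (2::nat) ^ Suc d"
  define \<theta> where "\<theta> \<tau> i = cis (2 * pi * real \<tau> * 2 ^ i / real N)" for \<tau> i
  have "(\<Sum>\<tau><N. \<theta> \<tau> p * cnj (\<theta> \<tau> q) * cnj (\<theta> \<tau> i) * \<theta> \<tau> j)
      = (if p = q \<and> i = j \<or> p = i \<and> q = j then of_nat N else 0)"
    if lt: "p < d" "q < d" "i < d" "j < d" for p q i j
  proof -
    define m :: int where "m = 2 ^ p + 2 ^ j - (2 ^ q + 2 ^ i)"
    have "\<theta> \<tau> p * cnj (\<theta> \<tau> q) * cnj (\<theta> \<tau> i) * \<theta> \<tau> j = cis (2 * pi * real \<tau> * of_int m / real N)" for \<tau>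
      unfolding \<theta>_def m_def cis_cnj cis_mult
      by (rule arg_cong[where f = cis]) (simp add: field_simps add_divide_distrib diff_divide_distrib)
    moreover have "\<bar>m\<bar> < int N"
    proof -
      have b: "(2::int) ^ l \<le> 2 ^ d" "(0::int) < 2 ^ l" if "l < d" for l
        using that by (simp_all add: power_increasing)
      have "int N = 2 * 2 ^ d" by (simp add: N_def)
      then show ?thesis unfolding m_def
        using b[OF lt(1)] b[OF lt(2)] b[OF lt(3)] b[OF lt(4)] by linarith
    qed
    moreover have "m = 0 \<longleftrightarrow> p = q \<and> i = j \<or> p = i \<and> q = j"
    proof -
      have "m = 0 \<longleftrightarrow> int (2 ^ p + 2 ^ j) = int (2 ^ q + 2 ^ i)" by (simp add: m_def)
      also have "\<dots> \<longleftrightarrow> (2::nat) ^ p + 2 ^ j = 2 ^ q + 2 ^ i" by (rule of_nat_eq_iff)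
      finally show ?thesis unfolding power2_sum_eq_iff by auto
    qed
    ultimately show ?thesis by (simp add: sum_character)
  qed
  moreover have "0 < N" "\<And>\<tau> i. cmod (\<theta> \<tau> i) = 1" by (simp_all add: N_def \<theta>_def)
  ultimately show ?thesis using that by blast
qed

lemma qform_combination:
  "qform R K (\<lambda>r. \<Sum>i\<in>S. c i * z (i, r))
    = (\<Sum>i\<in>S. \<Sum>j\<in>S. cnj (c i) * c j * (\<Sum>r\<in>R. \<Sum>s\<in>R. cnj (z (i, r)) * K r s * z (j, s)))"
  using qform_rank_one_tensor[of S R "\<lambda>i. cnj (c i)" K z]
  unfolding qform_Times by (simp add: sum_distrib_left mult_ac)

text \<open>
  The two matchings overlap when all four indices agree; those terms are counted in the first sum.
\<close>

lemma sum_pairings: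
  fixes f :: "nat \<Rightarrow> nat \<Rightarrow> nat \<Rightarrow> nat \<Rightarrow> complex"
  shows "(\<Sum>p<d. \<Sum>q<d. \<Sum>i<d. \<Sum>j<d. if p = q \<and> i = j \<or> p = i \<and> q = j then f p q i j else 0)
    = (\<Sum>p<d. \<Sum>q<d. f p q p q) + (\<Sum>i<d. \<Sum>p<d. if p = i then 0 else f p p i i)"
proof -
  have inner: "(\<Sum>i<d. \<Sum>j<d. if p = q \<and> i = j \<or> p = i \<and> q = j then f p q i j else 0)
    = f p q p q + (if p = q then (\<Sum>i<d. if p = i then 0 else f p p i i) else 0)"
    if pq: "p < d" "q < d" for p q
  proof (cases "p = q")
    case True
    have "(\<Sum>i<d. \<Sum>j<d. if p = q \<and> i = j \<or> p = i \<and> q = j then f p q i j else 0)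
      = (\<Sum>i<d. \<Sum>j<d. if i = j then f p p i i else 0)"
      using True by (intro sum.cong) auto
    also have "\<dots> = (\<Sum>i<d. f p p i i)" by simp
    also have "\<dots> = f p p p p + (\<Sum>i\<in>{..<d} - {p}. f p p i i)"
      using pq by (subst sum.remove[of _ p]) auto
    also have "(\<Sum>i\<in>{..<d} - {p}. f p p i i) = (\<Sum>i<d. if p = i then 0 else f p p i i)"
      by (intro sum.mono_neutral_cong_left) auto
    finally show ?thesis using True by simp
  next
    case False
    have "(\<Sum>i<d. \<Sum>j<d. if p = q \<and> i = j \<or> p = i \<and> q = j then f p q i j else 0)
      = (\<Sum>i<d. \<Sum>j<d. if q = j then (if p = i then f p q p q else 0) else 0)"
      using False by (intro sum.cong) auto
    also have "\<dots> = f p q p q" using pq by simp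
    finally show ?thesis using False by simp
  qed
  have "(\<Sum>p<d. \<Sum>q<d. \<Sum>i<d. \<Sum>j<d. if p = q \<and> i = j \<or> p = i \<and> q = j then f p q i j else 0)
    = (\<Sum>p<d. \<Sum>q<d. f p q p q + (if p = q then (\<Sum>i<d. if p = i then 0 else f p p i i) else 0))"
    using inner by (intro sum.cong) auto
  also have "\<dots> = (\<Sum>p<d. \<Sum>q<d. f p q p q) + (\<Sum>p<d. \<Sum>i<d. if p = i then 0 else f p p i i)"
    by (simp add: sum.distrib)
  also have "(\<Sum>p<d. \<Sum>i<d. if p = i then 0 else f p p i i) = (\<Sum>i<d. \<Sum>p<d. if p = i then 0 else f p p i i)"
    by (rule sum.swap)
  finally show ?thesis .
qed

text \<open>
  For phases \<open>\<theta>\<close> let \<open>x\<^sub>p = \<theta>\<^sub>p / \<surd>h\<^sub>p\<close> and \<open>y = \<Sum>\<^sub>i \<theta>\<^sub>i \<surd>h\<^sub>i z\<^sub>i\<close>, where \<open>z\<^sub>i\<close> are the components of a test vector \<open>z\<close>.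
  The average of \<open>\<langle>y, \<Phi> (x x\<^sup>*) y\<rangle>\<close> over the phases is \<open>\<langle>z, X z\<rangle>\<close>: the matching that pairs \<open>x\<close> with \<open>y\<close>
  gives the Choi kernel, where the weights cancel, and the one that pairs \<open>x\<close> with \<open>x\<close> gives the block
  diagonal terms. Similarly the average of \<open>\<Sum>\<^sub>r w\<^sub>r |y\<^sub>r|\<^sup>2\<close> is the diagonal form with entries \<open>h\<^sub>i w\<^sub>r\<close>. Hence both
  bounds on \<open>\<Phi> (x x\<^sup>*)\<close> pass to \<open>X\<close>.
\<close>

lemma phase_average:
  fixes h w :: "nat \<Rightarrow> real" and F :: "nat \<Rightarrow> nat \<Rightarrow> nat \<Rightarrow> nat \<Rightarrow> complex"
  assumes pos: "\<And>x. pos_kernel {..<d} (\<lambda>r s. \<Sum>p<d. \<Sum>q<d. x p * cnj (x q) * F p q r s)"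
    and blocks: "\<And>j. j < d \<Longrightarrow> pos_kernel {..<d} (F j j)"
    and h: "\<And>p. p < d \<Longrightarrow> 0 < h p"
    and bound: "\<And>x. (\<And>p. p < d \<Longrightarrow> (cmod (x p))\<^sup>2 = 1 / h p) \<Longrightarrow>
      pos_kernel {..<d} (\<lambda>r s. (if r = s then of_real (w r) else 0) - (\<Sum>p<d. \<Sum>q<d. x p * cnj (x q) * F p q r s))"
  defines "X \<equiv> \<lambda>x y. F (fst x) (fst y) (snd x) (snd y)
    + (if fst x = fst y then \<Sum>j<d. if j = fst x then 0 else of_real (h (fst x) / h j) * F j j (snd x) (snd y) else 0)"
  shows "pos_kernel ({..<d} \<times> {..<d}) X"
    and "pos_kernel ({..<d} \<times> {..<d}) (\<lambda>x y. X x y - F (fst x) (fst y) (snd x) (snd y))"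
    and "pos_kernel ({..<d} \<times> {..<d}) (\<lambda>x y. (if x = y then of_real (h (fst x) * w (snd x)) else 0) - X x y)"
proof -
  let ?R = "{..<d}"
  obtain N :: nat and \<theta> where N: "0 < N" and \<theta>: "\<And>\<tau> i. cmod (\<theta> \<tau> i) = 1"
    and \<theta>4: "\<And>p q i j. p < d \<Longrightarrow> q < d \<Longrightarrow> i < d \<Longrightarrow> j < d \<Longrightarrow>
      (\<Sum>\<tau><N. \<theta> \<tau> p * cnj (\<theta> \<tau> q) * cnj (\<theta> \<tau> i) * \<theta> \<tau> j)
        = (if p = q \<and> i = j \<or> p = i \<and> q = j then of_nat N else 0)"
    by (rule phases[of d]) blast
  have \<theta>2: "(\<Sum>\<tau><N. \<theta> \<tau> j * cnj (\<theta> \<tau> i)) = (if i = j then of_nat N else 0)" if "i < d" "j < d" for i j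
  proof -
    have "\<theta> \<tau> j * cnj (\<theta> \<tau> i) = \<theta> \<tau> i * cnj (\<theta> \<tau> i) * cnj (\<theta> \<tau> i) * \<theta> \<tau> j" for \<tau>
    proof -
      have "\<theta> \<tau> i * cnj (\<theta> \<tau> i) = 1" using \<theta>[of \<tau> i] by (simp add: mult_cnj_self)
      then show ?thesis by (simp only: mult_1_left mult.commute)
    qed
    then have "(\<Sum>\<tau><N. \<theta> \<tau> j * cnj (\<theta> \<tau> i))
      = (\<Sum>\<tau><N. \<theta> \<tau> i * cnj (\<theta> \<tau> i) * cnj (\<theta> \<tau> i) * \<theta> \<tau> j)" by (intro sum.cong refl)
    then show ?thesis unfolding \<theta>4[OF that(1,1,1,2)] by simp
  qed
  define a where "a \<tau> p = \<theta> \<tau> p / of_real (sqrt (h p))" for \<tau> p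
  define c where "c \<tau> i = \<theta> \<tau> i * of_real (sqrt (h i))" for \<tau> i
  define G where "G \<tau> r s = (\<Sum>p<d. \<Sum>q<d. a \<tau> p * cnj (a \<tau> q) * F p q r s)" for \<tau> r s
  define y where "y z \<tau> r = (\<Sum>i<d. c \<tau> i * z (i, r))" for z :: "nat \<times> nat \<Rightarrow> complex" and \<tau> r
  have a: "(cmod (a \<tau> p))\<^sup>2 = 1 / h p" if "p < d" for \<tau> p
    using h[OF that] \<theta> by (simp add: a_def norm_divide power_divide)
  have average: "(\<Sum>\<tau><N. qform ?R (G \<tau>) (y z \<tau>)) = of_nat N * qform (?R \<times> ?R) X z" for z
  proof -
    define g where "g p q i j = (\<Sum>r<d. \<Sum>s<d. cnj (z (i, r)) * F p q r s * z (j, s))" for p q i j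
    define H where "H p q i j = complex_of_real (sqrt (h i) * sqrt (h j) / (sqrt (h p) * sqrt (h q)))" for p q i j
    have Q: "qform ?R (G \<tau>) (y z \<tau>) = (\<Sum>p<d. \<Sum>q<d. \<Sum>i<d. \<Sum>j<d.
      \<theta> \<tau> p * cnj (\<theta> \<tau> q) * cnj (\<theta> \<tau> i) * \<theta> \<tau> j * (H p q i j * g p q i j))" for \<tau>
    proof -
      have "qform ?R (G \<tau>) (y z \<tau>) = (\<Sum>p<d. \<Sum>q<d. a \<tau> p * cnj (a \<tau> q) * qform ?R (F p q) (y z \<tau>))"
        unfolding G_def by (simp only: qform_sum qform_scale)
      also have "\<dots> = (\<Sum>p<d. \<Sum>q<d. a \<tau> p * cnj (a \<tau> q) * (\<Sum>i<d. \<Sum>j<d. cnj (c \<tau> i) * c \<tau> j * g p q i j))"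
        unfolding y_def qform_combination g_def ..
      also have "\<dots> = (\<Sum>p<d. \<Sum>q<d. \<Sum>i<d. \<Sum>j<d.
        \<theta> \<tau> p * cnj (\<theta> \<tau> q) * cnj (\<theta> \<tau> i) * \<theta> \<tau> j * (H p q i j * g p q i j))"
        unfolding sum_distrib_left by (intro sum.cong refl) (simp add: a_def c_def H_def)
      finally show ?thesis .
    qed
    have "(\<Sum>\<tau><N. qform ?R (G \<tau>) (y z \<tau>)) = (\<Sum>p<d. \<Sum>q<d. \<Sum>i<d. \<Sum>j<d. \<Sum>\<tau><N.
      \<theta> \<tau> p * cnj (\<theta> \<tau> q) * cnj (\<theta> \<tau> i) * \<theta> \<tau> j * (H p q i j * g p q i j))"
      unfolding Q by (simp only: sum.swap[of _ "{..<d}" "{..<N}"])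
    also have "\<dots> = (\<Sum>p<d. \<Sum>q<d. \<Sum>i<d. \<Sum>j<d.
      if p = q \<and> i = j \<or> p = i \<and> q = j then of_nat N * (H p q i j * g p q i j) else 0)"
      by (intro sum.cong refl) (simp add: \<theta>4 flip: sum_distrib_right)
    also have "\<dots> = (\<Sum>p<d. \<Sum>q<d. of_nat N * (H p q p q * g p q p q))
      + (\<Sum>i<d. \<Sum>p<d. if p = i then 0 else of_nat N * (H p p i i * g p p i i))"
      by (rule sum_pairings)
    also have "(\<Sum>p<d. \<Sum>q<d. of_nat N * (H p q p q * g p q p q)) = of_nat N * (\<Sum>p<d. \<Sum>q<d. g p q p q)"
      unfolding sum_distrib_left
    proof (intro sum.cong refl)
      fix p q assume "p \<in> {..<d}" "q \<in> {..<d}"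
      then have "H p q p q = 1" using h[of p] h[of q] by (simp add: H_def)
      then show "of_nat N * (H p q p q * g p q p q) = of_nat N * g p q p q" by simp
    qed
    also have "(\<Sum>i<d. \<Sum>p<d. if p = i then 0 else of_nat N * (H p p i i * g p p i i))
      = of_nat N * (\<Sum>i<d. \<Sum>p<d. if p = i then 0 else of_real (h i / h p) * g p p i i)"
      unfolding sum_distrib_left
    proof (intro sum.cong refl)
      fix i p assume "i \<in> {..<d}" "p \<in> {..<d}"
      then have "H p p i i = of_real (h i / h p)" using h[of p] h[of i] by (simp add: H_def)
      then show "(if p = i then 0 else of_nat N * (H p p i i * g p p i i))
        = of_nat N * (if p = i then 0 else of_real (h i / h p) * g p p i i)" by simp
    qed
    also have "(\<Sum>i<d. \<Sum>p<d. if p = i then 0 else of_real (h i / h p) * g p p i i)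
      = (\<Sum>i<d. \<Sum>j<d. if i = j then \<Sum>p<d. if p = i then 0 else of_real (h i / h p) * g p p i i else 0)"
      by simp
    also have "\<dots> = qform (?R \<times> ?R) (\<lambda>x y. if fst x = fst y
      then \<Sum>j<d. if j = fst x then 0 else of_real (h (fst x) / h j) * F j j (snd x) (snd y) else 0) z"
      unfolding qform_Times fst_conv snd_conv
    proof (intro sum.cong refl)
      fix i j
      show "(if i = j then \<Sum>p<d. if p = i then 0 else of_real (h i / h p) * g p p i i else 0)
        = (\<Sum>r<d. \<Sum>s<d. cnj (z (i, r)) * (if i = j then \<Sum>l<d. if l = i then 0
            else of_real (h i / h l) * F l l r s else 0) * z (j, s))"
      proof (cases "i = j")
        case True
        have "(\<Sum>p<d. if p = i then 0 else of_real (h i / h p) * g p p i i)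
          = (\<Sum>p<d. (if p = i then 0 else of_real (h i / h p)) * qform ?R (F p p) (\<lambda>r. z (i, r)))"
          by (intro sum.cong) (auto simp: g_def qform_def)
        also have "\<dots> = qform ?R (\<lambda>r s. \<Sum>p<d. (if p = i then 0 else of_real (h i / h p)) * F p p r s) (\<lambda>r. z (i, r))"
          by (simp only: qform_sum qform_scale)
        also have "\<dots> = qform ?R (\<lambda>r s. \<Sum>p<d. if p = i then 0 else of_real (h i / h p) * F p p r s) (\<lambda>r. z (i, r))"
          by (intro qform_cong sum.cong) auto
        finally show ?thesis using True by (simp add: qform_def)
      qed simp
    qed
    also have "(\<Sum>p<d. \<Sum>q<d. g p q p q) = qform (?R \<times> ?R) (\<lambda>x y. F (fst x) (fst y) (snd x) (snd y)) z"
      unfolding qform_Times g_def by simp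
    also have "of_nat N * qform (?R \<times> ?R) (\<lambda>x y. F (fst x) (fst y) (snd x) (snd y)) z
      + of_nat N * qform (?R \<times> ?R) (\<lambda>x y. if fst x = fst y
      then \<Sum>j<d. if j = fst x then 0 else of_real (h (fst x) / h j) * F j j (snd x) (snd y) else 0) z
      = of_nat N * qform (?R \<times> ?R) X z"
      unfolding X_def qform_add distrib_left ..
    finally show ?thesis .
  qed
  have average_diag: "(\<Sum>\<tau><N. qform ?R (\<lambda>r s. if r = s then of_real (w r) else 0) (y z \<tau>))
    = of_nat N * qform (?R \<times> ?R) (\<lambda>x y. if x = y then of_real (h (fst x) * w (snd x)) else 0) z" for z
  proof -
    have norm_y: "(\<Sum>\<tau><N. y z \<tau> r * cnj (y z \<tau> r)) = of_nat N * (\<Sum>i<d. of_real (h i * (cmod (z (i, r)))\<^sup>2))" for r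
    proof -
      have "(\<Sum>\<tau><N. y z \<tau> r * cnj (y z \<tau> r)) = (\<Sum>\<tau><N. \<Sum>j<d. \<Sum>i<d.
        \<theta> \<tau> j * cnj (\<theta> \<tau> i) * (of_real (sqrt (h j) * sqrt (h i)) * (z (j, r) * cnj (z (i, r)))))"
        unfolding y_def cnj_sum sum_product by (intro sum.cong refl) (simp add: c_def)
      also have "\<dots> = (\<Sum>j<d. \<Sum>i<d. \<Sum>\<tau><N.
        \<theta> \<tau> j * cnj (\<theta> \<tau> i) * (of_real (sqrt (h j) * sqrt (h i)) * (z (j, r) * cnj (z (i, r)))))"
        by (simp only: sum.swap[of _ "{..<d}" "{..<N}"])
      also have "\<dots> = (\<Sum>j<d. \<Sum>i<d. if i = j then of_nat N * of_real (h j * (cmod (z (j, r)))\<^sup>2) else 0)"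
      proof (intro sum.cong refl)
        fix i j assume ij: "j \<in> {..<d}" "i \<in> {..<d}"
        then have "complex_of_real (sqrt (h j)) * complex_of_real (sqrt (h j)) = of_real (h j)"
          using h[of j] by (simp flip: of_real_mult)
        then show "(\<Sum>\<tau><N. \<theta> \<tau> j * cnj (\<theta> \<tau> i) * (of_real (sqrt (h j) * sqrt (h i)) * (z (j, r) * cnj (z (i, r)))))
          = (if i = j then of_nat N * of_real (h j * (cmod (z (j, r)))\<^sup>2) else 0)"
          using ij by (simp add: \<theta>2 mult_cnj_self flip: sum_distrib_right)
      qed
      also have "\<dots> = of_nat N * (\<Sum>i<d. of_real (h i * (cmod (z (i, r)))\<^sup>2))"
        by (simp add: sum_distrib_left)
      finally show ?thesis .
    qed
    have "(\<Sum>\<tau><N. qform ?R (\<lambda>r s. if r = s then of_real (w r) else 0) (y z \<tau>))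
      = (\<Sum>\<tau><N. \<Sum>r<d. of_real (w r) * (y z \<tau> r * cnj (y z \<tau> r)))"
      by (simp add: qform_diagonal mult_cnj_self)
    also have "\<dots> = (\<Sum>r<d. of_real (w r) * (\<Sum>\<tau><N. y z \<tau> r * cnj (y z \<tau> r)))"
      unfolding sum_distrib_left by (rule sum.swap)
    also have "\<dots> = of_nat N * (\<Sum>r<d. \<Sum>i<d. of_real (h i * w r * (cmod (z (i, r)))\<^sup>2))"
      unfolding norm_y by (simp add: sum_distrib_left mult_ac)
    also have "(\<Sum>r<d. \<Sum>i<d. complex_of_real (h i * w r * (cmod (z (i, r)))\<^sup>2))
      = (\<Sum>i<d. \<Sum>r<d. complex_of_real (h i * w r * (cmod (z (i, r)))\<^sup>2))"
      by (rule sum.swap)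
    also have "\<dots> = qform (?R \<times> ?R) (\<lambda>x y. if x = y then of_real (h (fst x) * w (snd x)) else 0) z"
      by (subst qform_diagonal) (simp_all add: sum.cartesian_product')
    finally show ?thesis .
  qed
  have G: "pos_kernel ?R (G \<tau>)" for \<tau> unfolding G_def by (rule pos)
  have cancel: "0 \<le> x" if "0 \<le> of_nat N * x" for x :: complex
    using that N by (auto simp: less_eq_complex_def zero_le_mult_iff)
  show "pos_kernel (?R \<times> ?R) X"
    unfolding pos_kernel_def
  proof
    fix z
    have "0 \<le> (\<Sum>\<tau><N. qform ?R (G \<tau>) (y z \<tau>))" using G by (intro sum_nonneg) (auto simp: pos_kernel_def)
    then show "0 \<le> qform (?R \<times> ?R) X z" unfolding average by (rule cancel)
  qed
  show "pos_kernel (?R \<times> ?R) (\<lambda>x y. (if x = y then of_real (h (fst x) * w (snd x)) else 0) - X x y)"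
    unfolding pos_kernel_def
  proof
    fix z
    have "0 \<le> (\<Sum>\<tau><N. qform ?R (\<lambda>r s. (if r = s then of_real (w r) else 0) - G \<tau> r s) (y z \<tau>))"
      using bound[OF a] unfolding G_def pos_kernel_def by (intro sum_nonneg) auto
    then have "0 \<le> of_nat N * qform (?R \<times> ?R) (\<lambda>x y. (if x = y then of_real (h (fst x) * w (snd x)) else 0) - X x y) z"
      unfolding qform_diff sum_subtractf average average_diag right_diff_distrib .
    then show "0 \<le> qform (?R \<times> ?R) (\<lambda>x y. (if x = y then of_real (h (fst x) * w (snd x)) else 0) - X x y) z"
      by (rule cancel)
  qed
  show "pos_kernel (?R \<times> ?R) (\<lambda>x y. X x y - F (fst x) (fst y) (snd x) (snd y))"
  proof -
    have "pos_kernel (?R \<times> ?R) (\<lambda>x y. if fst x = fst y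
      then \<Sum>j<d. of_real (if j = fst x then 0 else h (fst x) / h j) * F j j (snd x) (snd y) else 0)"
      using blocks h
      by (intro pos_kernel_block_diagonal pos_kernel_sum pos_kernel_scale) (auto intro: less_imp_le)
    then show ?thesis
      by (rule pos_kernel_eqI) (auto simp: X_def intro!: sum.cong)
  qed
qed

section \<open>Eigenvalue sums of the Choi kernel\<close>

lemma fibre_sum:
  fixes g :: "nat \<times> nat \<Rightarrow> real"
  assumes "i < d"
  shows "(\<Sum>a\<in>{a \<in> {..<d} \<times> {..<d}. fst a = i}. g a) = (\<Sum>r<d. g (i, r))"
    and "(\<Sum>a\<in>{a \<in> {..<d} \<times> {..<d}. snd a = i}. g a) = (\<Sum>p<d. g (p, i))"
proof -
  have "{a \<in> {..<d} \<times> {..<d}. fst a = i} = Pair i ` {..<d}"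
    "{a \<in> {..<d} \<times> {..<d}. snd a = i} = (\<lambda>p. (p, i)) ` {..<d}"
    using assms by auto
  then show "(\<Sum>a\<in>{a \<in> {..<d} \<times> {..<d}. fst a = i}. g a) = (\<Sum>r<d. g (i, r))"
    "(\<Sum>a\<in>{a \<in> {..<d} \<times> {..<d}. snd a = i}. g a) = (\<Sum>p<d. g (p, i))"
    by (simp_all add: sum.reindex inj_on_def)
qed

lemma pos_kernel_minus_mono:
  assumes "finite I" "pos_kernel I (\<lambda>a b. (if a = b then of_real (f a) else 0) - X a b)"
    "\<And>a. a \<in> I \<Longrightarrow> f a \<le> g a"
  shows "pos_kernel I (\<lambda>a b. (if a = b then of_real (g a) else 0) - X a b)"
proof -
  have "pos_kernel I (\<lambda>a b. if a = b then of_real (g a - f a) else 0)"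
    using assms by (intro pos_kernel_diagonal) auto
  from pos_kernel_add[OF this assms(2)] show ?thesis
    by (rule pos_kernel_eqI) auto
qed

text \<open>
  Equality holds for \<open>k = 2\<close> and for \<open>k = d\<close>; in general the difference of the two sides, multiplied by \<open>k - 1\<close>, is
  \<open>(k - 2) (d - k)\<close>.
\<close>

lemma keb_factor:
  fixes k d :: nat
  assumes "2 \<le> k" "k \<le> d"
  shows "(real d - 1) / (real k - 1) \<le> real (d - k + 1)"
proof -
  define a b where "a = k - 2" and "b = d - k"
  have kd: "k = a + 2" "d = a + b + 2" using assms by (auto simp: a_def b_def)
  have "real d - 1 \<le> real (d - k + 1) * (real k - 1)"
    by (simp add: kd algebra_simps)
  then show ?thesis using assms by (simp add: divide_le_eq)
qed

text \<open>
  In each case a kernel \<open>X\<close> above the Choi kernel is fed into \<open>eigenvalue_sum_le\<close>. For \<open>k = 1\<close> the two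
  bounds required by \<open>phase_average\<close> are: for \<open>tr\<^sub>2\<close>, \<open>\<Phi> (x x\<^sup>*)\<close> is at most its trace
  \<open>\<Sum>\<^sub>p m\<^sub>p / h\<^sub>p \<le> d\<close>; for \<open>tr\<^sub>1\<close>, \<open>x x\<^sup>* \<le> d\<close> and therefore \<open>\<Phi> (x x\<^sup>*) \<le> d \<Phi> (1)\<close>, where \<open>\<Phi> (1)\<close> is diagonal with
  entries \<open>n\<close>.
\<close>

theorem keb_kernel_majorization:
  fixes m n lam :: "nat \<Rightarrow> real"
  assumes keb: "keb_kernel k d F" and k: "1 \<le> k" "k \<le> d"
    and tr2: "\<And>p q. p < d \<Longrightarrow> q < d \<Longrightarrow> (\<Sum>r<d. F p q r r) = (if p = q then of_real (m p) else 0)"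
    and tr1: "\<And>r s. r < d \<Longrightarrow> s < d \<Longrightarrow> (\<Sum>p<d. F p p r s) = (if r = s then of_real (n r) else 0)"
    and m: "\<And>i j. i \<le> j \<Longrightarrow> j < d \<Longrightarrow> m j \<le> m i"
    and n: "\<And>i j. i \<le> j \<Longrightarrow> j < d \<Longrightarrow> n j \<le> n i"
    and u: "orthonormal_basis {..<D} ({..<d} \<times> {..<d}) u" "l \<le> D"
      "\<And>x y. x \<in> {..<d} \<times> {..<d} \<Longrightarrow> y \<in> {..<d} \<times> {..<d} \<Longrightarrow>
        F (fst x) (fst y) (snd x) (snd y) = (\<Sum>t<D. of_real (lam t) * (u t x * cnj (u t y)))"
  shows "(\<Sum>j<l. lam j) \<le> (\<Sum>i<min l d. real (d - k + 1) * m i)"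
    and "(\<Sum>j<l. lam j) \<le> (\<Sum>i<min l d. real (d - k + 1) * n i)"
proof -
  let ?I = "{..<d} \<times> {..<d}"
  have I: "finite ?I" by simp
  have blocks: "pos_kernel {..<d} (F j j)" if "j < d" for j
    using keb_kernel_diagonal_block[OF keb _ that] k by simp
  have F0: "0 \<le> F p p r r" if "p < d" "r < d" for p r
    using pos_kernel_diag_nonneg[OF _ blocks[OF that(1)], of r] that by simp
  have m0: "0 \<le> m p" if "p < d" for p
  proof -
    have "0 \<le> (\<Sum>r<d. F p p r r)" using F0 that by (intro sum_nonneg) auto
    then show ?thesis using tr2[OF that that] by (simp add: less_eq_complex_def)
  qed
  have n0: "0 \<le> n r" if "r < d" for r
  proof -
    have "0 \<le> (\<Sum>p<d. F p p r r)" using F0 that by (intro sum_nonneg) auto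
    then show ?thesis using tr1[OF that that] by (simp add: less_eq_complex_def)
  qed
  have Re_tr2: "(\<Sum>r<d. Re (F p p r r)) = m p" if "p < d" for p
    using arg_cong[OF tr2[OF that that], of Re] by simp
  have Re_tr1: "(\<Sum>p<d. Re (F p p r r)) = n r" if "r < d" for r
    using arg_cong[OF tr1[OF that that], of Re] by simp
  define c where "c = real (d - k + 1)"
  have c0: "0 \<le> c" by (simp add: c_def)
  have goal2: "(\<Sum>j<l. lam j) \<le> (\<Sum>i<min l d. c * m i)"
    and goal1: "(\<Sum>j<l. lam j) \<le> (\<Sum>i<min l d. c * n i)" if k2: "2 \<le> k"
  proof -
    define c' where "c' = (real d - 1) / (real k - 1)"
    define X where "X x y = (if fst x = fst y then of_real c' else 1) * F (fst x) (fst y) (snd x) (snd y)"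
      for x y :: "nat \<times> nat"
    note X = subset_average[OF keb k2 k(2) tr2 tr1, folded c'_def, folded X_def]
    have cc: "c' \<le> c" unfolding c_def c'_def by (rule keb_factor[OF k2 k(2)])
    show "(\<Sum>j<l. lam j) \<le> (\<Sum>i<min l d. c * m i)"
    proof (rule eigenvalue_sum_le[OF I _ _ _ X(1,2) _ _ u, where \<kappa> = fst])
      show "pos_kernel ?I (\<lambda>a b. (if a = b then complex_of_real (c * m (fst a)) else 0) - X a b)"
        using cc m0 by (intro pos_kernel_minus_mono[OF I X(3)] mult_right_mono) auto
      fix i assume i: "i < d"
      have "(\<Sum>r<d. Re (X (i, r) (i, r))) = c' * m i"
        by (simp add: X_def Re_tr2[OF i] flip: sum_distrib_left)
      also have "\<dots> \<le> c * m i" using cc m0[OF i] by (rule mult_right_mono)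
      finally show "(\<Sum>a\<in>{a \<in> ?I. fst a = i}. Re (X a a)) \<le> c * m i"
        by (simp only: fibre_sum[OF i])
    qed (use m m0 c0 in \<open>auto intro: mult_left_mono\<close>)
    show "(\<Sum>j<l. lam j) \<le> (\<Sum>i<min l d. c * n i)"
    proof (rule eigenvalue_sum_le[OF I _ _ _ X(1,2) _ _ u, where \<kappa> = snd])
      show "pos_kernel ?I (\<lambda>a b. (if a = b then complex_of_real (c * n (snd a)) else 0) - X a b)"
        using cc n0 by (intro pos_kernel_minus_mono[OF I X(4)] mult_right_mono) auto
      fix i assume i: "i < d"
      have "(\<Sum>p<d. Re (X (p, i) (p, i))) = c' * n i"
        by (simp add: X_def Re_tr1[OF i] flip: sum_distrib_left)
      also have "\<dots> \<le> c * n i" using cc n0[OF i] by (rule mult_right_mono)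
      finally show "(\<Sum>a\<in>{a \<in> ?I. snd a = i}. Re (X a a)) \<le> c * n i"
        by (simp only: fibre_sum[OF i])
    qed (use n n0 c0 in \<open>auto intro: mult_left_mono\<close>)
  qed
  have goal2': "(\<Sum>j<l. lam j) \<le> (\<Sum>i<min l d. c * m i)"
    and goal1': "(\<Sum>j<l. lam j) \<le> (\<Sum>i<min l d. c * n i)" if k1: "k = 1"
  proof -
    have c: "c = real d" using k k1 by (simp add: c_def)
    define X where "X h x y = F (fst x) (fst y) (snd x) (snd y) + (if fst x = fst y
      then \<Sum>j<d. if j = fst x then 0 else complex_of_real (h (fst x) / h j) * F j j (snd x) (snd y) else 0)"
      for h :: "nat \<Rightarrow> real" and x y :: "nat \<times> nat"
    define G where "G x r s = (\<Sum>p<d. \<Sum>q<d. x p * cnj (x q) * F p q r s)" for x r s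
    have G: "pos_kernel {..<d} (G x)" for x
      unfolding G_def using keb_kernel_positive[OF keb] k by simp
    note average = phase_average[of d F, folded G_def, OF G blocks, folded X_def]
    have "(\<Sum>j<l. lam j) \<le> (\<Sum>i<min l d. c * m i) + \<delta>" if \<delta>: "0 < \<delta>" for \<delta>
    proof -
      \<comment> \<open>The shift of the weights by \<open>\<epsilon>\<close> adds \<open>d \<epsilon>\<close> to each of at most \<open>d\<close> summands.\<close>
      define \<epsilon> where "\<epsilon> = \<delta> / (real d * real d)"
      have d0: "0 < d" using k by simp
      have \<epsilon>: "0 < \<epsilon>" using \<delta> d0 by (simp add: \<epsilon>_def)
      define h where "h p = m p + \<epsilon>" for p
      have h: "0 < h p" if "p < d" for p using m0[OF that] \<epsilon> by (simp add: h_def)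
      have bound: "pos_kernel {..<d} (\<lambda>r s. (if r = s then complex_of_real (real d) else 0) - G x r s)"
        if x: "\<And>p. p < d \<Longrightarrow> (cmod (x p))\<^sup>2 = 1 / h p" for x
      proof -
        have "(\<Sum>r<d. G x r r) = (\<Sum>p<d. \<Sum>q<d. x p * cnj (x q) * (\<Sum>r<d. F p q r r))"
          unfolding G_def sum_distrib_left by (subst sum.swap, rule sum.cong[OF refl], rule sum.swap)
        also have "\<dots> = (\<Sum>p<d. \<Sum>q<d. if p = q then x p * cnj (x p) * of_real (m p) else 0)"
          by (intro sum.cong refl) (auto simp: tr2)
        also have "\<dots> = (\<Sum>p<d. of_real (m p / h p))"
          using x by (auto simp: complex_norm_square[symmetric] simp del: of_real_power intro!: sum.cong)
        finally have tr: "(\<Sum>r<d. G x r r) = of_real (\<Sum>p<d. m p / h p)" by simp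
        have le: "(\<Sum>p<d. m p / h p) \<le> real d"
        proof -
          have "(\<Sum>p<d. m p / h p) \<le> (\<Sum>p<d. 1)"
            using h \<epsilon> by (intro sum_mono) (auto simp: h_def divide_le_eq)
          then show ?thesis by simp
        qed
        have "pos_kernel {..<d} (\<lambda>r s. (if r = s then of_real (\<Sum>p<d. m p / h p) else 0) - G x r s)"
          using trace_minus_pos_kernel[OF _ G[of x]] unfolding tr by simp
        from pos_kernel_minus_mono[OF _ this, of "\<lambda>_. real d"] le show ?thesis by simp
      qed
      note X = average[of h "\<lambda>_. real d", OF _ h bound]
      have "(\<Sum>j<l. lam j) \<le> (\<Sum>i<min l d. h i * real d)"
      proof (rule eigenvalue_sum_le[where \<kappa> = fst and \<alpha> = "\<lambda>i. h i * real d", OF I _ _ _ X(1,2,3) _ u])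
        fix i assume i: "i < d"
        have "(\<Sum>r<d. Re (X h (i, r) (i, r))) = m i + (\<Sum>r<d. \<Sum>j<d. if j = i then 0 else h i / h j * Re (F j j r r))"
          by (simp add: X_def sum.distrib Re_tr2[OF i] if_distrib[of Re] cong: if_cong)
        also have "(\<Sum>r<d. \<Sum>j<d. if j = i then 0 else h i / h j * Re (F j j r r))
          = (\<Sum>j<d. \<Sum>r<d. if j = i then 0 else h i / h j * Re (F j j r r))" by (rule sum.swap)
        also have "\<dots> = (\<Sum>j<d. if j = i then 0 else h i / h j * m j)"
          by (intro sum.cong refl) (auto simp: Re_tr2 simp flip: sum_distrib_left sum_divide_distrib)
        also have "m i + \<dots> \<le> h i + (\<Sum>j<d. if j = i then 0 else h i)"
        proof (intro add_mono sum_mono)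
          fix j assume "j \<in> {..<d}"
          then show "(if j = i then 0 else h i / h j * m j) \<le> (if j = i then 0 else h i)"
            using h[of j] h[OF i] \<epsilon> by (auto simp: h_def divide_le_eq mult_left_mono)
        qed (use \<epsilon> in \<open>simp add: h_def\<close>)
        also have "(\<Sum>j<d. if j = i then 0 else h i) = (\<Sum>j\<in>{..<d} - {i}. h i)"
          by (intro sum.mono_neutral_cong_right) auto
        also have "h i + (\<Sum>j\<in>{..<d} - {i}. h i) = h i * real d"
          using i by (simp add: of_nat_diff algebra_simps)
        finally show "(\<Sum>a\<in>{a \<in> ?I. fst a = i}. Re (X h a a)) \<le> h i * real d"
          by (simp only: fibre_sum[OF i])
      next
        show "\<And>i j. i \<le> j \<Longrightarrow> j < d \<Longrightarrow> h j * real d \<le> h i * real d"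
          using m by (auto simp: h_def intro!: mult_right_mono)
        show "\<And>i. i < d \<Longrightarrow> 0 \<le> h i * real d" using h by (auto intro: less_imp_le)
      qed auto
      also have "(\<Sum>i<min l d. h i * real d) = (\<Sum>i<min l d. c * m i) + real (min l d) * (\<epsilon> * real d)"
        by (simp add: h_def c algebra_simps sum.distrib)
      also have "real (min l d) * (\<epsilon> * real d) \<le> real d * (\<epsilon> * real d)"
        using \<epsilon> by (intro mult_right_mono) auto
      also have "\<dots> = \<delta>" using d0 by (simp add: \<epsilon>_def)
      finally show ?thesis by simp
    qed
    then show "(\<Sum>j<l. lam j) \<le> (\<Sum>i<min l d. c * m i)" by (rule field_le_epsilon)
    have bound: "pos_kernel {..<d} (\<lambda>r s. (if r = s then complex_of_real (c * n r) else 0) - G x r s)"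
      if x: "\<And>p. p < d \<Longrightarrow> (cmod (x p))\<^sup>2 = 1 / (\<lambda>_. 1) p" for x
      unfolding pos_kernel_def qform_diff
    proof
      fix y
      \<comment> \<open>For fixed \<open>y\<close>, \<open>\<langle>y, \<Phi> (x x\<^sup>*) y\<rangle>\<close> is a positive form in \<open>x\<close> with kernel \<open>L\<close>, bounded by its trace.\<close>
      define L where "L q p = qform {..<d} (F p q) y" for q p
      have GL: "qform {..<d} (G v) y = qform {..<d} L v" for v
      proof -
        have "qform {..<d} (G v) y = (\<Sum>p<d. \<Sum>q<d. v p * cnj (v q) * L q p)"
          unfolding G_def L_def by (simp only: qform_sum qform_scale)
        also have "\<dots> = qform {..<d} L v"
          unfolding qform_def by (subst sum.swap) (simp add: mult_ac)
        finally show ?thesis .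
      qed
      have "pos_kernel {..<d} L" using G unfolding pos_kernel_def GL[symmetric] by blast
      from trace_minus_pos_kernel[OF _ this]
      have "0 \<le> qform {..<d} (\<lambda>a b. if a = b then (\<Sum>p<d. L p p) else 0) x - qform {..<d} L x"
        unfolding pos_kernel_def qform_diff by simp
      moreover have "(\<Sum>p<d. L p p) = of_real (\<Sum>r<d. n r * (cmod (y r))\<^sup>2)"
      proof -
        have "(\<Sum>p<d. L p p) = qform {..<d} (\<lambda>r s. \<Sum>p<d. F p p r s) y"
          unfolding L_def qform_sum ..
        also have "\<dots> = qform {..<d} (\<lambda>r s. if r = s then of_real (n r) else 0) y"
          by (rule qform_cong) (simp add: tr1)
        also have "\<dots> = of_real (\<Sum>r<d. n r * (cmod (y r))\<^sup>2)" by (rule qform_diagonal) simp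
        finally show ?thesis .
      qed
      moreover have "qform {..<d} (\<lambda>a b. if a = b then complex_of_real (\<Sum>r<d. n r * (cmod (y r))\<^sup>2) else 0) x
        = of_real (c * (\<Sum>r<d. n r * (cmod (y r))\<^sup>2))"
        using x unfolding qform_diagonal[OF finite_lessThan, of d "\<lambda>_. \<Sum>r<d. n r * (cmod (y r))\<^sup>2"]
        by (simp add: c)
      moreover have "qform {..<d} (\<lambda>r s. if r = s then complex_of_real (c * n r) else 0) y
        = of_real (c * (\<Sum>r<d. n r * (cmod (y r))\<^sup>2))"
        unfolding qform_diagonal[OF finite_lessThan, of d "\<lambda>r. c * n r"] by (simp only: sum_distrib_left mult.assoc)
      ultimately show "0 \<le> qform {..<d} (\<lambda>r s. if r = s then complex_of_real (c * n r) else 0) y - qform {..<d} (G x) y"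
        unfolding GL by (simp only:)
    qed
    have one: "0 < (1::real)" if "p < d" for p by simp
    note X = average[of "\<lambda>_. 1" "\<lambda>r. c * n r", OF _ one bound]
    show "(\<Sum>j<l. lam j) \<le> (\<Sum>i<min l d. c * n i)"
    proof (rule eigenvalue_sum_le[OF I _ _ _ X(1,2) _ _ u, where \<kappa> = snd])
      show "pos_kernel ?I (\<lambda>a b. (if a = b then complex_of_real (c * n (snd a)) else 0) - X (\<lambda>_. 1) a b)"
        using X(3) unfolding mult_1 .
      fix i assume i: "i < d"
      have "(\<Sum>p<d. Re (X (\<lambda>_. 1) (p, i) (p, i))) = n i + (\<Sum>p<d. \<Sum>j<d. if j = p then 0 else Re (F j j i i))"
        by (simp add: X_def sum.distrib Re_tr1[OF i] if_distrib[of Re] cong: if_cong)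
      also have "(\<Sum>p<d. \<Sum>j<d. if j = p then 0 else Re (F j j i i)) = (\<Sum>p<d. n i - Re (F p p i i))"
      proof (intro sum.cong refl)
        fix p assume "p \<in> {..<d}"
        then have "n i = Re (F p p i i) + (\<Sum>j\<in>{..<d} - {p}. Re (F j j i i))"
          using sum.remove[of "{..<d}" p "\<lambda>j. Re (F j j i i)"] Re_tr1[OF i] by simp
        also have "(\<Sum>j\<in>{..<d} - {p}. Re (F j j i i)) = (\<Sum>j<d. if j = p then 0 else Re (F j j i i))"
          by (intro sum.mono_neutral_cong_left) auto
        finally show "(\<Sum>j<d. if j = p then 0 else Re (F j j i i)) = n i - Re (F p p i i)" by simp
      qed
      also have "n i + \<dots> = c * n i" by (simp add: sum_subtractf Re_tr1[OF i] c)
      finally show "(\<Sum>a\<in>{a \<in> ?I. snd a = i}. Re (X (\<lambda>_. 1) a a)) \<le> c * n i"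
        by (simp only: fibre_sum[OF i])
    qed (use n n0 c0 in \<open>auto intro: mult_left_mono\<close>)
  qed
  show "(\<Sum>j<l. lam j) \<le> (\<Sum>i<min l d. real (d - k + 1) * m i)"
    using goal2 goal2' k unfolding c_def by (cases "k = 1") auto
  show "(\<Sum>j<l. lam j) \<le> (\<Sum>i<min l d. real (d - k + 1) * n i)"
    using goal1 goal1' k unfolding c_def by (cases "k = 1") auto
qed

section \<open>Change of orthonormal bases\<close>

lemma orthonormal_basis_compose:
  assumes I: "finite I" and J: "finite J" and g: "orthonormal_basis I I g" and u: "orthonormal_basis J I u"
  shows "orthonormal_basis J I (\<lambda>t x. cip I (g x) (u t))"
  unfolding orthonormal_basis_def
proof (intro conjI ballI)
  fix s t assume st: "s \<in> J" "t \<in> J"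
  have "cip I (\<lambda>x. cip I (g x) (u s)) (\<lambda>x. cip I (g x) (u t))
    = (\<Sum>x\<in>I. \<Sum>a\<in>I. \<Sum>b\<in>I. cnj (u s a) * u t b * (g x a * cnj (g x b)))"
    unfolding cip_def by (simp add: sum_product mult_ac)
  also have "\<dots> = (\<Sum>a\<in>I. \<Sum>b\<in>I. \<Sum>x\<in>I. cnj (u s a) * u t b * (g x a * cnj (g x b)))"
    by (subst sum.swap, rule sum.cong[OF refl], rule sum.swap)
  also have "\<dots> = (\<Sum>a\<in>I. \<Sum>b\<in>I. if a = b then cnj (u s a) * u t a else 0)"
    using g unfolding orthonormal_basis_def
    by (intro sum.cong refl) (auto simp flip: sum_distrib_left)
  also have "\<dots> = cip I (u s) (u t)" using I by (simp add: cip_def)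
  also have "\<dots> = (if s = t then 1 else 0)" using u st by (simp add: orthonormal_basis_def)
  finally show "cip I (\<lambda>x. cip I (g x) (u s)) (\<lambda>x. cip I (g x) (u t)) = (if s = t then 1 else 0)" .
next
  fix x y assume xy: "x \<in> I" "y \<in> I"
  have "(\<Sum>t\<in>J. cip I (g x) (u t) * cnj (cip I (g y) (u t)))
    = (\<Sum>t\<in>J. \<Sum>a\<in>I. \<Sum>b\<in>I. cnj (g x a) * g y b * (u t a * cnj (u t b)))"
    unfolding cip_def cnj_sum complex_cnj_mult complex_cnj_cnj sum_product by (simp only: mult_ac)
  also have "\<dots> = (\<Sum>a\<in>I. \<Sum>b\<in>I. \<Sum>t\<in>J. cnj (g x a) * g y b * (u t a * cnj (u t b)))"
    by (subst sum.swap, rule sum.cong[OF refl], rule sum.swap)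
  also have "\<dots> = (\<Sum>a\<in>I. \<Sum>b\<in>I. if a = b then cnj (g x a) * g y a else 0)"
    using u unfolding orthonormal_basis_def
    by (intro sum.cong refl) (auto simp flip: sum_distrib_left)
  also have "\<dots> = cip I (g x) (g y)" using I by (simp add: cip_def)
  also have "\<dots> = (if x = y then 1 else 0)" using g xy by (simp add: orthonormal_basis_def)
  finally show "(\<Sum>t\<in>J. cip I (g x) (u t) * cnj (cip I (g y) (u t))) = (if x = y then 1 else 0)" .
qed

lemma spectral_compose:
  assumes "\<And>a b. a \<in> I \<Longrightarrow> b \<in> I \<Longrightarrow> K a b = (\<Sum>t\<in>J. lam t * (u t a * cnj (u t b)))"
  shows "(\<Sum>a\<in>I. \<Sum>b\<in>I. cnj (g x a) * K a b * g y b)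
    = (\<Sum>t\<in>J. lam t * (cip I (g x) (u t) * cnj (cip I (g y) (u t))))"
proof -
  have "(\<Sum>a\<in>I. \<Sum>b\<in>I. cnj (g x a) * K a b * g y b)
    = (\<Sum>a\<in>I. \<Sum>b\<in>I. \<Sum>t\<in>J. lam t * (cnj (g x a) * u t a * (g y b * cnj (u t b))))"
    using assms by (intro sum.cong refl) (simp add: sum_distrib_left sum_distrib_right mult_ac)
  also have "\<dots> = (\<Sum>a\<in>I. \<Sum>t\<in>J. \<Sum>b\<in>I. lam t * (cnj (g x a) * u t a * (g y b * cnj (u t b))))"
    by (intro sum.cong refl sum.swap)
  also have "\<dots> = (\<Sum>t\<in>J. \<Sum>a\<in>I. \<Sum>b\<in>I. lam t * (cnj (g x a) * u t a * (g y b * cnj (u t b))))"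
    by (rule sum.swap)
  also have "\<dots> = (\<Sum>t\<in>J. lam t * (cip I (g x) (u t) * cnj (cip I (g y) (u t))))"
    unfolding cip_def by (simp add: sum_product sum_distrib_left mult_ac)
  finally show ?thesis .
qed

lemma orthonormal_basis_diagonalizes:
  assumes e: "orthonormal_basis I I e" and I: "finite I"
    and K: "\<And>a b. a \<in> I \<Longrightarrow> b \<in> I \<Longrightarrow> K a b = (\<Sum>t\<in>I. lam t * (e t a * cnj (e t b)))"
    and p: "p \<in> I" "q \<in> I"
  shows "(\<Sum>a\<in>I. \<Sum>b\<in>I. cnj (e p a) * K a b * e q b) = (if p = q then lam p else 0)"
proof -
  have "(\<Sum>a\<in>I. \<Sum>b\<in>I. cnj (e p a) * K a b * e q b)
    = (\<Sum>t\<in>I. lam t * (cip I (e p) (e t) * cnj (cip I (e q) (e t))))"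
    by (rule spectral_compose[OF K])
  also have "\<dots> = (\<Sum>t\<in>I. if t = p then (if p = q then lam p else 0) else 0)"
    using e p by (intro sum.cong) (auto simp: orthonormal_basis_def)
  finally show ?thesis using p I by simp
qed

lemma orthonormal_basis_trace:
  assumes e: "orthonormal_basis I I e" and I: "finite I"
  shows "(\<Sum>t\<in>I. \<Sum>a\<in>I. \<Sum>b\<in>I. cnj (e t a) * K a b * e t b) = (\<Sum>a\<in>I. K a a)"
proof -
  have "(\<Sum>t\<in>I. \<Sum>a\<in>I. \<Sum>b\<in>I. cnj (e t a) * K a b * e t b)
    = (\<Sum>a\<in>I. \<Sum>b\<in>I. \<Sum>t\<in>I. K a b * (e t b * cnj (e t a)))"
    by (subst sum.swap, rule sum.cong[OF refl], subst sum.swap) (simp add: mult_ac)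
  also have "\<dots> = (\<Sum>a\<in>I. \<Sum>b\<in>I. if a = b then K a a else 0)"
    using e unfolding orthonormal_basis_def
    by (intro sum.cong refl) (auto simp flip: sum_distrib_left)
  finally show ?thesis using I by simp
qed

lemma orthonormal_basis_product:
  assumes S: "orthonormal_basis S S a" and R: "orthonormal_basis R R b"
  shows "orthonormal_basis (S \<times> R) (S \<times> R) (\<lambda>x y. a (fst x) (fst y) * b (snd x) (snd y))"
proof -
  have *: "(\<Sum>y\<in>S \<times> R. f (fst y) * g (snd y)) = (\<Sum>p\<in>S. f p) * (\<Sum>r\<in>R. g r)" for f g :: "_ \<Rightarrow> complex"
    by (simp add: sum.cartesian_product' sum_product)
  show ?thesis
    unfolding orthonormal_basis_def
  proof (intro conjI ballI)
    fix x y assume xy: "x \<in> S \<times> R" "y \<in> S \<times> R"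
    have "cip (S \<times> R) (\<lambda>z. a (fst x) (fst z) * b (snd x) (snd z)) (\<lambda>z. a (fst y) (fst z) * b (snd y) (snd z))
      = cip S (a (fst x)) (a (fst y)) * cip R (b (snd x)) (b (snd y))"
      unfolding cip_def *[symmetric] by (intro sum.cong) (simp_all add: mult_ac)
    then show "cip (S \<times> R) (\<lambda>z. a (fst x) (fst z) * b (snd x) (snd z)) (\<lambda>z. a (fst y) (fst z) * b (snd y) (snd z))
      = (if x = y then 1 else 0)"
      using S R xy by (auto simp: orthonormal_basis_def prod_eq_iff)
    have "(\<Sum>t\<in>S \<times> R. a (fst t) (fst x) * b (snd t) (snd x) * cnj (a (fst t) (fst y) * b (snd t) (snd y)))
      = (\<Sum>p\<in>S. a p (fst x) * cnj (a p (fst y))) * (\<Sum>r\<in>R. b r (snd x) * cnj (b r (snd y)))"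
      unfolding *[symmetric] by (intro sum.cong) (simp_all add: mult_ac)
    then show "(\<Sum>t\<in>S \<times> R. a (fst t) (fst x) * b (snd t) (snd x) * cnj (a (fst t) (fst y) * b (snd t) (snd y)))
      = (if x = y then 1 else 0)"
      using S R xy by (auto simp: orthonormal_basis_def prod_eq_iff)
  qed
qed

text \<open>
  The kernel of \<open>\<Phi>\<close> with the matrix units on the input side taken in the basis of the conjugates of the
  vectors \<open>a p\<close>. The conjugation makes the Choi kernel transform by \<open>a\<close> itself, see \<open>change_left_right\<close>.
\<close>

definition change_left :: "nat \<Rightarrow> (nat \<Rightarrow> nat \<Rightarrow> complex) \<Rightarrow> (nat \<Rightarrow> nat \<Rightarrow> nat \<Rightarrow> nat \<Rightarrow> complex) \<Rightarrow>
    nat \<Rightarrow> nat \<Rightarrow> nat \<Rightarrow> nat \<Rightarrow> complex" where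
  "change_left d a F p q r s = (\<Sum>p'<d. \<Sum>q'<d. cnj (a p p') * F p' q' r s * a q q')"

definition change_right :: "nat \<Rightarrow> (nat \<Rightarrow> nat \<Rightarrow> complex) \<Rightarrow> (nat \<Rightarrow> nat \<Rightarrow> nat \<Rightarrow> nat \<Rightarrow> complex) \<Rightarrow>
    nat \<Rightarrow> nat \<Rightarrow> nat \<Rightarrow> nat \<Rightarrow> complex" where
  "change_right d b F p q r s = (\<Sum>r'<d. \<Sum>s'<d. cnj (b r r') * F p q r' s' * b s s')"

text \<open>
  The change of basis is absorbed into the vectors \<open>x\<close>.
\<close>

lemma keb_kernel_change_left:
  assumes "keb_kernel k d F"
  shows "keb_kernel k d (change_left d a F)"
  unfolding keb_kernel_def
proof
  fix x :: "nat \<Rightarrow> nat \<Rightarrow> complex"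
  define x' where "x' s p' = (\<Sum>p<d. x s p * cnj (a p p'))" for s p'
  have "(\<Sum>p<d. \<Sum>q<d. x s p * cnj (x t q) * change_left d a F p q r r')
    = (\<Sum>p<d. \<Sum>q<d. x' s p * cnj (x' t q) * F p q r r')" for s t r r'
  proof -
    have "(\<Sum>p<d. \<Sum>q<d. x s p * cnj (x t q) * change_left d a F p q r r')
      = (\<Sum>p<d. \<Sum>q<d. \<Sum>p'<d. \<Sum>q'<d. (x s p * cnj (a p p')) * (cnj (x t q) * a q q') * F p' q' r r')"
      unfolding change_left_def by (simp add: sum_distrib_left mult_ac)
    also have "\<dots> = (\<Sum>p<d. \<Sum>p'<d. \<Sum>q<d. \<Sum>q'<d. (x s p * cnj (a p p')) * (cnj (x t q) * a q q') * F p' q' r r')"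
      by (intro sum.cong refl sum.swap)
    also have "\<dots> = (\<Sum>p'<d. \<Sum>p<d. \<Sum>q<d. \<Sum>q'<d. (x s p * cnj (a p p')) * (cnj (x t q) * a q q') * F p' q' r r')"
      by (rule sum.swap)
    also have "\<dots> = (\<Sum>p'<d. \<Sum>p<d. \<Sum>q'<d. \<Sum>q<d. (x s p * cnj (a p p')) * (cnj (x t q) * a q q') * F p' q' r r')"
      by (intro sum.cong refl sum.swap)
    also have "\<dots> = (\<Sum>p'<d. \<Sum>q'<d. \<Sum>p<d. \<Sum>q<d. (x s p * cnj (a p p')) * (cnj (x t q) * a q q') * F p' q' r r')"
      by (intro sum.cong refl sum.swap)
    also have "\<dots> = (\<Sum>p<d. \<Sum>q<d. x' s p * cnj (x' t q) * F p q r r')"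
      unfolding x'_def cnj_sum sum_product by (simp add: sum_distrib_right)
    finally show ?thesis .
  qed
  moreover have "sep_kernel {..<k} {..<d} (\<lambda>s t r r'. \<Sum>p<d. \<Sum>q<d. x' s p * cnj (x' t q) * F p q r r')"
    using assms unfolding keb_kernel_def by blast
  ultimately show "sep_kernel {..<k} {..<d}
    (\<lambda>s t r r'. \<Sum>p<d. \<Sum>q<d. x s p * cnj (x t q) * change_left d a F p q r r')" by simp
qed

text \<open>
  The quadratic form of the new kernel is the old one on a transformed vector. Applied to the second factor of
  each term of a separable kernel, this covers the change of basis on the output side.
\<close>

lemma pos_kernel_congruence:
  assumes "pos_kernel J K"
  shows "pos_kernel I (\<lambda>r s. \<Sum>r'\<in>J. \<Sum>s'\<in>J. cnj (b r r') * K r' s' * b s s')"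
proof -
  have "qform I (\<lambda>r s. \<Sum>r'\<in>J. \<Sum>s'\<in>J. cnj (b r r') * K r' s' * b s s') v
    = qform J K (\<lambda>s'. \<Sum>s\<in>I. b s s' * v s)" for v
  proof -
    have "qform I (\<lambda>r s. \<Sum>r'\<in>J. \<Sum>s'\<in>J. cnj (b r r') * K r' s' * b s s') v
      = (\<Sum>r'\<in>J. \<Sum>s'\<in>J. K r' s' * qform I (\<lambda>r s. cnj (b r r') * b s s') v)"
      by (simp only: qform_sum flip: qform_scale) (simp only: mult_ac)
    also have "\<dots> = qform J K (\<lambda>s'. \<Sum>s\<in>I. b s s' * v s)"
      unfolding qform_def
    proof (intro sum.cong refl)
      fix r' s'
      have "(\<Sum>a\<in>I. \<Sum>c\<in>I. cnj (v a) * (cnj (b a r') * b c s') * v c)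
        = cnj (\<Sum>s\<in>I. b s r' * v s) * (\<Sum>s\<in>I. b s s' * v s)"
        unfolding cnj_sum sum_product by (simp add: mult_ac)
      then show "K r' s' * (\<Sum>a\<in>I. \<Sum>c\<in>I. cnj (v a) * (cnj (b a r') * b c s') * v c)
        = cnj (\<Sum>s\<in>I. b s r' * v s) * K r' s' * (\<Sum>s\<in>I. b s s' * v s)" by simp
    qed
    finally show ?thesis .
  qed
  then show ?thesis using assms unfolding pos_kernel_def by simp
qed

lemma keb_kernel_change_right:
  assumes "keb_kernel k d F"
  shows "keb_kernel k d (change_right d b F)"
  unfolding keb_kernel_def
proof
  fix x :: "nat \<Rightarrow> nat \<Rightarrow> complex"
  define G where "G s t r r' = (\<Sum>p<d. \<Sum>q<d. x s p * cnj (x t q) * F p q r r')" for s t r r'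
  have "sep_kernel {..<k} {..<d} G" using assms unfolding keb_kernel_def G_def by blast
  then obtain N :: nat and A B where AB: "\<forall>n<N. pos_kernel {..<k} (A n) \<and> pos_kernel {..<d} (B n)"
    and G: "\<forall>s\<in>{..<k}. \<forall>t\<in>{..<k}. \<forall>r\<in>{..<d}. \<forall>r'\<in>{..<d}. G s t r r' = (\<Sum>n<N. A n s t * B n r r')"
    unfolding sep_kernel_def by blast
  define B' where "B' n r s = (\<Sum>r'<d. \<Sum>s'<d. cnj (b r r') * B n r' s' * b s s')" for n r s
  have B': "pos_kernel {..<d} (B' n)" if "n < N" for n
    unfolding B'_def using AB that by (intro pos_kernel_congruence) auto
  have "(\<Sum>p<d. \<Sum>q<d. x s p * cnj (x t q) * change_right d b F p q r r') = (\<Sum>n<N. A n s t * B' n r r')"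
    if st: "s < k" "t < k" for s t r r'
  proof -
    have "(\<Sum>p<d. \<Sum>q<d. x s p * cnj (x t q) * change_right d b F p q r r')
      = (\<Sum>p<d. \<Sum>q<d. \<Sum>u<d. \<Sum>v<d. cnj (b r u) * (x s p * cnj (x t q) * F p q u v) * b r' v)"
      unfolding change_right_def by (simp add: sum_distrib_left mult_ac)
    also have "\<dots> = (\<Sum>p<d. \<Sum>u<d. \<Sum>q<d. \<Sum>v<d. cnj (b r u) * (x s p * cnj (x t q) * F p q u v) * b r' v)"
      by (intro sum.cong refl sum.swap)
    also have "\<dots> = (\<Sum>u<d. \<Sum>p<d. \<Sum>q<d. \<Sum>v<d. cnj (b r u) * (x s p * cnj (x t q) * F p q u v) * b r' v)"
      by (rule sum.swap)
    also have "\<dots> = (\<Sum>u<d. \<Sum>p<d. \<Sum>v<d. \<Sum>q<d. cnj (b r u) * (x s p * cnj (x t q) * F p q u v) * b r' v)"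
      by (intro sum.cong refl sum.swap)
    also have "\<dots> = (\<Sum>u<d. \<Sum>v<d. \<Sum>p<d. \<Sum>q<d. cnj (b r u) * (x s p * cnj (x t q) * F p q u v) * b r' v)"
      by (intro sum.cong refl sum.swap)
    also have "\<dots> = (\<Sum>u<d. \<Sum>v<d. cnj (b r u) * G s t u v * b r' v)"
      unfolding G_def by (simp add: sum_distrib_left sum_distrib_right)
    also have "\<dots> = (\<Sum>u<d. \<Sum>v<d. \<Sum>n<N. A n s t * (cnj (b r u) * B n u v * b r' v))"
      using G st by (intro sum.cong refl) (simp add: sum_distrib_left sum_distrib_right mult_ac)
    also have "\<dots> = (\<Sum>u<d. \<Sum>n<N. \<Sum>v<d. A n s t * (cnj (b r u) * B n u v * b r' v))"
      by (intro sum.cong refl sum.swap)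
    also have "\<dots> = (\<Sum>n<N. \<Sum>u<d. \<Sum>v<d. A n s t * (cnj (b r u) * B n u v * b r' v))"
      by (rule sum.swap)
    also have "\<dots> = (\<Sum>n<N. A n s t * B' n r r')"
      unfolding B'_def by (simp add: sum_distrib_left)
    finally show ?thesis .
  qed
  then show "sep_kernel {..<k} {..<d}
    (\<lambda>s t r r'. \<Sum>p<d. \<Sum>q<d. x s p * cnj (x t q) * change_right d b F p q r r')"
    unfolding sep_kernel_def using AB B'
    by (intro exI[of _ N] exI[of _ A] exI[of _ B']) auto
qed

lemma change_left_right:
  "change_right d b (change_left d a F) p q r s
    = (\<Sum>y\<in>{..<d} \<times> {..<d}. \<Sum>z\<in>{..<d} \<times> {..<d}. cnj (a p (fst y) * b r (snd y)) *
        F (fst y) (fst z) (snd y) (snd z) * (a q (fst z) * b s (snd z)))"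
proof -
  have "change_right d b (change_left d a F) p q r s
    = (\<Sum>r'<d. \<Sum>s'<d. \<Sum>p'<d. \<Sum>q'<d. cnj (a p p' * b r r') * F p' q' r' s' * (a q q' * b s s'))"
    unfolding change_right_def change_left_def by (simp add: sum_distrib_left sum_distrib_right mult_ac)
  also have "\<dots> = (\<Sum>r'<d. \<Sum>p'<d. \<Sum>s'<d. \<Sum>q'<d. cnj (a p p' * b r r') * F p' q' r' s' * (a q q' * b s s'))"
    by (intro sum.cong refl sum.swap)
  also have "\<dots> = (\<Sum>p'<d. \<Sum>r'<d. \<Sum>s'<d. \<Sum>q'<d. cnj (a p p' * b r r') * F p' q' r' s' * (a q q' * b s s'))"
    by (rule sum.swap)
  also have "\<dots> = (\<Sum>p'<d. \<Sum>r'<d. \<Sum>q'<d. \<Sum>s'<d. cnj (a p p' * b r r') * F p' q' r' s' * (a q q' * b s s'))"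
    by (intro sum.cong refl sum.swap)
  finally show ?thesis by (simp only: sum.cartesian_product' fst_conv snd_conv)
qed

section \<open>Passage from matrices to kernels\<close>

lemma psd_pos_kernel:
  assumes "psd n A"
  shows "pos_kernel {..<n} (\<lambda>i j. A $$ (i, j))"
  unfolding pos_kernel_def
proof
  fix v :: "nat \<Rightarrow> complex"
  have A: "A \<in> carrier_mat n n" using assms by (simp add: psd_def)
  have "(A *\<^sub>v vec n v) \<bullet>c vec n v = qform {..<n} (\<lambda>i j. A $$ (i, j)) v"
    using A unfolding qform_def
    by (auto simp: scalar_prod_def lessThan_atLeast0 sum_distrib_left mult_ac intro!: sum.cong)
  moreover have "0 \<le> (A *\<^sub>v vec n v) \<bullet>c vec n v"
    using assms unfolding psd_def by (metis vec_carrier)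
  ultimately show "0 \<le> qform {..<n} (\<lambda>i j. A $$ (i, j)) v" by simp
qed

lemma psd_rank_one: "psd n (mat n n (\<lambda>(i, j). z i * cnj (z j)))" (is "psd n ?A")
  unfolding psd_def
proof (intro conjI ballI)
  show A: "?A \<in> carrier_mat n n" by simp
  show "mat_adjoint ?A = ?A"
  proof (rule eq_matI)
    fix i j assume "i < dim_row ?A" "j < dim_col ?A"
    then have ij: "i < n" "j < n" by auto
    show "mat_adjoint ?A $$ (i, j) = ?A $$ (i, j)"
      unfolding mat_adjoint_index[OF A ij] using ij by simp
  qed auto
  fix v :: "complex vec" assume v: "v \<in> carrier_vec n"
  have "(?A *\<^sub>v v) \<bullet>c v = qform {..<n} (\<lambda>i j. z i * cnj (z j)) (\<lambda>i. v $ i)"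
    using v unfolding qform_def
    by (auto simp: scalar_prod_def lessThan_atLeast0 sum_distrib_left mult_ac intro!: sum.cong)
  also have "0 \<le> \<dots>" unfolding qform_rank_one by (simp only: zero_le_complex_of_real_iff zero_le_power2)
  finally show "0 \<le> (?A *\<^sub>v v) \<bullet>c v" .
qed

lemma linear_mat_map_entries:
  assumes lin: "linear_mat_map d \<Phi>" and rs: "r < d" "s < d"
  shows "\<Phi> (mat d d f) $$ (r, s) = (\<Sum>p<d. \<Sum>q<d. f (p, q) * \<Phi> (mat_unit d p q) $$ (r, s))"
proof -
  define g where "g pq = f pq \<cdot>\<^sub>m mat_unit d (fst pq) (snd pq)" for pq
  have g: "g pq \<in> carrier_mat d d" for pq by (simp add: g_def mat_unit_def)
  have ms: "mat_sum d g S \<in> carrier_mat d d" for S by (simp add: mat_sum_def)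
  have \<Phi>: "\<Phi> A \<in> carrier_mat d d" if "A \<in> carrier_mat d d" for A
    using lin that by (simp add: linear_mat_map_def)
  have "\<Phi> (mat_sum d g S) $$ (r, s) = (\<Sum>pq\<in>S. \<Phi> (g pq) $$ (r, s))" if "finite S" for S
    using that
  proof induction
    case empty
    have "mat_sum d g {} = 0 \<cdot>\<^sub>m mat_sum d g {}" by (intro eq_matI) (auto simp: mat_sum_def)
    then have "\<Phi> (mat_sum d g {}) = 0 \<cdot>\<^sub>m \<Phi> (mat_sum d g {})"
      using lin ms[of "{}"] unfolding linear_mat_map_def by metis
    then have "\<Phi> (mat_sum d g {}) $$ (r, s) = (0 \<cdot>\<^sub>m \<Phi> (mat_sum d g {})) $$ (r, s)" by simp
    then show ?case using \<Phi>[OF ms[of "{}"]] rs by simp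
  next
    case (insert pq S)
    have "mat_sum d g (insert pq S) = g pq + mat_sum d g S"
      using insert.hyps g[of pq] by (intro eq_matI) (auto simp: mat_sum_def)
    then have "\<Phi> (mat_sum d g (insert pq S)) = \<Phi> (g pq) + \<Phi> (mat_sum d g S)"
      using lin g ms unfolding linear_mat_map_def by metis
    then show ?case
      using insert \<Phi>[OF g[of pq]] \<Phi>[OF ms[of S]] rs by simp
  qed
  from this[of "{..<d} \<times> {..<d}"]
  have "\<Phi> (mat_sum d g ({..<d} \<times> {..<d})) $$ (r, s) = (\<Sum>p<d. \<Sum>q<d. \<Phi> (g (p, q)) $$ (r, s))"
    by (simp add: sum.cartesian_product')
  moreover have "mat_sum d g ({..<d} \<times> {..<d}) = mat d d f"
  proof (rule eq_matI)
    fix i j assume "i < dim_row (mat d d f)" "j < dim_col (mat d d f)"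
    then have ij: "i < d" "j < d" by auto
    have "mat_sum d g ({..<d} \<times> {..<d}) $$ (i, j) = (\<Sum>p<d. \<Sum>q<d. g (p, q) $$ (i, j))"
      using ij by (simp add: mat_sum_def sum.cartesian_product')
    also have "\<dots> = (\<Sum>p<d. \<Sum>q<d. if q = j then (if p = i then f (i, j) else 0) else 0)"
      using ij by (intro sum.cong refl) (auto simp: g_def mat_unit_def)
    finally show "mat_sum d g ({..<d} \<times> {..<d}) $$ (i, j) = mat d d f $$ (i, j)"
      using ij by simp
  qed (auto simp: mat_sum_def)
  moreover have "\<Phi> (g (p, q)) $$ (r, s) = f (p, q) * \<Phi> (mat_unit d p q) $$ (r, s)" for p q
  proof -
    have u: "mat_unit d p q \<in> carrier_mat d d" by (simp add: mat_unit_def)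
    have "\<Phi> (g (p, q)) = f (p, q) \<cdot>\<^sub>m \<Phi> (mat_unit d p q)"
      using lin u unfolding linear_mat_map_def g_def by simp
    then show ?thesis using \<Phi>[OF u] rs by simp
  qed
  ultimately show ?thesis by simp
qed

lemma block_index_div_mod:
  fixes d i p :: nat
  assumes "i < d"
  shows "(p * d + i) div d = p" "(p * d + i) mod d = i"
  using assms by auto

text \<open>
  The hypothesis is applied to the rank-one matrix \<open>Z = z z\<^sup>*\<close>, where \<open>z\<close> is the concatenation of the vectors \<open>x s\<close>.
\<close>

lemma k_entanglement_breaking_kernel:
  assumes lin: "linear_mat_map d \<Phi>" and keb: "k_entanglement_breaking k d \<Phi>"
  shows "keb_kernel k d (\<lambda>p q r s. \<Phi> (mat_unit d p q) $$ (r, s))"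
  unfolding keb_kernel_def
proof
  fix x :: "nat \<Rightarrow> nat \<Rightarrow> complex"
  define z where "z i = x (i div d) (i mod d)" for i
  define Z where "Z = mat (k * d) (k * d) (\<lambda>(i, j). z i * cnj (z j))"
  have "psd (k * d) Z" unfolding Z_def by (rule psd_rank_one)
  then have "separable k d (id_tensor k d \<Phi> Z)"
    using keb unfolding k_entanglement_breaking_def by blast
  then obtain N :: nat and A B where AB: "\<forall>t<N. psd k (A t) \<and> psd d (B t)"
    and sum: "id_tensor k d \<Phi> Z = mat_sum (k * d) (\<lambda>t. kron (A t) (B t)) {..<N}"
    unfolding separable_def by blast
  have "(\<Sum>p<d. \<Sum>q<d. x s p * cnj (x t q) * \<Phi> (mat_unit d p q) $$ (r, r')) = (\<Sum>n<N. A n $$ (s, t) * B n $$ (r, r'))"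
    if "s < k" "t < k" "r < d" "r' < d" for s t r r'
  proof -
    have i: "s * d + r < k * d" "t * d + r' < k * d" using that by (auto simp: block_index_less)
    have "block d Z s t = mat d d (\<lambda>(p, q). x s p * cnj (x t q))"
      using that by (intro eq_matI) (auto simp: block_def Z_def z_def block_index_less block_index_div_mod)
    then have "id_tensor k d \<Phi> Z $$ (s * d + r, t * d + r') = \<Phi> (mat d d (\<lambda>(p, q). x s p * cnj (x t q))) $$ (r, r')"
      using that i by (simp add: id_tensor_def block_index_div_mod)
    also have "\<dots> = (\<Sum>p<d. \<Sum>q<d. x s p * cnj (x t q) * \<Phi> (mat_unit d p q) $$ (r, r'))"
      using linear_mat_map_entries[OF lin that(3,4)] by simp
    finally have 1: "id_tensor k d \<Phi> Z $$ (s * d + r, t * d + r')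
      = (\<Sum>p<d. \<Sum>q<d. x s p * cnj (x t q) * \<Phi> (mat_unit d p q) $$ (r, r'))" .
    have "mat_sum (k * d) (\<lambda>t. kron (A t) (B t)) {..<N} $$ (s * d + r, t * d + r')
      = (\<Sum>n<N. kron (A n) (B n) $$ (s * d + r, t * d + r'))"
      using i by (simp add: mat_sum_def)
    also have "\<dots> = (\<Sum>n<N. A n $$ (s, t) * B n $$ (r, r'))"
    proof (intro sum.cong refl)
      fix n assume "n \<in> {..<N}"
      then have "A n \<in> carrier_mat k k" "B n \<in> carrier_mat d d" using AB by (auto simp: psd_def)
      then show "kron (A n) (B n) $$ (s * d + r, t * d + r') = A n $$ (s, t) * B n $$ (r, r')"
        using i that by (auto simp: kron_def block_index_div_mod)
    qed
    finally show ?thesis using 1 sum by simp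
  qed
  then show "sep_kernel {..<k} {..<d}
    (\<lambda>s t r r'. \<Sum>p<d. \<Sum>q<d. x s p * cnj (x t q) * \<Phi> (mat_unit d p q) $$ (r, r'))"
    unfolding sep_kernel_def using AB psd_pos_kernel
    by (intro exI[of _ N] exI[of _ "\<lambda>n s t. A n $$ (s, t)"] exI[of _ "\<lambda>n r r'. B n $$ (r, r')"]) auto
qed

lemma choi_index:
  assumes lin: "linear_mat_map d \<Phi>" and lt: "p < d" "q < d" "r < d" "s < d"
  shows "choi d \<Phi> $$ (p * d + r, q * d + s) = \<Phi> (mat_unit d p q) $$ (r, s)"
proof -
  have i: "p * d + r < d * d" "q * d + s < d * d" using lt by (auto simp: block_index_less)
  have c: "\<Phi> (mat_unit d i j) \<in> carrier_mat d d" for i j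
    using lin by (auto simp: linear_mat_map_def mat_unit_def)
  have "choi d \<Phi> $$ (p * d + r, q * d + s)
    = (\<Sum>i<d. \<Sum>j<d. kron (mat_unit d i j) (\<Phi> (mat_unit d i j)) $$ (p * d + r, q * d + s))"
    using i by (simp add: choi_def mat_sum_def sum.cartesian_product')
  also have "\<dots> = (\<Sum>i<d. \<Sum>j<d. if q = j then (if p = i then \<Phi> (mat_unit d p q) $$ (r, s) else 0) else 0)"
  proof (intro sum.cong refl)
    fix i j
    have "dim_row (\<Phi> (mat_unit d i j)) = d" "dim_col (\<Phi> (mat_unit d i j)) = d" using c[of i j] by auto
    then show "kron (mat_unit d i j) (\<Phi> (mat_unit d i j)) $$ (p * d + r, q * d + s)
      = (if q = j then (if p = i then \<Phi> (mat_unit d p q) $$ (r, s) else 0) else 0)"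
      using i lt by (auto simp: kron_def mat_unit_def block_index_div_mod)
  qed
  finally show ?thesis using lt by simp
qed

lemma bij_betw_block_index:
  fixes d :: nat
  shows "bij_betw (\<lambda>i. (i div d, i mod d)) {..<d * d} ({..<d} \<times> {..<d})"
  by (rule bij_betw_byWitness[where f' = "\<lambda>(p, r). p * d + r"])
    (auto simp: block_index_div_mod block_index_less less_mult_imp_div_less intro!: mod_less_divisor
      intro: Nat.gr0I)

text \<open>
  Nonnegativity keeps the shorter list sorted after zeros have been appended, and makes the appended zeros
  harmless: its partial sums just stop growing at \<open>d\<close>.
\<close>

lemma weakly_majorizedI:
  assumes xs: "sorted (rev xs)" "length xs = n" and ys: "sorted (rev ys)" "length ys = d" "d \<le> n"
    and nonneg: "\<And>i. i < d \<Longrightarrow> 0 \<le> ys ! i"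
    and le: "\<And>l. l \<le> n \<Longrightarrow> (\<Sum>j<l. xs ! j) \<le> (\<Sum>i<min l d. ys ! i)"
  shows "weakly_majorized xs ys"
proof -
  have dec: "decreasing zs = zs" if "sorted (rev zs)" for zs
  proof -
    have "sort zs = rev zs" by (rule properties_for_sort) (use that in auto)
    then show ?thesis by (simp add: decreasing_def)
  qed
  have max: "max (length xs) (length ys) = n" using xs ys by simp
  have padx: "pad_zeros n xs = xs" using xs by (simp add: pad_zeros_def)
  have "\<forall>y\<in>set ys. 0 \<le> y" using nonneg ys(2) by (auto simp: in_set_conv_nth)
  then have "sorted (rev (pad_zeros n ys))"
    using ys(1) by (auto simp: pad_zeros_def sorted_append)
  note pady = dec[OF this]
  have tx: "sum_list (take l xs) = (\<Sum>j<l. xs ! j)" if "l \<le> n" for l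
    using that xs(2) by (simp add: sum_list_sum_nth lessThan_atLeast0 min_def)
  have ty: "sum_list (take l (pad_zeros n ys)) = (\<Sum>i<min l d. ys ! i)" for l
  proof -
    have "sum_list (take l (pad_zeros n ys)) = sum_list (take l ys)"
      by (simp add: pad_zeros_def take_replicate sum_list_replicate)
    then show ?thesis using ys(2) by (simp add: sum_list_sum_nth lessThan_atLeast0 min.commute)
  qed
  show ?thesis
    unfolding weakly_majorized_def Let_def max padx pady dec[OF xs(1)] ty
    using tx le by auto
qed

lemma eigenvalue_list_antimono:
  assumes "i \<le> j" "j < length (eigenvalue_list A)"
  shows "eigenvalue_list A ! j \<le> eigenvalue_list A ! i"
  using sorted_rev_nth_mono[OF sorted_rev_eigenvalue_list] assms by blast

theorem theorem6p2:
  fixes d k :: nat and \<Phi> :: "complex mat \<Rightarrow> complex mat"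
  assumes "1 \<le> k" and "k \<le> d"
    and "linear_mat_map d \<Phi>"
    and "k_entanglement_breaking k d \<Phi>"
  shows "weakly_majorized_mat (choi d \<Phi>) (of_nat (d - k + 1) \<cdot>\<^sub>m ptrace1 d (choi d \<Phi>))
       \<and> weakly_majorized_mat (choi d \<Phi>) (of_nat (d - k + 1) \<cdot>\<^sub>m ptrace2 d (choi d \<Phi>))"
proof -
  let ?I = "{..<d} \<times> {..<d}"
  define C where "C = choi d \<Phi>"
  define F where "F p q r s = \<Phi> (mat_unit d p q) $$ (r, s)" for p q r s
  define c where "c = real (d - k + 1)"
  have c: "0 < c" by (simp add: c_def)
  have keb: "keb_kernel k d F"
    using k_entanglement_breaking_kernel[OF assms(3,4)] unfolding F_def .
  have herm: "F q p s r = cnj (F p q r s)" if "p < d" "q < d" "r < d" "s < d" for p q r s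
    using keb_kernel_hermitian[OF keb _ that] assms(1) by simp
  have C: "C \<in> carrier_mat (d * d) (d * d)" by (simp add: C_def choi_def mat_sum_def)
  have C_index: "C $$ (p * d + r, q * d + s) = F p q r s" if "p < d" "q < d" "r < d" "s < d" for p q r s
    unfolding C_def F_def by (rule choi_index[OF assms(3) that])
  have C_index': "C $$ (i, j) = F (i div d) (j div d) (i mod d) (j mod d)" if "i < d * d" "j < d * d" for i j
    using C_index[of "i div d" "j div d" "i mod d" "j mod d"] that assms(1,2)
    by (simp add: less_mult_imp_div_less)
  have hermitian: "mat_adjoint A = A" if A: "A \<in> carrier_mat n n"
    and "\<And>i j. i < n \<Longrightarrow> j < n \<Longrightarrow> A $$ (j, i) = cnj (A $$ (i, j))" for A :: "complex mat" and n
  proof (rule eq_matI)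
    fix i j assume "i < dim_row A" "j < dim_col A"
    then have ij: "i < n" "j < n" using A by auto
    show "mat_adjoint A $$ (i, j) = A $$ (i, j)"
      unfolding mat_adjoint_index[OF A ij] using that(2)[OF ij(2,1)] by simp
  qed (use A in auto)
  define P1 where "P1 = of_nat (d - k + 1) \<cdot>\<^sub>m ptrace1 d C"
  define P2 where "P2 = of_nat (d - k + 1) \<cdot>\<^sub>m ptrace2 d C"
  have P: "P1 \<in> carrier_mat d d" "P2 \<in> carrier_mat d d"
    by (simp_all add: P1_def P2_def ptrace1_def ptrace2_def)
  have P1: "P1 $$ (r, s) = of_real c * (\<Sum>p<d. F p p r s)" if "r < d" "s < d" for r s
    using that by (simp add: P1_def ptrace1_def c_def C_index)
  have P2: "P2 $$ (p, q) = of_real c * (\<Sum>r<d. F p q r r)" if "p < d" "q < d" for p q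
    using that by (simp add: P2_def ptrace2_def c_def C_index)
  have "mat_adjoint C = C"
  proof (rule hermitian[OF C])
    fix i j assume ij: "i < d * d" "j < d * d"
    then have "0 < d" by (cases d) auto
    then show "C $$ (j, i) = cnj (C $$ (i, j))"
      using herm[of "i div d" "j div d" "i mod d" "j mod d"] ij
      unfolding C_index'[OF ij] C_index'[OF ij(2,1)] by (simp add: less_mult_imp_div_less)
  qed
  note C_spec = hermitian_spectral_decomposition[OF C this]
  have "mat_adjoint P1 = P1"
  proof (rule hermitian[OF P(1)])
    fix i j assume ij: "i < d" "j < d"
    have "(\<Sum>p<d. F p p j i) = (\<Sum>p<d. cnj (F p p i j))"
      using ij by (intro sum.cong refl herm) auto
    then show "P1 $$ (j, i) = cnj (P1 $$ (i, j))" using ij by (simp add: P1)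
  qed
  note P1_spec = hermitian_spectral_decomposition[OF P(1) this]
  have "mat_adjoint P2 = P2"
  proof (rule hermitian[OF P(2)])
    fix i j assume ij: "i < d" "j < d"
    have "(\<Sum>r<d. F j i r r) = (\<Sum>r<d. cnj (F i j r r))"
      using ij by (intro sum.cong refl herm) auto
    then show "P2 $$ (j, i) = cnj (P2 $$ (i, j))" using ij by (simp add: P2)
  qed
  note P2_spec = hermitian_spectral_decomposition[OF P(2) this]
  define xs ys1 ys2 where "xs = eigenvalue_list C" and "ys1 = eigenvalue_list P1" and "ys2 = eigenvalue_list P2"
  obtain u where u: "orthonormal_basis {..<d * d} {..<d * d} u"
    "\<And>i j. i < d * d \<Longrightarrow> j < d * d \<Longrightarrow> C $$ (i, j) = (\<Sum>t<d * d. of_real (xs ! t) * (u t i * cnj (u t j)))"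
    using C_spec(2) unfolding xs_def by blast
  obtain b where b: "orthonormal_basis {..<d} {..<d} b"
    "\<And>i j. i < d \<Longrightarrow> j < d \<Longrightarrow> P1 $$ (i, j) = (\<Sum>t<d. of_real (ys1 ! t) * (b t i * cnj (b t j)))"
    using P1_spec(2) unfolding ys1_def by blast
  obtain a where a: "orthonormal_basis {..<d} {..<d} a"
    "\<And>i j. i < d \<Longrightarrow> j < d \<Longrightarrow> P2 $$ (i, j) = (\<Sum>t<d. of_real (ys2 ! t) * (a t i * cnj (a t j)))"
    using P2_spec(2) unfolding ys2_def by blast
  \<comment> \<open>In these bases both partial traces of the Choi kernel are diagonal, with their eigenvalues in decreasing order.\<close>
  define F' where "F' = change_right d b (change_left d a F)"
  have keb': "keb_kernel k d F'"
    unfolding F'_def by (intro keb_kernel_change_right keb_kernel_change_left keb)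
  define m n where "m p = ys2 ! p / c" and "n p = ys1 ! p / c" for p
  have tr2: "(\<Sum>r<d. F' p q r r) = (if p = q then of_real (m p) else 0)" if "p < d" "q < d" for p q
  proof -
    have "(\<Sum>r<d. F' p q r r) = (\<Sum>r<d. change_left d a F p q r r)"
      unfolding F'_def change_right_def by (rule orthonormal_basis_trace[OF b(1) finite_lessThan])
    also have "\<dots> = (\<Sum>p'<d. \<Sum>q'<d. cnj (a p p') * (\<Sum>r<d. F p' q' r r) * a q q')"
      unfolding change_left_def sum_distrib_left sum_distrib_right
      by (subst sum.swap, rule sum.cong[OF refl], rule sum.swap)
    also have "\<dots> = (if p = q then of_real (m p) else 0)"
    proof (rule orthonormal_basis_diagonalizes[OF a(1) finite_lessThan])
      fix i j assume "i \<in> {..<d}" "j \<in> {..<d}"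
      then have "of_real c * (\<Sum>r<d. F i j r r) = (\<Sum>t<d. of_real (ys2 ! t) * (a t i * cnj (a t j)))"
        using a(2)[of i j] P2[of i j] by simp
      then show "(\<Sum>r<d. F i j r r) = (\<Sum>t<d. of_real (m t) * (a t i * cnj (a t j)))"
        using c by (simp add: m_def field_simps flip: sum_divide_distrib)
    qed (use that in auto)
    finally show ?thesis .
  qed
  have tr1: "(\<Sum>p<d. F' p p r s) = (if r = s then of_real (n r) else 0)" if "r < d" "s < d" for r s
  proof -
    have "(\<Sum>p<d. F' p p r s) = (\<Sum>r'<d. \<Sum>s'<d. cnj (b r r') * (\<Sum>p<d. change_left d a F p p r' s') * b s s')"
      unfolding F'_def change_right_def sum_distrib_left sum_distrib_right
      by (subst sum.swap, rule sum.cong[OF refl], rule sum.swap)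
    also have "\<dots> = (\<Sum>r'<d. \<Sum>s'<d. cnj (b r r') * (\<Sum>p<d. F p p r' s') * b s s')"
      unfolding change_left_def orthonormal_basis_trace[OF a(1) finite_lessThan] ..
    also have "\<dots> = (if r = s then of_real (n r) else 0)"
    proof (rule orthonormal_basis_diagonalizes[OF b(1) finite_lessThan])
      fix i j assume "i \<in> {..<d}" "j \<in> {..<d}"
      then have "of_real c * (\<Sum>p<d. F p p i j) = (\<Sum>t<d. of_real (ys1 ! t) * (b t i * cnj (b t j)))"
        using b(2)[of i j] P1[of i j] by simp
      then show "(\<Sum>p<d. F p p i j) = (\<Sum>t<d. of_real (n t) * (b t i * cnj (b t j)))"
        using c by (simp add: n_def field_simps flip: sum_divide_distrib)
    qed (use that in auto)
    finally show ?thesis .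
  qed
  define h where "h i = (i div d, i mod d)" for i
  have h: "bij_betw h {..<d * d} ?I" unfolding h_def by (rule bij_betw_block_index)
  have inv_h: "inv_into {..<d * d} h (p, r) = p * d + r" if "p < d" "r < d" for p r
    using that h by (intro inv_into_f_eq) (auto simp: bij_betw_def h_def block_index_less block_index_div_mod)
  define U where "U t x = u t (inv_into {..<d * d} h x)" for t x
  have U: "orthonormal_basis {..<d * d} ?I U"
    unfolding U_def by (rule orthonormal_basis_reindex[OF h u(1)])
  have F_U: "F (fst x) (fst y) (snd x) (snd y) = (\<Sum>t<d * d. of_real (xs ! t) * (U t x * cnj (U t y)))"
    if "x \<in> ?I" "y \<in> ?I" for x y
    using that by (auto simp: U_def inv_h C_index[symmetric] u(2) block_index_less)
  define g where "g x y = a (fst x) (fst y) * b (snd x) (snd y)" for x y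
  have g: "orthonormal_basis ?I ?I g" unfolding g_def by (rule orthonormal_basis_product[OF a(1) b(1)])
  have U': "orthonormal_basis {..<d * d} ?I (\<lambda>t x. cip ?I (g x) (U t))"
    by (rule orthonormal_basis_compose[OF _ _ g U]) auto
  have F'_U: "F' (fst x) (fst y) (snd x) (snd y)
      = (\<Sum>t<d * d. of_real (xs ! t) * (cip ?I (g x) (U t) * cnj (cip ?I (g y) (U t))))" for x y
    unfolding F'_def change_left_right using spectral_compose[where g = g and x = x and y = y, OF F_U] by (simp add: g_def)
  have len: "length xs = d * d" "length ys1 = d" "length ys2 = d"
    using C_spec(1) P1_spec(1) P2_spec(1) by (simp_all add: xs_def ys1_def ys2_def)
  have mono: "m j \<le> m i" "n j \<le> n i" if "i \<le> j" "j < d" for i j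
    using eigenvalue_list_antimono[of i j P1] eigenvalue_list_antimono[of i j P2] that len c
    by (auto simp: m_def n_def ys1_def ys2_def divide_right_mono)
  have blocks: "0 \<le> F' p p r r" if "p < d" "r < d" for p r
    using pos_kernel_diag_nonneg[OF _ keb_kernel_diagonal_block[OF keb' _ that(1)], of r] that assms(1) by simp
  have m: "0 \<le> m p" if "p < d" for p
  proof -
    have "0 \<le> (\<Sum>r<d. F' p p r r)" using blocks that by (intro sum_nonneg) auto
    then show ?thesis unfolding tr2[OF that that] by (simp add: less_eq_complex_def)
  qed
  have n: "0 \<le> n r" if "r < d" for r
  proof -
    have "0 \<le> (\<Sum>p<d. F' p p r r)" using blocks that by (intro sum_nonneg) auto
    then show ?thesis unfolding tr1[OF that that] by (simp add: less_eq_complex_def)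
  qed
  have dd: "d \<le> d * d" by (cases d) auto
  have ys: "0 \<le> ys1 ! i" "0 \<le> ys2 ! i" if "i < d" for i
    using m[OF that] n[OF that] c by (simp_all add: m_def n_def zero_le_divide_iff)
  have cancel: "c * m i = ys2 ! i" "c * n i = ys1 ! i" for i using c by (simp_all add: m_def n_def)
  note sorted = sorted_rev_eigenvalue_list[of C, folded xs_def]
    sorted_rev_eigenvalue_list[of P1, folded ys1_def] sorted_rev_eigenvalue_list[of P2, folded ys2_def]
  note majorization = keb_kernel_majorization[OF keb' assms(1,2) tr2 tr1 mono U' _ F'_U,
      folded c_def, unfolded cancel]
  have "weakly_majorized xs ys1"
  proof (rule weakly_majorizedI[OF sorted(1) len(1) sorted(2) len(2) dd ys(1)])
    show "(\<Sum>j<l. xs ! j) \<le> (\<Sum>i<min l d. ys1 ! i)" if "l \<le> d * d" for l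
      using that by (intro majorization(2))
  qed
  moreover have "weakly_majorized xs ys2"
  proof (rule weakly_majorizedI[OF sorted(1) len(1) sorted(3) len(3) dd ys(2)])
    show "(\<Sum>j<l. xs ! j) \<le> (\<Sum>i<min l d. ys2 ! i)" if "l \<le> d * d" for l
      using that by (intro majorization(1))
  qed
  ultimately show ?thesis
    unfolding weakly_majorized_mat_def xs_def ys1_def ys2_def P1_def P2_def C_def by simp
qed

end
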